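(* Let $1 \leq p < n $, $1\le q\le p$, and let $w\in A_{q,\mathcal R}$ in $\mathbb{R}^n$ be a nontrivial weight, i.e. $[w]_{A_{\infty,\mathcal R}}>1$. Fix $\delta>0$ and let $p_w^*$ be defined by $$\frac{1}{p} -\frac{1}{ p_w^* }=\frac{\delta}{n}\,\frac{1}{q+\log [w]_{A_{q,\mathcal R}}},$$ where it is understood that $\delta$ is such that $0<p_w^*<\infty$. Let $a$ be the functional on $\mathcal R$ defined by $$a(R)=d(R)^\delta\left(\frac{\mu(R)}{w(R)} \right)^{1/p},$$ where $\mu $ is any Radon measure in $\mathbb{R}^n$. Suppose that the locally integrable function $f$ satisfies $$\frac{1}{|R|}\int_{R} |f-P_{R}f|\,dx \le a(R)\qquad\text{for every } R\in\mathcal R.$$ Then there exists a constant $C_n$, depending only on the dimension $n$ (and on the fixed degree $m$ in the definition of $P_R$), such that for every $R\in\mathcal R$, $$\left( \frac{1}{ w(R) } \int_{ R } |f -P_{R}f|^{p_w^*}\,w\,dx\right)^{\frac{1}{p_w^*}} \leq B_{w,q}\, C_n\, \frac{1}{\delta}\, a(R),\qquad B_{w,q}=\frac{1+ \log\big([w]_{A_{q,\mathcal R}}^{1/q}\big)}{ \log\big([w]_{A_{q,\mathcal R}}^{1/q}\big)}.$$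
   Context: $\mathcal R$ is the family of rectangles in $\mathbb{R}^n$, i.e. $n$-fold products of bounded intervals of $\mathbb R$; $d(R)$ is the diameter of $R$ and $|R|$ its Lebesgue measure. A weight is a nonnegative locally integrable function $w$, and $w(E)=\int_E w\,dx$. For $1<q<\infty$, $[w]_{A_{q,\mathcal R}}:=\sup_{R\in\mathcal R}\big(\frac1{|R|}\int_R w\big)\big(\frac1{|R|}\int_R w^{-\frac1{q-1}}\big)^{q-1}$; $[w]_{A_{1,\mathcal R}}$ is the smallest $c$ with $\frac1{|R|}\int_R w\le c\,\operatorname{ess\,inf}_R w$ for all $R\in\mathcal R$. $A_{q,\mathcal R}$ is the class of weights for which $[w]_{A_{q,\mathcal R}}<\infty$. Further, $[w]_{A_{\infty,\mathcal R}}:=\sup_{R\in\mathcal R}\frac1{w(R)}\int_R M_s(w\chi_R)\,dx$, where $M_s g(x)=\sup_{\mathcal R\ni R\ni x}\frac1{|R|}\int_R|g|$. The polynomial $P_Rf$: fix an integer $m\ge0$ and let $\mathcal P_m$ be the space of polynomials in $n$ variables of degree at most $m$, with inner product $\langle f,g\rangle_R=\frac1{|R|}\int_R fg\,dx$. If $\{\phi_\alpha\}$ is an orthonormal basis of $\mathcal P_m$ for this inner product, then $P_Rf=\sum_\alpha\big(\frac1{|R|}\int_R f\phi_\alpha\,dx\big)\phi_\alpha$. (For $m=0$, $P_Rf=f_R$ is the average.) *)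

theory Defs
  imports "HOL-Analysis.Analysis"
begin

text \<open>
  Sides may be open, closed or half-open, but have nonempty interior: the statement divides by
  the measure of a rectangle.
\<close>
definition rectangles :: "(real ^ 'n) set set" where
  "rectangles = {R. \<exists>I :: 'n \<Rightarrow> real set.
     (\<forall>i. is_interval (I i) \<and> bounded (I i) \<and> interior (I i) \<noteq> {}) \<and>
     R = {x. \<forall>i. x $ i \<in> I i}}"

definition locally_integrable :: "(real ^ 'n \<Rightarrow> real) \<Rightarrow> bool" where
  "locally_integrable f \<longleftrightarrow> (\<forall>K. compact K \<longrightarrow> set_integrable lebesgue K f)"

definition weight :: "(real ^ 'n \<Rightarrow> real) \<Rightarrow> bool" where
  "weight w \<longleftrightarrow> (\<forall>x. 0 \<le> w x) \<and> locally_integrable w"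

definition wmeas :: "(real ^ 'n \<Rightarrow> real) \<Rightarrow> (real ^ 'n) set \<Rightarrow> real" where
  "wmeas w E = set_lebesgue_integral lebesgue E w"

definition avg :: "(real ^ 'n) set \<Rightarrow> (real ^ 'n \<Rightarrow> real) \<Rightarrow> real" where
  "avg R f = set_lebesgue_integral lebesgue R f / measure lebesgue R"

definition navg :: "(real ^ 'n) set \<Rightarrow> (real ^ 'n \<Rightarrow> ennreal) \<Rightarrow> ennreal" where
  "navg R g = set_nn_integral lebesgue R g / emeasure lebesgue R"

text \<open>
  Real powers on \<open>[0, \<infinity>]\<close>, with \<open>0\<close> and \<open>\<infinity>\<close> exchanged by negative exponents. In the
  \<open>A\<^sub>q\<close> constant this makes the negative power of a weight infinite where the weight vanishes
  (the real \<open>powr\<close> would give \<open>0\<close> there).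
\<close>
definition enn_powr :: "ennreal \<Rightarrow> real \<Rightarrow> ennreal" where
  "enn_powr x r =
    (if r = 0 then 1
     else if x = 0 then (if r < 0 then \<infinity> else 0)
     else if x = \<infinity> then (if r < 0 then 0 else \<infinity>)
     else ennreal (enn2real x powr r))"

definition ess_inf_on :: "(real ^ 'n) set \<Rightarrow> (real ^ 'n \<Rightarrow> real) \<Rightarrow> ennreal" where
  "ess_inf_on R w = Sup {t. AE x in lebesgue. x \<in> R \<longrightarrow> t \<le> ennreal (w x)}"

definition A1_const :: "(real ^ 'n \<Rightarrow> real) \<Rightarrow> ennreal" where
  "A1_const w =
     Inf {c. \<forall>R\<in>rectangles. navg R (\<lambda>x. ennreal (w x)) \<le> c * ess_inf_on R w}"

definition Aq_const :: "real \<Rightarrow> (real ^ 'n \<Rightarrow> real) \<Rightarrow> ennreal" where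
  "Aq_const q w =
    (if q = 1 then A1_const w
     else (SUP R\<in>rectangles.
       navg R (\<lambda>x. ennreal (w x)) *
       enn_powr (navg R (\<lambda>x. enn_powr (ennreal (w x)) (- 1 / (q - 1)))) (q - 1)))"

definition Aq_class :: "real \<Rightarrow> (real ^ 'n \<Rightarrow> real) set" where
  "Aq_class q = {w. weight w \<and> Aq_const q w < \<infinity>}"

definition strong_maximal :: "(real ^ 'n \<Rightarrow> real) \<Rightarrow> real ^ 'n \<Rightarrow> ennreal" where
  "strong_maximal g x = (SUP R\<in>{R \<in> rectangles. x \<in> R}. navg R (\<lambda>y. ennreal \<bar>g y\<bar>))"

definition Ainf_const :: "(real ^ 'n \<Rightarrow> real) \<Rightarrow> ennreal" where
  "Ainf_const w = (SUP R\<in>rectangles.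
     set_nn_integral lebesgue R (strong_maximal (\<lambda>y. w y * indicator R y)) /
     set_nn_integral lebesgue R (\<lambda>x. ennreal (w x)))"

definition radon_measure :: "(real ^ 'n) measure \<Rightarrow> bool" where
  "radon_measure \<mu> \<longleftrightarrow>
     sets \<mu> = sets borel \<and>
     (\<forall>K. compact K \<longrightarrow> emeasure \<mu> K < \<infinity>) \<and>
     (\<forall>B\<in>sets borel. emeasure \<mu> B = (SUP K\<in>{K. compact K \<and> K \<subseteq> B}. emeasure \<mu> K))"

definition multi_indices :: "nat \<Rightarrow> ('n::finite \<Rightarrow> nat) set" where
  "multi_indices m = {\<alpha>. (\<Sum>i\<in>UNIV. \<alpha> i) \<le> m}"

lemma finite_multi_indices: "finite (multi_indices m :: ('n::finite \<Rightarrow> nat) set)"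
proof (rule finite_subset)
  show "(multi_indices m :: ('n \<Rightarrow> nat) set) \<subseteq> (UNIV \<rightarrow>\<^sub>E {..m})"
  proof
    fix \<alpha> :: "'n \<Rightarrow> nat"
    assume "\<alpha> \<in> multi_indices m"
    moreover have "\<alpha> i \<le> (\<Sum>i\<in>UNIV. \<alpha> i)" for i
      by (rule member_le_sum) auto
    ultimately show "\<alpha> \<in> UNIV \<rightarrow>\<^sub>E {..m}"
      by (auto simp: multi_indices_def intro: order_trans)
  qed
qed (auto intro: finite_PiE)

definition poly_space :: "nat \<Rightarrow> (real ^ 'n \<Rightarrow> real) set" where
  "poly_space m = {p. \<exists>c. p = (\<lambda>x. \<Sum>\<alpha>\<in>multi_indices m. c \<alpha> * (\<Prod>i\<in>UNIV. (x $ i) ^ \<alpha> i))}"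

definition orthonormal_basis ::
    "nat \<Rightarrow> (real ^ 'n) set \<Rightarrow> (real ^ 'n \<Rightarrow> real) set \<Rightarrow> bool" where
  "orthonormal_basis m R \<Phi> \<longleftrightarrow>
     finite \<Phi> \<and> \<Phi> \<subseteq> poly_space m \<and>
     (\<forall>\<phi>\<in>\<Phi>. \<forall>\<psi>\<in>\<Phi>. avg R (\<lambda>x. \<phi> x * \<psi> x) = (if \<phi> = \<psi> then 1 else 0)) \<and>
     (\<forall>p\<in>poly_space m. \<exists>c. p = (\<lambda>x. \<Sum>\<phi>\<in>\<Phi>. c \<phi> * \<phi> x))"

text \<open>The value does not depend on the orthonormal basis that is chosen.\<close>
definition poly_proj ::
    "nat \<Rightarrow> (real ^ 'n) set \<Rightarrow> (real ^ 'n \<Rightarrow> real) \<Rightarrow> real ^ 'n \<Rightarrow> real" where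
  "poly_proj m R f =
     (let \<Phi> = (SOME \<Phi>. orthonormal_basis m R \<Phi>)
      in (\<lambda>x. \<Sum>\<phi>\<in>\<Phi>. avg R (\<lambda>y. f y * \<phi> y) * \<phi> x))"

definition rect_functional ::
    "real \<Rightarrow> real \<Rightarrow> (real ^ 'n \<Rightarrow> real) \<Rightarrow> (real ^ 'n) measure \<Rightarrow> (real ^ 'n) set \<Rightarrow> real" where
  "rect_functional \<delta> p w \<mu> R =
     diameter R powr \<delta> * (measure \<mu> R / wmeas w R) powr (1 / p)"

definition B_const :: "real \<Rightarrow> (real ^ 'n \<Rightarrow> real) \<Rightarrow> real" where
  "B_const q w =
     (1 + ln (enn2real (Aq_const q w) powr (1 / q))) / ln (enn2real (Aq_const q w) powr (1 / q))"

end

theory Submission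
  imports Defs
begin

text \<open>
  Every rectangle is, up to a null set, an open box \<open>R\<close>, which is bisected repeatedly into
  \<open>2\<^sup>n\<close> similar boxes. Passing from a dyadic box \<open>Q\<close> to a child changes the polynomial by
  at most a constant times \<open>a(Q)\<close>, so almost everywhere \<open>|f - P\<^sub>R f|\<close> is at most a constant
  times the sum over all generations of \<open>a(Q(x))\<close>, where \<open>Q(x)\<close> is the box of that generation
  containing \<open>x\<close>; that the remainder tends to zero in \<open>L\<^sup>1(dx)\<close> follows from the \<open>A\<^sub>q\<close> condition
  and \<open>q \<le> p\<close>. The lower bound for \<open>w(Q)/w(R)\<close> given by \<open>A\<^sub>q\<close> makes
  the \<open>L\<^sup>r(w)\<close> norms of the generations (\<open>r = p\<^sub>w\<^sup>*\<close>) decay geometrically with ratio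
  \<open>2 powr (- \<delta> / B\<^bsub>w,q\<^esub>)\<close>, and summing the geometric series gives the factor
  \<open>B\<^bsub>w,q\<^esub> / \<delta>\<close>, with a constant that is uniform for \<open>\<delta>\<close> in bounded sets.

  For \<open>\<delta>\<close> beyond a threshold depending on \<open>n\<close> and \<open>m\<close> only, \<open>f\<close> is a polynomial almost
  everywhere on \<open>R\<close>: the oscillation on a box is at most a constant times the
  oscillation on one of its overlapping corner boxes, and iterating this forces it to vanish.
\<close>

section \<open>Polynomials and finite differences\<close>

text \<open>The target exponent \<open>r\<close> enters through two identities. With \<tau> = 1/p -
  1/r one has r/p = 1 + r \<tau>: in a(Q)^r w(Q) one power of \<mu>(Q) is kept for additivity over a
  generation, and the surplus r \<tau> is spent on \<mu>(Q) \<le> \<mu>(R) and on the lower bound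
  for w(Q). Moreover \<kappa> = \<delta> - n q \<tau>, which equals \<delta>/B, is what is left of
  the gain from the diameter after that lower bound has been paid for. The remainder f - P f on
  small boxes has to be controlled in L^1(dx), because no integrability of f against w is known
  beforehand, whereas a(Q) sums naturally in L^p(w); \<open>interpolation\<close> bridges the two.
  The dyadic argument bounds A^\<tau> only by e^\<delta> and 1/(1 - 2^(-\<kappa>)) only by (\<delta>
  + 2)/\<kappa>, so it is not uniform for large \<delta>. Dyadic boxes are of no use there: f could
  be a different polynomial on each child. Overlapping boxes share a core on which their polynomials
  can be compared, and the mean of a polynomial over the core controls it on the whole box.\<close>

definition fdiff :: "nat \<Rightarrow> (nat \<Rightarrow> real) \<Rightarrow> real" where
  "fdiff N g = (\<Sum>j\<le>N. (-1) ^ j * real (N choose j) * g j)"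

lemma fdiff_Suc: "fdiff (Suc N) g = fdiff N g - fdiff N (\<lambda>j. g (Suc j))"
proof -
  have "fdiff (Suc N) g = g 0 + (\<Sum>j\<le>N. (-1) ^ Suc j * real (Suc N choose Suc j) * g (Suc j))"
    unfolding fdiff_def by (subst sum.atMost_Suc_shift) simp
  also have "\<dots> = (g 0 + (\<Sum>j\<le>N. (-1) ^ Suc j * real (N choose Suc j) * g (Suc j)))
      - fdiff N (\<lambda>j. g (Suc j))"
    by (simp add: fdiff_def algebra_simps sum.distrib sum_negf sum_subtractf)
  also have "g 0 + (\<Sum>j\<le>N. (-1) ^ Suc j * real (N choose Suc j) * g (Suc j))
      = (\<Sum>j\<le>Suc N. (-1) ^ j * real (N choose j) * g j)"
    by (subst sum.atMost_Suc_shift) simp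
  also have "\<dots> = fdiff N g" by (simp add: fdiff_def)
  finally show ?thesis .
qed

text \<open>The absorption identity for binomial coefficients. Along a line each coordinate is
  affine in the node index, so this is the reason why multiplication by a coordinate raises the
  order of vanishing differences by only one.\<close>

lemma fdiff_mult_index: "fdiff (Suc N) (\<lambda>j. real j * g j) = - real (Suc N) * fdiff N (\<lambda>j. g (Suc j))"
proof -
  have *: "real (Suc N choose Suc j) * real (Suc j) = real (Suc N) * real (N choose j)" for j
    unfolding of_nat_mult[symmetric] using Suc_times_binomial[of j N] by (simp only: mult.commute)
  have "fdiff (Suc N) (\<lambda>j. real j * g j)
     = (\<Sum>j\<le>N. (-1) ^ Suc j * (real (Suc N choose Suc j) * real (Suc j)) * g (Suc j))"
    unfolding fdiff_def by (subst sum.atMost_Suc_shift) (simp add: mult.assoc)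
  also have "\<dots> = (\<Sum>j\<le>N. - real (Suc N) * ((-1) ^ j * real (N choose j) * g (Suc j)))"
    unfolding * by (rule sum.cong) (simp_all add: algebra_simps)
  finally show ?thesis unfolding fdiff_def sum_distrib_left .
qed

lemma fdiff_add: "fdiff N (\<lambda>j. f j + g j) = fdiff N f + fdiff N g"
  by (simp add: fdiff_def algebra_simps sum.distrib)

lemma fdiff_cmult: "fdiff N (\<lambda>j. c * f j) = c * fdiff N f"
  by (simp add: fdiff_def algebra_simps sum_distrib_left)

lemma fdiff_sum: "fdiff N (\<lambda>j. \<Sum>i\<in>I. f i j) = (\<Sum>i\<in>I. fdiff N (f i))"
  unfolding fdiff_def sum_distrib_left by (rule sum.swap)

text \<open>A coefficient-free substitute for "degree below \<open>N\<close>": it relates values at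
  equally spaced points of a line, with free base point and free step.\<close>

definition fdiff_zero :: "nat \<Rightarrow> ('a::real_vector \<Rightarrow> real) \<Rightarrow> bool" where
  "fdiff_zero N p \<longleftrightarrow> (\<forall>x h. fdiff N (\<lambda>j. p (x + real j *\<^sub>R h)) = 0)"

lemma fdiff_zero_shift:
  assumes "fdiff_zero N p"
  shows "fdiff N (\<lambda>j. p (x + real (Suc j) *\<^sub>R h)) = 0"
proof -
  have "x + h + real j *\<^sub>R h = x + real (Suc j) *\<^sub>R h" for j
    by (simp add: scaleR_left_distrib)
  then show ?thesis using assms[unfolded fdiff_zero_def, rule_format, of "x + h" h] by (simp only:)
qed

lemma fdiff_zero_Suc:
  assumes "fdiff_zero N p"
  shows "fdiff_zero (Suc N) p"
  unfolding fdiff_zero_def fdiff_Suc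
  using assms[unfolded fdiff_zero_def] fdiff_zero_shift[OF assms] by (simp only: diff_self simp_thms)

lemma fdiff_zero_mono: "fdiff_zero N p \<Longrightarrow> N \<le> M \<Longrightarrow> fdiff_zero M p"
proof (induction M)
  case (Suc M)
  show ?case
  proof (cases "N = Suc M")
    case True
    then show ?thesis using Suc.prems by simp
  next
    case False
    then show ?thesis using Suc.prems by (intro fdiff_zero_Suc Suc.IH) simp_all
  qed
qed simp

lemma fdiff_zero_mult_coord:
  fixes p :: "real ^ 'n \<Rightarrow> real"
  assumes "fdiff_zero N p"
  shows "fdiff_zero (Suc N) (\<lambda>x. x $ i * p x)"
  unfolding fdiff_zero_def
proof (intro allI)
  fix x h
  have "fdiff (Suc N) (\<lambda>j. (x + real j *\<^sub>R h) $ i * p (x + real j *\<^sub>R h))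
    = x $ i * fdiff (Suc N) (\<lambda>j. p (x + real j *\<^sub>R h))
      + h $ i * fdiff (Suc N) (\<lambda>j. real j * p (x + real j *\<^sub>R h))"
    unfolding fdiff_cmult[symmetric] fdiff_add[symmetric] by (simp add: algebra_simps)
  also have "\<dots> = 0"
    using fdiff_zero_Suc[OF assms] fdiff_zero_shift[OF assms]
    by (simp add: fdiff_zero_def fdiff_mult_index)
  finally show "fdiff (Suc N) (\<lambda>j. (x + real j *\<^sub>R h) $ i * p (x + real j *\<^sub>R h)) = 0" .
qed

lemma fdiff_zero_mult_power:
  fixes p :: "real ^ 'n \<Rightarrow> real"
  assumes "fdiff_zero N p"
  shows "fdiff_zero (N + k) (\<lambda>x. (x $ i) ^ k * p x)"
proof (induction k)
  case 0
  show ?case using assms by simp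
next
  case (Suc k)
  show ?case using fdiff_zero_mult_coord[OF Suc, of i] by (simp add: mult.assoc)
qed

lemma fdiff_zero_monomial:
  fixes \<alpha> :: "'n::finite \<Rightarrow> nat"
  shows "fdiff_zero (Suc (\<Sum>i\<in>A. \<alpha> i)) (\<lambda>x::real^'n. \<Prod>i\<in>A. (x $ i) ^ \<alpha> i)"
proof (induction A rule: infinite_finite_induct)
  case (insert i A)
  then show ?case
    using fdiff_zero_mult_power[OF insert.IH, of "\<alpha> i" i] by (simp add: add.commute)
qed (simp_all add: fdiff_zero_def fdiff_Suc fdiff_def[of 0])

lemma fdiff_zero_poly:
  assumes "p \<in> poly_space m"
  shows "fdiff_zero (Suc m) (p :: real ^ 'n \<Rightarrow> real)"
proof -
  obtain c where p: "p = (\<lambda>x. \<Sum>\<alpha>\<in>multi_indices m. c \<alpha> * (\<Prod>i\<in>UNIV. (x $ i) ^ \<alpha> i))"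
    using assms by (auto simp: poly_space_def)
  have "fdiff_zero (Suc m) (\<lambda>x::real^'n. \<Prod>i\<in>UNIV. (x $ i) ^ \<alpha> i)" if "\<alpha> \<in> multi_indices m" for \<alpha>
    by (rule fdiff_zero_mono[OF fdiff_zero_monomial]) (use that in \<open>simp add: multi_indices_def\<close>)
  then show ?thesis
    unfolding p fdiff_zero_def fdiff_sum fdiff_cmult by simp
qed

text \<open>Solve the vanishing difference of order \<open>m + 1\<close> for its term
  \<open>j = 0\<close>. The step \<open>h\<close> stays free: pointing it at a centre gives unique
  continuation, averaging over it gives the core bound.\<close>

lemma poly_space_point_bound:
  fixes p :: "real ^ 'n \<Rightarrow> real"
  assumes "p \<in> poly_space m"
  shows "\<bar>p x\<bar> \<le> (\<Sum>j\<in>{1..Suc m}. real (Suc m choose j) * \<bar>p (x + real j *\<^sub>R h)\<bar>)"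
proof -
  have "fdiff (Suc m) (\<lambda>j. p (x + real j *\<^sub>R h)) = 0"
    using fdiff_zero_poly[OF assms] by (simp add: fdiff_zero_def)
  moreover have "{..Suc m} = insert 0 {1..Suc m}" by auto
  moreover have "fdiff (Suc m) (\<lambda>j. p (x + real j *\<^sub>R h)) = p x
      + (\<Sum>j\<in>{1..Suc m}. (-1) ^ j * real (Suc m choose j) * p (x + real j *\<^sub>R h))"
    unfolding fdiff_def \<open>{..Suc m} = insert 0 {1..Suc m}\<close>
    by (subst sum.insert) simp_all
  ultimately have "p x = - (\<Sum>j\<in>{1..Suc m}. (-1) ^ j * real (Suc m choose j) * p (x + real j *\<^sub>R h))"
    by linarith
  then have "\<bar>p x\<bar> = \<bar>\<Sum>j\<in>{1..Suc m}. (-1) ^ j * real (Suc m choose j) * p (x + real j *\<^sub>R h)\<bar>"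
    by (simp only: abs_minus_cancel)
  also have "\<dots> \<le> (\<Sum>j\<in>{1..Suc m}. \<bar>(-1) ^ j * real (Suc m choose j) * p (x + real j *\<^sub>R h)\<bar>)"
    by (rule sum_abs)
  also have "\<dots> = (\<Sum>j\<in>{1..Suc m}. real (Suc m choose j) * \<bar>p (x + real j *\<^sub>R h)\<bar>)"
    by (simp only: abs_mult power_abs abs_minus_cancel abs_one power_one abs_of_nat mult_1)
  finally show ?thesis .
qed

text \<open>Unique continuation without derivatives: for a suitable step all nodes lie nearer to the
  centre than \<open>x\<close> by a fixed factor, so the zero set spreads from a ball to one that is
  \<rho> times larger.\<close>

lemma poly_space_zero:
  fixes p :: "real ^ 'n \<Rightarrow> real"
  assumes p: "p \<in> poly_space m" and r: "r > 0" and 0: "\<And>x. x \<in> ball c r \<Longrightarrow> p x = 0"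
  shows "p x = 0"
proof -
  define \<rho> where "\<rho> = (real m + 2) / (real m + 1)"
  have \<rho>: "\<rho> > 1" by (simp add: \<rho>_def field_simps)
  have step: "p x = 0" if "x \<in> ball c (\<rho> ^ k * r)" for k x
    using that
  proof (induction k arbitrary: x)
    case 0 then show ?case using assms(3) by simp
  next
    case (Suc k)
    \<comment> \<open>Node \<open>j\<close> is then \<open>x\<close> contracted towards
      \<open>c\<close> by the factor \<open>1 - j / (m + 2)\<close>, which for \<open>j\<close> from
      1 to \<open>m + 1\<close> is positive and at most \<open>1 / \<rho>\<close>.\<close>
    let ?h = "- ((x - c) /\<^sub>R (real m + 2))"
    have "p (x + real j *\<^sub>R ?h) = 0" if j: "j \<in> {1..Suc m}" for j
    proof (rule Suc.IH)
      have "x + real j *\<^sub>R ?h - c = (1 - real j / (real m + 2)) *\<^sub>R (x - c)"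
        by (simp add: algebra_simps divide_inverse)
      then have "norm (x + real j *\<^sub>R ?h - c) = \<bar>1 - real j / (real m + 2)\<bar> * norm (x - c)"
        by simp
      also have "\<bar>1 - real j / (real m + 2)\<bar> \<le> 1 / \<rho>"
      proof -
        have "1 \<le> real j" "real j \<le> real m + 2" using j by auto
        then have "\<bar>1 - real j / (real m + 2)\<bar> = 1 - real j / (real m + 2)" by simp
        also have "\<dots> \<le> 1 - 1 / (real m + 2)" using \<open>1 \<le> real j\<close> by (simp add: divide_right_mono)
        also have "\<dots> = 1 / \<rho>" by (simp add: \<rho>_def field_simps)
        finally show ?thesis .
      qed
      then have "\<bar>1 - real j / (real m + 2)\<bar> * norm (x - c) \<le> 1 / \<rho> * norm (x - c)"
        by (rule mult_right_mono) simp
      also have "norm (x - c) < \<rho> * (\<rho> ^ k * r)"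
        using Suc.prems by (simp add: dist_norm norm_minus_commute[of c] mult.assoc)
      then have "1 / \<rho> * norm (x - c) < \<rho> ^ k * r" using \<rho> by (simp add: pos_divide_less_eq mult.commute)
      finally show "x + real j *\<^sub>R ?h \<in> ball c (\<rho> ^ k * r)"
        by (simp only: mem_ball dist_norm norm_minus_commute[of c])
    qed
    then show ?case using poly_space_point_bound[OF p, of x ?h] by simp
  qed
  obtain k where "norm (x - c) / r < \<rho> ^ k" using real_arch_pow[OF \<rho>] by blast
  then have "norm (x - c) < \<rho> ^ k * r" using r by (simp add: pos_divide_less_eq)
  then show ?thesis by (intro step[of _ k]) (simp only: mem_ball dist_norm norm_minus_commute[of c])
qed

section \<open>Polynomials as a vector space of continuous functions\<close>

lemma poly_spaceE:
  assumes "p \<in> poly_space m"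
  obtains c where "p = (\<lambda>x. \<Sum>\<alpha>\<in>multi_indices m. c \<alpha> * (\<Prod>i\<in>UNIV. (x $ i) ^ \<alpha> i))"
  using assms unfolding poly_space_def mem_Collect_eq by (elim exE)

lemma poly_space_add:
  assumes "p \<in> poly_space m" "r \<in> poly_space m"
  shows "(\<lambda>x. p x + r x) \<in> poly_space m"
proof -
  obtain c where c: "p = (\<lambda>x. \<Sum>\<alpha>\<in>multi_indices m. c \<alpha> * (\<Prod>i\<in>UNIV. (x $ i) ^ \<alpha> i))"
    using assms(1) by (rule poly_spaceE)
  obtain d where d: "r = (\<lambda>x. \<Sum>\<alpha>\<in>multi_indices m. d \<alpha> * (\<Prod>i\<in>UNIV. (x $ i) ^ \<alpha> i))"
    using assms(2) by (rule poly_spaceE)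
  from c d have "(\<lambda>x. p x + r x)
      = (\<lambda>x. \<Sum>\<alpha>\<in>multi_indices m. (c \<alpha> + d \<alpha>) * (\<Prod>i\<in>UNIV. (x $ i) ^ \<alpha> i))"
    by (simp only: sum.distrib distrib_right)
  then show ?thesis unfolding poly_space_def mem_Collect_eq by (rule exI[of _ "\<lambda>\<alpha>. c \<alpha> + d \<alpha>"])
qed

lemma poly_space_cmult:
  assumes "p \<in> poly_space m"
  shows "(\<lambda>x. k * p x) \<in> poly_space m"
proof -
  obtain c where "p = (\<lambda>x. \<Sum>\<alpha>\<in>multi_indices m. c \<alpha> * (\<Prod>i\<in>UNIV. (x $ i) ^ \<alpha> i))"
    using assms by (rule poly_spaceE)
  then have "(\<lambda>x. k * p x) = (\<lambda>x. \<Sum>\<alpha>\<in>multi_indices m. (k * c \<alpha>) * (\<Prod>i\<in>UNIV. (x $ i) ^ \<alpha> i))"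
    by (simp only: sum_distrib_left mult.assoc)
  then show ?thesis unfolding poly_space_def mem_Collect_eq by (rule exI[of _ "\<lambda>\<alpha>. k * c \<alpha>"])
qed

lemma poly_space_0: "(\<lambda>x. 0) \<in> poly_space m"
  unfolding poly_space_def by (rule CollectI, rule exI[of _ "\<lambda>\<alpha>. 0"]) simp

lemma poly_space_diff: "p \<in> poly_space m \<Longrightarrow> r \<in> poly_space m \<Longrightarrow> (\<lambda>x. p x - r x) \<in> poly_space m"
  by (drule poly_space_cmult[of r m "-1"], drule (1) poly_space_add[of p m]) simp

lemma poly_space_sum:
  assumes "\<And>i. i \<in> I \<Longrightarrow> g i \<in> poly_space m"
  shows "(\<lambda>x. \<Sum>i\<in>I. k i * g i x) \<in> poly_space m"
  using assms
proof (induction I rule: infinite_finite_induct)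
  case (insert i I)
  then show ?case
    using poly_space_add[OF poly_space_cmult[of "g i" m "k i"], of "\<lambda>x. \<Sum>i\<in>I. k i * g i x"] by simp
qed (simp_all add: poly_space_0)

lemma poly_space_continuous:
  assumes "p \<in> poly_space m"
  shows "continuous_on S p"
proof -
  obtain c where p: "p = (\<lambda>x. \<Sum>\<alpha>\<in>multi_indices m. c \<alpha> * (\<Prod>i\<in>UNIV. (x $ i) ^ \<alpha> i))"
    using assms by (rule poly_spaceE)
  show ?thesis
    unfolding p by (intro continuous_on_sum continuous_on_mult continuous_on_const continuous_on_prod
      continuous_on_power continuous_on_component continuous_on_id)
qed

section \<open>Lebesgue measure and integrability on boxes\<close>

lemma measure_box_cart:
  fixes a b :: "real ^ 'n"
  assumes "\<And>i. a $ i < b $ i"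
  shows "measure lebesgue (box a b) = (\<Prod>i\<in>UNIV. b $ i - a $ i)"
proof -
  have "cbox a b \<noteq> {}" using assms by (auto simp: interval_ne_empty_cart less_imp_le)
  then have "measure lborel (cbox a b) = (\<Prod>i\<in>UNIV. b $ i - a $ i)"
    by (rule content_cbox_cart)
  moreover have "measure lborel (box a b) = measure lborel (cbox a b)"
    by (simp add: measure_lborel_box_eq measure_lborel_cbox_eq)
  ultimately show ?thesis by simp
qed

lemma measure_box_pos:
  fixes a b :: "real ^ 'n"
  assumes "\<And>i. a $ i < b $ i"
  shows "0 < measure lebesgue (box a b)"
  unfolding measure_box_cart[OF assms] using assms by (simp add: prod_pos)

lemma measure_box_scale:
  fixes a b u v :: "real ^ 'n"
  assumes ab: "\<And>i. a $ i < b $ i" and t: "t > 0" and uv: "v - u = t *\<^sub>R (b - a)"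
  shows "measure lebesgue (box u v) = t ^ CARD('n) * measure lebesgue (box a b)"
proof -
  have d: "v $ i - u $ i = t * (b $ i - a $ i)" for i
    using arg_cong[OF uv, of "\<lambda>z. z $ i"] by simp
  have "u $ i < v $ i" for i
    using d[of i] ab[of i] t by (smt (verit) mult_pos_pos)
  then show ?thesis
    by (simp only: measure_box_cart[OF ab] measure_box_cart[of u v] d prod.distrib prod_constant)
qed

lemma emeasure_box_lebesgue:
  "emeasure lebesgue (box a b) = ennreal (measure lebesgue (box (a::real^'n) b))"
  using emeasure_lborel_box_finite[of a b] by (intro emeasure_eq_ennreal_measure) auto

lemma poly_set_integrable:
  fixes p :: "real ^ 'n \<Rightarrow> real"
  assumes "p \<in> poly_space m"
  shows "set_integrable lebesgue (box a b) p"
  by (rule set_integrable_subset[OF absolutely_integrable_continuous[OF poly_space_continuous[OF assms], of a b]])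
    (simp_all add: box_subset_cbox)

lemma set_integrable_mult_poly:
  fixes p :: "real ^ 'n \<Rightarrow> real"
  assumes p: "p \<in> poly_space m" and f: "set_integrable lebesgue (box a b) f"
  shows "set_integrable lebesgue (box a b) (\<lambda>x. f x * p x)"
proof -
  have "compact (p ` cbox a b)"
    by (rule compact_continuous_image[OF poly_space_continuous[OF p] compact_cbox])
  then obtain M where M: "\<And>x. x \<in> cbox a b \<Longrightarrow> norm (p x) \<le> M"
    by (meson bounded_iff compact_imp_bounded imageI)
  have meas: "(\<lambda>x. indicator (box a b) x *\<^sub>R (f x * p x)) \<in> borel_measurable lebesgue"
  proof -
    have "(\<lambda>x. indicator (box a b) x *\<^sub>R f x) \<in> borel_measurable lebesgue"
      using f unfolding set_integrable_def by (rule borel_measurable_integrable)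
    moreover have "p \<in> borel_measurable lebesgue"
      using borel_measurable_continuous_onI[OF poly_space_continuous[OF p]]
      by (simp add: measurable_completion)
    ultimately have "(\<lambda>x. (indicator (box a b) x *\<^sub>R f x) * p x) \<in> borel_measurable lebesgue"
      by (rule borel_measurable_times)
    then show ?thesis by (simp add: mult.assoc)
  qed
  show ?thesis
  proof (rule set_integrable_bound[OF set_integrable_mult_right[of "M" lebesgue "box a b" f]])
    show "set_integrable lebesgue (box a b) f" by (rule f)
    show "set_borel_measurable lebesgue (box a b) (\<lambda>x. f x * p x)"
      using meas by (simp add: set_borel_measurable_def)
    show "AE x in lebesgue. x \<in> box a b \<longrightarrow> norm (f x * p x) \<le> norm (M * f x)"
    proof (rule AE_I2, rule impI)
      fix x assume "x \<in> box a b"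
      then have "norm (p x) \<le> M" using M box_subset_cbox by blast
      then have "\<bar>p x\<bar> \<le> \<bar>M\<bar>" by simp
      then have "\<bar>f x\<bar> * \<bar>p x\<bar> \<le> \<bar>f x\<bar> * \<bar>M\<bar>" by (rule mult_left_mono) simp
      then show "norm (f x * p x) \<le> norm (M * f x)" by (simp add: abs_mult mult.commute)
    qed
  qed
qed

lemma nn_integral_lborel_dilate:
  fixes g :: "real ^ 'n \<Rightarrow> ennreal"
  assumes g: "g \<in> borel_measurable borel" and c: "1 \<le> c"
  shows "(\<integral>\<^sup>+h. g (t + c *\<^sub>R h) \<partial>lborel) \<le> (\<integral>\<^sup>+x. g x \<partial>lborel)"
proof -
  have "(\<integral>\<^sup>+x. g x \<partial>lborel) = (\<integral>\<^sup>+x. g x \<partial>density (distr lborel borel (\<lambda>x. t + c *\<^sub>R x)) (\<lambda>_. \<bar>c\<bar> ^ DIM(real^'n)))"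
    using c by (subst lborel_affine[of c t]) auto
  also have "\<dots> = (\<integral>\<^sup>+h. ennreal (\<bar>c\<bar> ^ DIM(real^'n)) * g (t + c *\<^sub>R h) \<partial>lborel)"
    using g by (simp add: nn_integral_density nn_integral_distr)
  also have "\<dots> \<ge> (\<integral>\<^sup>+h. g (t + c *\<^sub>R h) \<partial>lborel)"
  proof (rule nn_integral_mono)
    fix h
    have "1 \<le> ennreal (\<bar>c\<bar> ^ DIM(real^'n))"
      using c by (simp add: one_le_power)
    then show "g (t + c *\<^sub>R h) \<le> ennreal (\<bar>c\<bar> ^ DIM(real^'n)) * g (t + c *\<^sub>R h)"
      using mult_right_mono[of 1 "ennreal (\<bar>c\<bar> ^ DIM(real^'n))" "g (t + c *\<^sub>R h)"] by simp
  qed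
  finally show ?thesis .
qed

text \<open>Relative width of the margin around the core. A step of at most three margins per
  coordinate, taken \<open>m + 1\<close> times, moves a point by at most 3/8 of the side; starting
  in one half of the box it therefore stays 1/8 of the side away from the opposite face.\<close>

definition core_eps :: "nat \<Rightarrow> real" where
  "core_eps m = 1 / (8 * (real m + 1))"

lemma core_eps: "0 < core_eps m" "core_eps m \<le> 1 / 8" "core_eps m * (real m + 1) = 1 / 8"
  by (simp_all add: core_eps_def field_simps)

text \<open>
  Averaging the finite difference identity over the increments \<open>h\<close> in a box that keeps
  all nodes \<open>x + j h\<close> inside the core of the box.
\<close>
lemma poly_core_bound:
  fixes p :: "real ^ 'n \<Rightarrow> real"
  assumes ab: "\<And>i. a $ i < b $ i" and p: "p \<in> poly_space m" and x: "x \<in> box a b"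
  defines "Q \<equiv> box (a + core_eps m *\<^sub>R (b - a)) (b - core_eps m *\<^sub>R (b - a))"
  shows "\<bar>p x\<bar> * measure lebesgue (box a b)
    \<le> 2 ^ Suc m * (4 * (real m + 1)) ^ CARD('n) * (LINT y:Q|lebesgue. \<bar>p y\<bar>)"
proof -
  let ?e = "core_eps m"
  \<comment> \<open>The box of admissible increments. In each coordinate they point from
    \<open>x\<close> towards the farther face and have length between one and three margins, so that
    already the first node has left the margin at the near face.\<close>
  define u where "u = (\<chi> i. (if x $ i - a $ i \<le> (b $ i - a $ i) / 2 then ?e else - 3 * ?e) * (b $ i - a $ i))"
  define v where "v = u + (2 * ?e) *\<^sub>R (b - a)"
  have node: "x + real j *\<^sub>R h \<in> Q" if h: "h \<in> box u v" and j: "j \<in> {1..Suc m}" for h j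
    unfolding Q_def mem_box_cart
  proof (intro allI)
    fix i
    let ?l = "b $ i - a $ i"
    have l: "?l > 0" using ab[of i] by simp
    have xi: "a $ i < x $ i" "x $ i < b $ i" using x by (auto simp: mem_box_cart)
    have hi: "u $ i < h $ i" "h $ i < v $ i" using h by (auto simp: mem_box_cart)
    have j1: "1 \<le> real j" "real j \<le> real m + 1" using j by auto
    have el: "?e * ?l > 0" "?e * ?l \<le> ?l / 8" "real j * (?e * ?l) \<le> ?l / 8"
    proof -
      show "?e * ?l > 0" using l core_eps(1) by simp
      show "?e * ?l \<le> ?l / 8" using mult_right_mono[OF core_eps(2)[of m], of ?l] l by simp
      have "real j * (?e * ?l) \<le> (real m + 1) * (?e * ?l)"
        using j1(2) \<open>?e * ?l > 0\<close> by (intro mult_right_mono) auto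
      also have "\<dots> = (?e * (real m + 1)) * ?l" by (simp only: mult_ac)
      finally show "real j * (?e * ?l) \<le> ?l / 8" unfolding core_eps(3) by simp
    qed
    have goal: "a $ i + ?e * ?l < x $ i + real j * h $ i \<and> x $ i + real j * h $ i < b $ i - ?e * ?l"
    proof (cases "x $ i - a $ i \<le> ?l / 2")
      case True
      then have h1: "?e * ?l < h $ i" "h $ i < 3 * (?e * ?l)"
        using hi by (simp_all add: u_def v_def algebra_simps)
      have "1 * h $ i \<le> real j * h $ i" using j1 h1 el(1) by (intro mult_right_mono) auto
      moreover have "real j * h $ i < real j * (3 * (?e * ?l))" using j1 h1 by (intro mult_strict_left_mono) auto
      then have "real j * h $ i < 3 * (real j * (?e * ?l))" by (simp only: mult_ac)
      ultimately show ?thesis using True h1 el xi by argo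
    next
      case False
      then have h1: "?e * ?l < - h $ i" "- h $ i < 3 * (?e * ?l)"
        using hi by (simp_all add: u_def v_def algebra_simps)
      have "1 * (- h $ i) \<le> real j * (- h $ i)" using j1 h1 el(1) by (intro mult_right_mono) auto
      moreover have "real j * (- h $ i) < real j * (3 * (?e * ?l))" using j1 h1 by (intro mult_strict_left_mono) auto
      then have "real j * (- h $ i) < 3 * (real j * (?e * ?l))" by (simp only: mult_ac)
      moreover have "real j * (- h $ i) = - (real j * h $ i)" by simp
      ultimately show ?thesis using False h1 el xi by argo
    qed
    then show "(a + ?e *\<^sub>R (b - a)) $ i < (x + real j *\<^sub>R h) $ i \<and>
      (x + real j *\<^sub>R h) $ i < (b - ?e *\<^sub>R (b - a)) $ i" by simp
  qed
  have mV: "emeasure lborel (box u v) = ennreal ((2 * ?e) ^ CARD('n) * measure lebesgue (box a b))"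
  proof -
    have "emeasure lborel (box u v) = emeasure lebesgue (box u v)" by simp
    also have "\<dots> = ennreal (measure lebesgue (box u v))" by (rule emeasure_box_lebesgue)
    also have "measure lebesgue (box u v) = (2 * ?e) ^ CARD('n) * measure lebesgue (box a b)"
      using core_eps(1)[of m] by (intro measure_box_scale ab) (simp_all add: v_def)
    finally show ?thesis .
  qed
  have pm: "p \<in> borel_measurable borel"
    by (rule borel_measurable_continuous_onI[OF poly_space_continuous[OF p]])
  define g where "g y = ennreal \<bar>p y\<bar> * indicator Q y" for y
  have gm: "g \<in> borel_measurable borel" unfolding g_def Q_def using pm by measurable
  define J where "J = (LINT y:Q|lebesgue. \<bar>p y\<bar>)"
  have J0: "0 \<le> J" by (simp add: J_def set_lebesgue_integral_def)
  have intQ: "(\<integral>\<^sup>+y. g y \<partial>lborel) = ennreal J"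
  proof -
    have si: "set_integrable lebesgue Q (\<lambda>y. \<bar>p y\<bar>)"
      unfolding Q_def by (intro set_integrable_abs poly_set_integrable[OF p])
    have "(\<integral>\<^sup>+y. g y \<partial>lborel) = (\<integral>\<^sup>+y. g y \<partial>lebesgue)"
      using gm by (intro nn_integral_completion[symmetric])
    also have "\<dots> = (\<integral>\<^sup>+y. ennreal (indicator Q y *\<^sub>R \<bar>p y\<bar>) \<partial>lebesgue)"
      by (intro nn_integral_cong) (simp add: g_def split: split_indicator)
    also have "\<dots> = ennreal J"
      using si unfolding J_def set_integrable_def set_lebesgue_integral_def
      by (intro nn_integral_eq_integral) auto
    finally show ?thesis .
  qed
  have "ennreal \<bar>p x\<bar> * emeasure lborel (box u v) = (\<integral>\<^sup>+h. ennreal \<bar>p x\<bar> * indicator (box u v) h \<partial>lborel)"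
    by (simp add: nn_integral_cmult_indicator)
  also have "\<dots> \<le> (\<integral>\<^sup>+h. (\<Sum>j\<in>{1..Suc m}. ennreal (real (Suc m choose j)) * g (x + real j *\<^sub>R h)) \<partial>lborel)"
  proof (rule nn_integral_mono)
    fix h
    show "ennreal \<bar>p x\<bar> * indicator (box u v) h
      \<le> (\<Sum>j\<in>{1..Suc m}. ennreal (real (Suc m choose j)) * g (x + real j *\<^sub>R h))"
    proof (cases "h \<in> box u v")
      case True
      have "ennreal \<bar>p x\<bar> \<le> ennreal (\<Sum>j\<in>{1..Suc m}. real (Suc m choose j) * \<bar>p (x + real j *\<^sub>R h)\<bar>)"
        by (intro ennreal_leI poly_space_point_bound[OF p])
      also have "\<dots> = (\<Sum>j\<in>{1..Suc m}. ennreal (real (Suc m choose j) * \<bar>p (x + real j *\<^sub>R h)\<bar>))"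
        by (intro sum_ennreal[symmetric]) simp
      also have "\<dots> = (\<Sum>j\<in>{1..Suc m}. ennreal (real (Suc m choose j)) * g (x + real j *\<^sub>R h))"
        using node[OF True] by (intro sum.cong) (simp_all add: g_def ennreal_mult)
      finally show ?thesis using True by simp
    qed simp
  qed
  also have "\<dots> = (\<Sum>j\<in>{1..Suc m}. ennreal (real (Suc m choose j)) * (\<integral>\<^sup>+h. g (x + real j *\<^sub>R h) \<partial>lborel))"
  proof -
    have m: "(\<lambda>h. g (x + real j *\<^sub>R h)) \<in> borel_measurable lborel" for j
      using measurable_compose[OF _ gm, of "\<lambda>h. x + real j *\<^sub>R h" lborel] by simp
    then have "(\<lambda>h. ennreal (real (Suc m choose j)) * g (x + real j *\<^sub>R h)) \<in> borel_measurable lborel" for j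
      by (intro borel_measurable_times_ennreal borel_measurable_const)
    then show ?thesis
      by (subst nn_integral_sum) (auto intro!: sum.cong nn_integral_cmult m simp del: sum.cl_ivl_Suc binomial_Suc_Suc)
  qed
  also have "\<dots> \<le> (\<Sum>j\<in>{1..Suc m}. ennreal (real (Suc m choose j)) * ennreal J)"
    using gm unfolding intQ[symmetric] by (intro sum_mono mult_left_mono nn_integral_lborel_dilate) auto
  also have "\<dots> = (\<Sum>j\<in>{1..Suc m}. ennreal (real (Suc m choose j) * J))"
    using J0 by (intro sum.cong refl ennreal_mult[symmetric]) auto
  also have "\<dots> = ennreal (\<Sum>j\<in>{1..Suc m}. real (Suc m choose j) * J)"
    using J0 by (intro sum_ennreal mult_nonneg_nonneg) auto
  finally have "ennreal (\<bar>p x\<bar> * ((2 * ?e) ^ CARD('n) * measure lebesgue (box a b)))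
      \<le> ennreal ((\<Sum>j\<in>{1..Suc m}. real (Suc m choose j)) * J)"
    unfolding mV sum_distrib_right using core_eps(1)[of m]
    by (subst ennreal_mult) auto
  then have "\<bar>p x\<bar> * ((2 * ?e) ^ CARD('n) * measure lebesgue (box a b))
      \<le> (\<Sum>j\<in>{1..Suc m}. real (Suc m choose j)) * J"
    using J0 by (subst (asm) ennreal_le_iff) (auto intro!: mult_nonneg_nonneg sum_nonneg simp del: sum.cl_ivl_Suc binomial_Suc_Suc)
  also have "\<dots> \<le> 2 ^ Suc m * J"
  proof (rule mult_right_mono)
    have "(\<Sum>j\<in>{1..Suc m}. real (Suc m choose j)) \<le> (\<Sum>j\<in>{..Suc m}. real (Suc m choose j))"
      by (intro sum_mono2) auto
    also have "\<dots> = real (\<Sum>j\<in>{..Suc m}. Suc m choose j)" by (simp only: of_nat_sum)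
    also have "\<dots> = 2 ^ Suc m" by (simp only: choose_row_sum of_nat_power of_nat_numeral)
    finally show "(\<Sum>j\<in>{1..Suc m}. real (Suc m choose j)) \<le> 2 ^ Suc m" .
  qed (rule J0)
  finally have *: "(2 * ?e) ^ CARD('n) * (\<bar>p x\<bar> * measure lebesgue (box a b)) \<le> 2 ^ Suc m * J"
    by (simp only: mult_ac)
  \<comment> \<open>\<open>4 * (m + 1)\<close> is the reciprocal of \<open>2 * core_eps m\<close>,
    the side of the box of increments relative to that of the given box.\<close>
  have "4 * (real m + 1) * (2 * ?e) = 1" using core_eps(3)[of m] by (simp add: algebra_simps)
  then have one: "(4 * (real m + 1)) ^ CARD('n) * (2 * ?e) ^ CARD('n) = 1"
    unfolding power_mult_distrib[symmetric] by simp
  have "\<bar>p x\<bar> * measure lebesgue (box a b)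
      = (4 * (real m + 1)) ^ CARD('n) * ((2 * ?e) ^ CARD('n) * (\<bar>p x\<bar> * measure lebesgue (box a b)))"
    unfolding mult.assoc[symmetric] one by simp
  also have "\<dots> \<le> (4 * (real m + 1)) ^ CARD('n) * (2 ^ Suc m * J)"
    by (rule mult_left_mono[OF *]) simp
  also have "\<dots> = 2 ^ Suc m * (4 * (real m + 1)) ^ CARD('n) * J"
    by (simp only: mult_ac)
  finally show ?thesis unfolding J_def .
qed

section \<open>Orthogonal projection onto polynomials\<close>

text \<open>The constant is that of \<open>poly_core_bound\<close>.\<close>
definition poly_const :: "nat \<Rightarrow> 'n::finite itself \<Rightarrow> real" where
  "poly_const m _ = 2 ^ Suc m * (4 * (real m + 1)) ^ CARD('n)"

lemma poly_const_ge_1: "1 \<le> poly_const m TYPE('n::finite)"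
proof -
  have "1 * 1 \<le> 2 ^ Suc m * (4 * (real m + 1)) ^ CARD('n)"
    by (intro mult_mono one_le_power) auto
  then show ?thesis by (simp add: poly_const_def)
qed

section \<open>Averages over boxes\<close>

lemma avg_cmult: "avg R (\<lambda>x. c * g x) = c * avg R g"
  by (simp add: avg_def)

lemma avg_add:
  "set_integrable lebesgue R g \<Longrightarrow> set_integrable lebesgue R h \<Longrightarrow> avg R (\<lambda>x. g x + h x) = avg R g + avg R h"
  by (simp add: avg_def set_integral_add add_divide_distrib)

lemma avg_diff:
  "set_integrable lebesgue R g \<Longrightarrow> set_integrable lebesgue R h \<Longrightarrow> avg R (\<lambda>x. g x - h x) = avg R g - avg R h"
  by (simp add: avg_def set_integral_diff diff_divide_distrib)

lemma set_integrable_sum_real: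
  fixes g :: "'i \<Rightarrow> 'a \<Rightarrow> real"
  assumes "\<And>i. i \<in> I \<Longrightarrow> set_integrable M R (g i)"
  shows "set_integrable M R (\<lambda>x. \<Sum>i\<in>I. g i x)"
  using assms by (induction I rule: infinite_finite_induct) (auto simp: set_integrable_def[of M R "\<lambda>x. 0"])

lemma avg_sum:
  assumes "\<And>i. i \<in> I \<Longrightarrow> set_integrable lebesgue R (g i)"
  shows "avg R (\<lambda>x. \<Sum>i\<in>I. k i * g i x) = (\<Sum>i\<in>I. k i * avg R (g i))"
  using assms
proof (induction I rule: infinite_finite_induct)
  case (insert i I)
  have "set_integrable lebesgue R (\<lambda>x. \<Sum>i\<in>I. k i * g i x)"
    using insert.prems by (intro set_integrable_sum_real set_integrable_mult_right) auto
  then show ?case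
    using insert avg_add[of R "\<lambda>x. k i * g i x" "\<lambda>x. \<Sum>i\<in>I. k i * g i x"]
    by (simp add: avg_cmult)
qed (simp_all add: avg_def)

lemma avg_mono:
  assumes "set_integrable lebesgue R g" "set_integrable lebesgue R h" "\<And>x. x \<in> R \<Longrightarrow> g x \<le> h x"
  shows "avg R g \<le> avg R h"
  unfolding avg_def using assms by (intro divide_right_mono set_integral_mono) auto

lemma avg_nonneg: "(\<And>x. 0 \<le> g x) \<Longrightarrow> 0 \<le> avg R g"
  by (simp add: avg_def set_lebesgue_integral_def)

lemma set_integrable_const_box: "set_integrable lebesgue (box a b) (\<lambda>x::real^'n. c::real)"
  unfolding set_integrable_def using emeasure_box_lebesgue[of a b] by (intro integrable_scaleR_left) simp

lemma LINT_const_box: "(LINT x:box a b|lebesgue. c) = measure lebesgue (box a (b::real^'n)) * (c::real)"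
  using emeasure_box_lebesgue[of a b] by (subst set_integral_const) auto

lemma avg_const_box:
  fixes a b :: "real ^ 'n"
  assumes "\<And>i. a $ i < b $ i"
  shows "avg (box a b) (\<lambda>x. c) = c"
  using measure_box_pos[OF assms] unfolding avg_def LINT_const_box by simp

text \<open>The core bound with the core enlarged to the full box. The constant is the same for all
  boxes, however eccentric; this is what makes the argument work for rectangles and not only for
  cubes.\<close>

lemma poly_sup_bound:
  fixes p :: "real ^ 'n \<Rightarrow> real"
  assumes ab: "\<And>i. a $ i < b $ i" and p: "p \<in> poly_space m" and x: "x \<in> box a b"
  shows "\<bar>p x\<bar> \<le> poly_const m TYPE('n) * avg (box a b) (\<lambda>y. \<bar>p y\<bar>)"
proof -
  define Q where "Q = box (a + core_eps m *\<^sub>R (b - a)) (b - core_eps m *\<^sub>R (b - a))"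
  have pos: "measure lebesgue (box a b) > 0" by (rule measure_box_pos[OF ab])
  have QR: "Q \<subseteq> box a b"
  proof
    fix y assume y: "y \<in> Q"
    have "a $ i < y $ i \<and> y $ i < b $ i" for i
    proof -
      have "0 < core_eps m * (b $ i - a $ i)" using ab[of i] core_eps(1)[of m] by simp
      moreover have "a $ i + core_eps m * (b $ i - a $ i) < y $ i" "y $ i < b $ i - core_eps m * (b $ i - a $ i)"
        using y by (auto simp: Q_def mem_box_cart)
      ultimately show ?thesis by linarith
    qed
    then show "y \<in> box a b" by (simp add: mem_box_cart)
  qed
  have "(LINT y:Q|lebesgue. \<bar>p y\<bar>) \<le> (LINT y:box a b|lebesgue. \<bar>p y\<bar>)"
    unfolding set_lebesgue_integral_def
  proof (rule integral_mono)
    show "integrable lebesgue (\<lambda>y. indicator Q y *\<^sub>R \<bar>p y\<bar>)"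
      "integrable lebesgue (\<lambda>y. indicator (box a b) y *\<^sub>R \<bar>p y\<bar>)"
      using set_integrable_abs[OF poly_set_integrable[OF p]]
      unfolding Q_def set_integrable_def by blast+
    show "indicator Q y *\<^sub>R \<bar>p y\<bar> \<le> indicator (box a b) y *\<^sub>R \<bar>p y\<bar>" for y
      using QR by (auto split: split_indicator)
  qed
  then have "poly_const m TYPE('n) * (LINT y:Q|lebesgue. \<bar>p y\<bar>)
      \<le> poly_const m TYPE('n) * (LINT y:box a b|lebesgue. \<bar>p y\<bar>)"
    using poly_const_ge_1[of m, where 'n='n] by (intro mult_left_mono) auto
  moreover have "\<bar>p x\<bar> * measure lebesgue (box a b) \<le> poly_const m TYPE('n) * (LINT y:Q|lebesgue. \<bar>p y\<bar>)"
    using poly_core_bound[OF ab p x] by (simp add: poly_const_def Q_def)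
  ultimately have "\<bar>p x\<bar> * measure lebesgue (box a b) \<le> poly_const m TYPE('n) * (LINT y:box a b|lebesgue. \<bar>p y\<bar>)"
    by linarith
  then show ?thesis using pos by (simp add: avg_def pos_le_divide_eq)
qed

lemma set_integrable_poly_mult:
  assumes "p \<in> poly_space m" "r \<in> poly_space m"
  shows "set_integrable lebesgue (box a b) (\<lambda>x. p x * r x)"
  by (rule set_integrable_mult_poly[OF assms(2) poly_set_integrable[OF assms(1)]])

text \<open>Nonnegativity of the variance of \<open>\<bar>p\<bar>\<close>: expand the mean of
  \<open>(\<bar>p\<bar> - s)\<close> squared.\<close>

lemma avg_abs_square_le:
  fixes p :: "real ^ 'n \<Rightarrow> real"
  assumes ab: "\<And>i. a $ i < b $ i" and p: "p \<in> poly_space m"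
  defines "s \<equiv> avg (box a b) (\<lambda>x. \<bar>p x\<bar>)"
  shows "s * s \<le> avg (box a b) (\<lambda>x. p x * p x)"
proof -
  let ?R = "box a b"
  have i: "set_integrable lebesgue ?R (\<lambda>y. p y * p y)" "set_integrable lebesgue ?R (\<lambda>y. \<bar>p y\<bar>)"
    by (rule set_integrable_poly_mult[OF p p], rule set_integrable_abs[OF poly_set_integrable[OF p]])
  have "0 \<le> avg ?R (\<lambda>y. (\<bar>p y\<bar> - s) * (\<bar>p y\<bar> - s))" by (rule avg_nonneg) simp
  also have "(\<lambda>y. (\<bar>p y\<bar> - s) * (\<bar>p y\<bar> - s)) = (\<lambda>y. (p y * p y + s * s) - 2 * s * \<bar>p y\<bar>)"
    by (simp add: algebra_simps fun_eq_iff flip: abs_mult)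
  also have "avg ?R \<dots> = avg ?R (\<lambda>y. p y * p y + s * s) - avg ?R (\<lambda>y. 2 * s * \<bar>p y\<bar>)"
    by (intro avg_diff set_integral_add(1) set_integrable_mult_right i set_integrable_const_box)
  also have "\<dots> = avg ?R (\<lambda>y. p y * p y) - s * s"
    using avg_add[OF i(1) set_integrable_const_box[of a b "s * s"]] avg_const_box[OF ab, of "s * s"]
    by (simp add: avg_cmult s_def)
  finally show ?thesis by simp
qed

text \<open>Definiteness of the inner product. A vanishing mean square forces a vanishing mean of
  \<open>\<bar>p\<bar>\<close>, hence a vanishing supremum on the box, and unique continuation does
  the rest.\<close>

lemma poly_avg_square_pos:
  fixes p :: "real ^ 'n \<Rightarrow> real"
  assumes ab: "\<And>i. a $ i < b $ i" and p: "p \<in> poly_space m" and nz: "p \<noteq> (\<lambda>x. 0)"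
  shows "0 < avg (box a b) (\<lambda>x. p x * p x)"
proof (rule ccontr)
  let ?R = "box a b"
  assume "\<not> 0 < avg ?R (\<lambda>x. p x * p x)"
  moreover have "0 \<le> avg ?R (\<lambda>x. p x * p x)" by (rule avg_nonneg) simp
  ultimately have 0: "avg ?R (\<lambda>x. p x * p x) = 0" by simp
  then have "avg ?R (\<lambda>x. \<bar>p x\<bar>) * avg ?R (\<lambda>x. \<bar>p x\<bar>) \<le> 0"
    using avg_abs_square_le[OF ab p] by simp
  then have s: "avg ?R (\<lambda>x. \<bar>p x\<bar>) = 0" by (metis mult_eq_0_iff order_antisym zero_le_square)
  have "p x = 0" if "x \<in> ?R" for x
    using poly_sup_bound[OF ab p that] unfolding s by simp
  moreover have "(1/2) *\<^sub>R (a + b) \<in> ?R"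
    using ab by (simp add: mem_box_cart field_simps)
  then obtain r where "r > 0" "ball ((1/2) *\<^sub>R (a + b)) r \<subseteq> ?R"
    using open_box open_contains_ball_eq by blast
  ultimately have "p x = 0" for x
    using poly_space_zero[OF p, of r] by blast
  then show False using nz by auto
qed

section \<open>Linear spans and orthonormal bases\<close>

definition lin_span :: "('a \<Rightarrow> real) set \<Rightarrow> ('a \<Rightarrow> real) set" where
  "lin_span \<Phi> = {p. \<exists>c. p = (\<lambda>x. \<Sum>\<phi>\<in>\<Phi>. c \<phi> * \<phi> x)}"

lemma lin_spanI: "(\<And>x. p x = (\<Sum>\<phi>\<in>\<Phi>. c \<phi> * \<phi> x)) \<Longrightarrow> p \<in> lin_span \<Phi>"
  unfolding lin_span_def mem_Collect_eq by (rule exI[of _ c]) (rule ext)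

lemma lin_spanE:
  assumes "p \<in> lin_span \<Phi>"
  obtains c where "p = (\<lambda>x. \<Sum>\<phi>\<in>\<Phi>. c \<phi> * \<phi> x)"
  using assms unfolding lin_span_def mem_Collect_eq by (elim exE)

lemma lin_span_axpy:
  assumes "p \<in> lin_span \<Phi>" "r \<in> lin_span \<Phi>"
  shows "(\<lambda>x. k * p x + r x) \<in> lin_span \<Phi>"
proof -
  obtain c where c: "p = (\<lambda>x. \<Sum>\<phi>\<in>\<Phi>. c \<phi> * \<phi> x)" using assms(1) by (rule lin_spanE)
  obtain d where d: "r = (\<lambda>x. \<Sum>\<phi>\<in>\<Phi>. d \<phi> * \<phi> x)" using assms(2) by (rule lin_spanE)
  show ?thesis
    by (rule lin_spanI[where c="\<lambda>\<phi>. k * c \<phi> + d \<phi>"])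
      (simp only: c d sum.distrib distrib_right sum_distrib_left mult.assoc)
qed

lemma lin_span_0: "(\<lambda>x. 0) \<in> lin_span \<Phi>"
  by (rule lin_spanI[where c="\<lambda>_. 0"]) simp

lemma lin_span_sum:
  assumes "\<And>i. i \<in> I \<Longrightarrow> g i \<in> lin_span \<Phi>"
  shows "(\<lambda>x. \<Sum>i\<in>I. k i * g i x) \<in> lin_span \<Phi>"
  using assms
proof (induction I rule: infinite_finite_induct)
  case (insert i I)
  then show ?case using lin_span_axpy[of "g i" \<Phi> "\<lambda>x. \<Sum>i\<in>I. k i * g i x" "k i"] by simp
qed (simp_all add: lin_span_0)

lemma lin_span_base:
  assumes "finite \<Phi>" "\<phi> \<in> \<Phi>"
  shows "\<phi> \<in> lin_span \<Phi>"
proof (rule lin_spanI[where c="\<lambda>\<psi>. if \<psi> = \<phi> then 1 else 0"])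
  fix x
  have "(\<Sum>\<psi>\<in>\<Phi>. (if \<psi> = \<phi> then 1 else 0) * \<psi> x) = (\<Sum>\<psi>\<in>\<Phi>. if \<psi> = \<phi> then \<psi> x else 0)"
    by (intro sum.cong) auto
  then show "\<phi> x = (\<Sum>\<psi>\<in>\<Phi>. (if \<psi> = \<phi> then 1 else 0) * \<psi> x)"
    using assms by (simp add: sum.delta)
qed

lemma lin_span_insert_mono:
  assumes "finite \<Phi>" "p \<in> lin_span \<Phi>"
  shows "p \<in> lin_span (insert \<psi> \<Phi>)"
proof -
  obtain c where c: "p = (\<lambda>x. \<Sum>\<phi>\<in>\<Phi>. c \<phi> * \<phi> x)" using assms(2) by (rule lin_spanE)
  show ?thesis
    unfolding c using assms(1) by (intro lin_span_sum lin_span_base) auto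
qed

lemma avg_orthonormal_sum:
  assumes "finite \<Phi>" "\<Phi> \<subseteq> poly_space m" and \<psi>: "\<psi> \<in> \<Phi>"
    and on: "\<And>\<phi>. \<phi> \<in> \<Phi> \<Longrightarrow> avg (box a b) (\<lambda>x. \<phi> x * \<psi> x) = (if \<phi> = \<psi> then 1 else 0)"
  shows "avg (box a b) (\<lambda>x. (\<Sum>\<phi>\<in>\<Phi>. c \<phi> * \<phi> x) * \<psi> x) = c \<psi>"
proof -
  have \<psi>p: "\<psi> \<in> poly_space m" using assms by auto
  have "avg (box a b) (\<lambda>x. (\<Sum>\<phi>\<in>\<Phi>. c \<phi> * \<phi> x) * \<psi> x) = avg (box a b) (\<lambda>x. \<Sum>\<phi>\<in>\<Phi>. c \<phi> * (\<phi> x * \<psi> x))"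
    by (simp add: sum_distrib_right mult.assoc)
  also have "\<dots> = (\<Sum>\<phi>\<in>\<Phi>. c \<phi> * avg (box a b) (\<lambda>x. \<phi> x * \<psi> x))"
    using assms(2) \<psi>p by (intro avg_sum set_integrable_poly_mult) auto
  also have "\<dots> = (\<Sum>\<phi>\<in>\<Phi>. if \<phi> = \<psi> then c \<phi> else 0)"
    by (intro sum.cong refl) (simp add: on)
  also have "\<dots> = c \<psi>" using \<psi> assms(1) by (simp add: sum.delta)
  finally show ?thesis .
qed

text \<open>The generators need not be independent: one whose residual \<open>r\<close> after
  projection vanishes adds nothing to the family, and otherwise definiteness allows \<open>r\<close>
  to be normalised.\<close>

lemma gram_schmidt:
  fixes a b :: "real ^ 'n"
  assumes ab: "\<And>i. a $ i < b $ i" and "finite S" "S \<subseteq> poly_space m"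
  shows "\<exists>\<Phi>. finite \<Phi> \<and> \<Phi> \<subseteq> poly_space m \<and>
     (\<forall>\<phi>\<in>\<Phi>. \<forall>\<psi>\<in>\<Phi>. avg (box a b) (\<lambda>x. \<phi> x * \<psi> x) = (if \<phi> = \<psi> then 1 else 0)) \<and> S \<subseteq> lin_span \<Phi>"
  using assms(2,3)
proof (induction S)
  case empty
  show ?case by (rule exI[of _ "{}"]) simp
next
  case (insert s S)
  let ?R = "box a b"
  obtain \<Phi> where \<Phi>: "finite \<Phi>" "\<Phi> \<subseteq> poly_space m" "S \<subseteq> lin_span \<Phi>"
    and on: "\<And>\<phi> \<psi>. \<phi> \<in> \<Phi> \<Longrightarrow> \<psi> \<in> \<Phi> \<Longrightarrow> avg ?R (\<lambda>x. \<phi> x * \<psi> x) = (if \<phi> = \<psi> then 1 else 0)"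
    using insert.IH insert.prems by auto
  have s: "s \<in> poly_space m" using insert.prems by simp
  define pr where "pr = (\<lambda>x. \<Sum>\<phi>\<in>\<Phi>. avg ?R (\<lambda>y. s y * \<phi> y) * \<phi> x)"
  define r where "r = (\<lambda>x. s x - pr x)"
  have pr: "pr \<in> poly_space m" "pr \<in> lin_span \<Phi>"
    unfolding pr_def using \<Phi>(1,2) by (auto intro!: poly_space_sum lin_span_sum lin_span_base)
  have r: "r \<in> poly_space m" unfolding r_def by (rule poly_space_diff[OF s pr(1)])
  have orth: "avg ?R (\<lambda>x. r x * \<psi> x) = 0" if \<psi>: "\<psi> \<in> \<Phi>" for \<psi>
  proof -
    have \<psi>p: "\<psi> \<in> poly_space m" using \<psi> \<Phi> by auto
    have "avg ?R (\<lambda>x. pr x * \<psi> x) = avg ?R (\<lambda>y. s y * \<psi> y)"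
      unfolding pr_def by (rule avg_orthonormal_sum[OF \<Phi>(1,2) \<psi> on[OF _ \<psi>]])
    moreover have "avg ?R (\<lambda>x. r x * \<psi> x) = avg ?R (\<lambda>x. s x * \<psi> x) - avg ?R (\<lambda>x. pr x * \<psi> x)"
      unfolding r_def left_diff_distrib
      by (rule avg_diff[OF set_integrable_poly_mult[OF s \<psi>p] set_integrable_poly_mult[OF pr(1) \<psi>p]])
    ultimately show ?thesis by simp
  qed
  show ?case
  proof (cases "r = (\<lambda>x. 0)")
    case True
    then have "s = pr" by (auto simp: r_def fun_eq_iff)
    then show ?thesis using \<Phi> on pr by (intro exI[of _ \<Phi>]) auto
  next
    case False
    define N where "N = avg ?R (\<lambda>x. r x * r x)"
    have N: "N > 0" unfolding N_def by (rule poly_avg_square_pos[OF ab r False])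
    define \<psi> where "\<psi> = (\<lambda>x. 1 / sqrt N * r x)"
    have \<psi>: "\<psi> \<in> poly_space m" unfolding \<psi>_def by (rule poly_space_cmult[OF r])
    have \<psi>\<psi>: "avg ?R (\<lambda>x. \<psi> x * \<psi> x) = 1"
    proof -
      have "(\<lambda>x. \<psi> x * \<psi> x) = (\<lambda>x. 1 / N * (r x * r x))"
        using N by (simp add: \<psi>_def fun_eq_iff field_simps)
      then show ?thesis using N by (simp only: avg_cmult) (simp add: N_def)
    qed
    have \<psi>\<phi>: "avg ?R (\<lambda>x. \<psi> x * \<phi> x) = 0" "avg ?R (\<lambda>x. \<phi> x * \<psi> x) = 0" if "\<phi> \<in> \<Phi>" for \<phi>
    proof -
      have "(\<lambda>x. \<psi> x * \<phi> x) = (\<lambda>x. 1 / sqrt N * (r x * \<phi> x))"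
        by (simp add: \<psi>_def fun_eq_iff)
      then show "avg ?R (\<lambda>x. \<psi> x * \<phi> x) = 0" using orth[OF that] by (simp only: avg_cmult mult_zero_right)
      then show "avg ?R (\<lambda>x. \<phi> x * \<psi> x) = 0" by (simp only: mult.commute)
    qed
    have "\<psi> \<notin> \<Phi>" using \<psi>\<psi> \<psi>\<phi>(1) by force
    have "s \<in> lin_span (insert \<psi> \<Phi>)"
    proof -
      have "s = (\<lambda>x. sqrt N * \<psi> x + pr x)" using N by (simp add: \<psi>_def r_def fun_eq_iff)
      moreover have "\<psi> \<in> lin_span (insert \<psi> \<Phi>)" using \<Phi>(1) by (intro lin_span_base) auto
      ultimately show ?thesis
        using lin_span_axpy[OF _ lin_span_insert_mono[OF \<Phi>(1) pr(2)]] by metis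
    qed
    moreover have "S \<subseteq> lin_span (insert \<psi> \<Phi>)" using \<Phi>(3) lin_span_insert_mono[OF \<Phi>(1)] by blast
    moreover have "avg ?R (\<lambda>x. \<alpha> x * \<beta> x) = (if \<alpha> = \<beta> then 1 else 0)"
      if "\<alpha> \<in> insert \<psi> \<Phi>" "\<beta> \<in> insert \<psi> \<Phi>" for \<alpha> \<beta>
      using that on[of \<alpha> \<beta>] \<psi>\<psi> \<psi>\<phi>[of \<alpha>] \<psi>\<phi>[of \<beta>] \<open>\<psi> \<notin> \<Phi>\<close> by (cases "\<alpha> = \<psi>"; cases "\<beta> = \<psi>") auto
    ultimately show ?thesis
      using \<Phi>(1,2) \<psi> by (intro exI[of _ "insert \<psi> \<Phi>"]) auto
  qed
qed

lemma monomial_in_poly_space: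
  assumes "\<alpha> \<in> multi_indices m"
  shows "(\<lambda>x::real^'n. \<Prod>i\<in>UNIV. (x $ i) ^ \<alpha> i) \<in> poly_space m"
proof -
  have eq: "(\<Prod>i\<in>UNIV. (x $ i) ^ \<alpha> i)
      = (\<Sum>\<beta>\<in>multi_indices m. (if \<beta> = \<alpha> then 1 else 0) * (\<Prod>i\<in>UNIV. (x $ i) ^ \<beta> i))" for x :: "real^'n"
  proof -
    have "(\<Sum>\<beta>\<in>multi_indices m. (if \<beta> = \<alpha> then 1 else 0) * (\<Prod>i\<in>UNIV. (x $ i) ^ \<beta> i))
      = (\<Sum>\<beta>\<in>multi_indices m. if \<beta> = \<alpha> then (\<Prod>i\<in>UNIV. (x $ i) ^ \<beta> i) else 0)"
      by (intro sum.cong) auto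
    also have "\<dots> = (\<Prod>i\<in>UNIV. (x $ i) ^ \<alpha> i)"
      unfolding sum.delta[OF finite_multi_indices] using assms by (simp only: if_True)
    finally show ?thesis by (rule sym)
  qed
  show ?thesis
    unfolding poly_space_def mem_Collect_eq
    by (rule exI[of _ "\<lambda>\<beta>. if \<beta> = \<alpha> then 1 else 0"], rule ext, rule eq)
qed

text \<open>Guarantees that the choice operator in \<open>poly_proj\<close> selects a genuine
  orthonormal basis.\<close>

lemma orthonormal_basis_exists:
  fixes a b :: "real ^ 'n"
  assumes ab: "\<And>i. a $ i < b $ i"
  shows "\<exists>\<Phi>. orthonormal_basis m (box a b) \<Phi>"
proof -
  define S where "S = (\<lambda>\<alpha> (x::real^'n). \<Prod>i\<in>UNIV. (x $ i) ^ \<alpha> i) ` multi_indices m"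
  have S: "finite S" unfolding S_def by (rule finite_imageI[OF finite_multi_indices])
  have Sp: "S \<subseteq> poly_space m"
    unfolding S_def by (rule image_subsetI) (rule monomial_in_poly_space)
  obtain \<Phi> where \<Phi>: "finite \<Phi>" "\<Phi> \<subseteq> poly_space m"
     "\<forall>\<phi>\<in>\<Phi>. \<forall>\<psi>\<in>\<Phi>. avg (box a b) (\<lambda>x. \<phi> x * \<psi> x) = (if \<phi> = \<psi> then 1 else 0)" "S \<subseteq> lin_span \<Phi>"
    using gram_schmidt[OF ab S Sp] by (elim exE conjE)
  have "p \<in> lin_span \<Phi>" if pm: "p \<in> poly_space m" for p
  proof -
    obtain c where c: "p = (\<lambda>x. \<Sum>\<alpha>\<in>multi_indices m. c \<alpha> * (\<Prod>i\<in>UNIV. (x $ i) ^ \<alpha> i))"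
      using pm by (rule poly_spaceE)
    have "(\<lambda>x. \<Prod>i\<in>UNIV. (x $ i) ^ \<alpha> i) \<in> lin_span \<Phi>" if "\<alpha> \<in> multi_indices m" for \<alpha>
      using \<Phi>(4) imageI[OF that] unfolding S_def by (rule subsetD)
    then show ?thesis unfolding c by (rule lin_span_sum)
  qed
  then have sp: "\<forall>p\<in>poly_space m. \<exists>c. p = (\<lambda>x. \<Sum>\<phi>\<in>\<Phi>. c \<phi> * \<phi> x)"
    unfolding lin_span_def by simp
  show ?thesis
    unfolding orthonormal_basis_def
    by (rule exI[of _ \<Phi>], rule conjI[OF \<Phi>(1)], rule conjI[OF \<Phi>(2)], rule conjI[OF \<Phi>(3) sp])
qed

lemma poly_projE:
  fixes a b :: "real ^ 'n"
  assumes ab: "\<And>i. a $ i < b $ i"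
  obtains \<Phi> where "orthonormal_basis m (box a b) \<Phi>"
    "\<And>f. poly_proj m (box a b) f = (\<lambda>x. \<Sum>\<phi>\<in>\<Phi>. avg (box a b) (\<lambda>y. f y * \<phi> y) * \<phi> x)"
  using someI_ex[OF orthonormal_basis_exists[OF ab, of m]]
  by (rule that[of "SOME \<Phi>. orthonormal_basis m (box a b) \<Phi>"]) (simp only: poly_proj_def Let_def)

lemma poly_proj_in_poly_space:
  assumes ab: "\<And>i. a $ i < b $ i"
  shows "poly_proj m (box a b) f \<in> poly_space m"
proof -
  obtain \<Phi> where \<Phi>: "orthonormal_basis m (box a b) \<Phi>"
    "poly_proj m (box a b) f = (\<lambda>x. \<Sum>\<phi>\<in>\<Phi>. avg (box a b) (\<lambda>y. f y * \<phi> y) * \<phi> x)"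
    by (rule poly_projE[OF ab, of m]) (rule that)
  show ?thesis unfolding \<Phi>(2)
    using \<Phi>(1) by (intro poly_space_sum) (auto simp: orthonormal_basis_def)
qed

lemma poly_proj_orthogonal:
  assumes ab: "\<And>i. a $ i < b $ i" and f: "set_integrable lebesgue (box a b) f" and p: "p \<in> poly_space m"
  shows "avg (box a b) (\<lambda>x. poly_proj m (box a b) f x * p x) = avg (box a b) (\<lambda>x. f x * p x)"
proof -
  let ?R = "box a b"
  obtain \<Phi> where ob: "orthonormal_basis m ?R \<Phi>"
    and P: "poly_proj m ?R f = (\<lambda>x. \<Sum>\<phi>\<in>\<Phi>. avg ?R (\<lambda>y. f y * \<phi> y) * \<phi> x)"
    by (rule poly_projE[OF ab, of m]) (rule that)
  note \<Phi> = ob[unfolded orthonormal_basis_def]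
  obtain c where c: "p = (\<lambda>x. \<Sum>\<phi>\<in>\<Phi>. c \<phi> * \<phi> x)"
    using \<Phi>[THEN conjunct2, THEN conjunct2, THEN conjunct2, rule_format, OF p] by (elim exE)
  note Pp = poly_proj_in_poly_space[OF ab, of m f]
  have 1: "avg ?R (\<lambda>x. poly_proj m ?R f x * \<psi> x) = avg ?R (\<lambda>x. f x * \<psi> x)" if \<psi>: "\<psi> \<in> \<Phi>" for \<psi>
    unfolding P using \<Phi> \<psi> by (intro avg_orthonormal_sum[of \<Phi> m]) auto
  have "avg ?R (\<lambda>x. poly_proj m ?R f x * p x) = avg ?R (\<lambda>x. \<Sum>\<phi>\<in>\<Phi>. c \<phi> * (poly_proj m ?R f x * \<phi> x))"
    by (simp add: c sum_distrib_left mult_ac)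
  also have "\<dots> = (\<Sum>\<phi>\<in>\<Phi>. c \<phi> * avg ?R (\<lambda>x. poly_proj m ?R f x * \<phi> x))"
    using \<Phi> Pp by (intro avg_sum set_integrable_poly_mult) auto
  also have "\<dots> = (\<Sum>\<phi>\<in>\<Phi>. c \<phi> * avg ?R (\<lambda>x. f x * \<phi> x))"
    by (intro sum.cong refl) (simp add: 1)
  also have "\<dots> = avg ?R (\<lambda>x. \<Sum>\<phi>\<in>\<Phi>. c \<phi> * (f x * \<phi> x))"
    using \<Phi> f by (intro avg_sum[symmetric] set_integrable_mult_poly) auto
  also have "\<dots> = avg ?R (\<lambda>x. f x * p x)"
    by (simp add: c sum_distrib_left mult_ac)
  finally show ?thesis .
qed

text \<open>The difference of two candidates is orthogonal to every polynomial, in particular to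
  itself. This frees all later arguments from the chosen basis.\<close>

lemma poly_proj_unique:
  assumes ab: "\<And>i. a $ i < b $ i" and f: "set_integrable lebesgue (box a b) f" and r: "r \<in> poly_space m"
    and eq: "\<And>p. p \<in> poly_space m \<Longrightarrow> avg (box a b) (\<lambda>x. r x * p x) = avg (box a b) (\<lambda>x. f x * p x)"
  shows "poly_proj m (box a b) f = r"
proof (rule ccontr)
  let ?R = "box a b"
  define d where "d = (\<lambda>x. poly_proj m ?R f x - r x)"
  note Pp = poly_proj_in_poly_space[OF ab, of m f]
  assume "poly_proj m ?R f \<noteq> r"
  then have "d \<noteq> (\<lambda>x. 0)" by (auto simp: d_def fun_eq_iff)
  moreover have d: "d \<in> poly_space m" unfolding d_def by (rule poly_space_diff[OF Pp r])
  ultimately have "0 < avg ?R (\<lambda>x. d x * d x)" by (intro poly_avg_square_pos ab)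
  also have "avg ?R (\<lambda>x. d x * d x) = avg ?R (\<lambda>x. poly_proj m ?R f x * d x - r x * d x)"
    by (simp add: d_def left_diff_distrib)
  also have "\<dots> = avg ?R (\<lambda>x. poly_proj m ?R f x * d x) - avg ?R (\<lambda>x. r x * d x)"
    by (rule avg_diff[OF set_integrable_poly_mult[OF Pp d] set_integrable_poly_mult[OF r d]])
  also have "\<dots> = 0" by (simp add: poly_proj_orthogonal[OF ab f d] eq[OF d])
  finally show False by simp
qed

lemma poly_proj_diff_poly:
  assumes ab: "\<And>i. a $ i < b $ i" and f: "set_integrable lebesgue (box a b) f" and r: "r \<in> poly_space m"
  shows "poly_proj m (box a b) (\<lambda>x. f x - r x) = (\<lambda>x. poly_proj m (box a b) f x - r x)"
proof (rule poly_proj_unique[OF ab])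
  let ?R = "box a b"
  note Pp = poly_proj_in_poly_space[OF ab, of m f]
  have ri: "set_integrable lebesgue ?R r" by (rule poly_set_integrable[OF r])
  show "set_integrable lebesgue ?R (\<lambda>x. f x - r x)" by (rule set_integral_diff(1)[OF f ri])
  show "(\<lambda>x. poly_proj m ?R f x - r x) \<in> poly_space m" by (rule poly_space_diff[OF Pp r])
  fix p :: "(real,'a) vec \<Rightarrow> real" assume p: "p \<in> poly_space m"
  show "avg ?R (\<lambda>x. (poly_proj m ?R f x - r x) * p x) = avg ?R (\<lambda>x. (f x - r x) * p x)"
    unfolding left_diff_distrib
    using avg_diff[OF set_integrable_poly_mult[OF Pp p] set_integrable_poly_mult[OF r p]]
      avg_diff[OF set_integrable_mult_poly[OF p f] set_integrable_poly_mult[OF r p]]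
      poly_proj_orthogonal[OF ab f p] by simp
qed

text \<open>
  By self-adjointness the mean square of \<open>P\<^sub>R f\<close> is at most the mean of \<open>f\<close> times the
  supremum of \<open>P\<^sub>R f\<close>, and the supremum is controlled by the mean.
\<close>
lemma poly_proj_sup_bound:
  fixes a b :: "real ^ 'n"
  assumes ab: "\<And>i. a $ i < b $ i" and f: "set_integrable lebesgue (box a b) f" and x: "x \<in> box a b"
  shows "\<bar>poly_proj m (box a b) f x\<bar> \<le> (poly_const m TYPE('n))\<^sup>2 * avg (box a b) (\<lambda>y. \<bar>f y\<bar>)"
proof -
  let ?R = "box a b" and ?K = "poly_const m TYPE('n)"
  define P where "P = poly_proj m ?R f"
  define s where "s = avg ?R (\<lambda>y. \<bar>P y\<bar>)"
  define F where "F = avg ?R (\<lambda>y. \<bar>f y\<bar>)"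
  have K: "?K \<ge> 1" by (rule poly_const_ge_1)
  have P: "P \<in> poly_space m" unfolding P_def by (rule poly_proj_in_poly_space[OF ab])
  have sup: "\<bar>P y\<bar> \<le> ?K * s" if "y \<in> ?R" for y
    unfolding s_def by (rule poly_sup_bound[OF ab P that])
  have s0: "s \<ge> 0" "F \<ge> 0" unfolding s_def F_def by (rule avg_nonneg; simp)+
  have "s * s \<le> avg ?R (\<lambda>y. P y * P y)" unfolding s_def by (rule avg_abs_square_le[OF ab P])
  also have "\<dots> = avg ?R (\<lambda>y. f y * P y)"
    using poly_proj_orthogonal[OF ab f P] by (simp add: P_def)
  also have "\<dots> \<le> avg ?R (\<lambda>y. (?K * s) * \<bar>f y\<bar>)"
  proof (rule avg_mono)
    show "set_integrable lebesgue ?R (\<lambda>y. f y * P y)" by (rule set_integrable_mult_poly[OF P f])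
    show "set_integrable lebesgue ?R (\<lambda>y. (?K * s) * \<bar>f y\<bar>)"
      by (intro set_integrable_mult_right set_integrable_abs f)
    fix y assume "y \<in> ?R"
    have "f y * P y \<le> \<bar>P y\<bar> * \<bar>f y\<bar>" by (metis abs_ge_self abs_mult mult.commute)
    also have "\<dots> \<le> (?K * s) * \<bar>f y\<bar>" by (intro mult_right_mono sup \<open>y \<in> ?R\<close>) simp
    finally show "f y * P y \<le> (?K * s) * \<bar>f y\<bar>" .
  qed
  also have "\<dots> = s * (?K * F)" unfolding avg_cmult by (simp add: F_def)
  finally have ss: "s * s \<le> s * (?K * F)" .
  have "s \<le> ?K * F"
  proof (cases "s = 0")
    case True
    then show ?thesis using K s0 by simp
  next
    case False
    then show ?thesis using ss s0 by simp
  qed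
  then have "?K * s \<le> ?K * (?K * F)" using K by (intro mult_left_mono) auto
  then show ?thesis using sup[OF x] by (simp add: P_def F_def power2_eq_square mult.assoc)
qed

text \<open>The projection reproduces polynomials, so the supremum bound may be applied to
  \<open>f - r\<close>. Taking for \<open>r\<close> the projection belonging to a larger box
  compares the two projections.\<close>

lemma poly_proj_near:
  fixes a b :: "real ^ 'n"
  assumes ab: "\<And>i. a $ i < b $ i" and f: "set_integrable lebesgue (box a b) f" and r: "r \<in> poly_space m"
    and x: "x \<in> box a b"
  shows "\<bar>poly_proj m (box a b) f x - r x\<bar> \<le> (poly_const m TYPE('n))\<^sup>2 * avg (box a b) (\<lambda>y. \<bar>f y - r y\<bar>)"
  using poly_proj_sup_bound[OF ab set_integral_diff(1)[OF f poly_set_integrable[OF r]] x, of m]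
  unfolding poly_proj_diff_poly[OF ab f r] .

section \<open>Mean oscillation\<close>

definition osc :: "nat \<Rightarrow> (real ^ 'n \<Rightarrow> real) \<Rightarrow> (real ^ 'n) set \<Rightarrow> real" where
  "osc m f R = avg R (\<lambda>x. \<bar>f x - poly_proj m R f x\<bar>)"

lemma osc_integrable:
  assumes ab: "\<And>i. a $ i < b $ i" and f: "set_integrable lebesgue (box a b) f"
  shows "set_integrable lebesgue (box a b) (\<lambda>x. f x - poly_proj m (box a b) f x)"
  by (rule set_integral_diff(1)[OF f poly_set_integrable[OF poly_proj_in_poly_space[OF ab]]])

lemma osc_nonneg: "0 \<le> osc m f R"
  unfolding osc_def by (rule avg_nonneg) simp

text \<open>The projection is a near-best polynomial approximation in the mean: by
  \<open>poly_proj_near\<close> replacing \<open>r\<close> by it costs only a constant.\<close>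

lemma osc_le_poly:
  fixes a b :: "real ^ 'n"
  assumes ab: "\<And>i. a $ i < b $ i" and f: "set_integrable lebesgue (box a b) f" and r: "r \<in> poly_space m"
  shows "osc m f (box a b) \<le> (1 + (poly_const m TYPE('n))\<^sup>2) * avg (box a b) (\<lambda>y. \<bar>f y - r y\<bar>)"
proof -
  let ?R = "box a b"
  define A where "A = avg ?R (\<lambda>y. \<bar>f y - r y\<bar>)"
  define c where "c = (poly_const m TYPE('n))\<^sup>2 * A"
  have i: "set_integrable lebesgue ?R (\<lambda>y. \<bar>f y - r y\<bar>)"
    by (intro set_integrable_abs set_integral_diff(1) f poly_set_integrable[OF r])
  have "osc m f ?R \<le> avg ?R (\<lambda>y. \<bar>f y - r y\<bar> + c)"
    unfolding osc_def
  proof (rule avg_mono)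
    show "set_integrable lebesgue ?R (\<lambda>x. \<bar>f x - poly_proj m ?R f x\<bar>)"
      by (intro set_integrable_abs osc_integrable[OF ab f])
    show "set_integrable lebesgue ?R (\<lambda>y. \<bar>f y - r y\<bar> + c)"
      by (intro set_integral_add(1) i set_integrable_const_box)
    fix x assume x: "x \<in> ?R"
    show "\<bar>f x - poly_proj m ?R f x\<bar> \<le> \<bar>f x - r x\<bar> + c"
      using poly_proj_near[OF ab f r x] unfolding c_def A_def by linarith
  qed
  also have "\<dots> = A + c"
    using avg_add[OF i set_integrable_const_box[of a b c]] avg_const_box[OF ab, of c] by (simp add: A_def)
  also have "\<dots> = (1 + (poly_const m TYPE('n))\<^sup>2) * A" by (simp add: c_def algebra_simps)
  finally show ?thesis unfolding A_def .
qed

section \<open>Oscillation on overlapping corner boxes\<close>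

lemma set_integral_subset_le:
  fixes g :: "'a \<Rightarrow> real"
  assumes "set_integrable M Q g" "set_integrable M R g" "Q \<subseteq> R" "\<And>x. 0 \<le> g x"
  shows "(LINT x:Q|M. g x) \<le> (LINT x:R|M. g x)"
  unfolding set_lebesgue_integral_def
  using assms unfolding set_integrable_def
  by (intro integral_mono) (auto split: split_indicator)

text \<open>Three losses: near-best approximation on the large box, the number of corner boxes (one
  for each set of coordinates), and the replacement of the polynomial of one corner box by that of
  another.\<close>

definition chain_const :: "nat \<Rightarrow> 'n::finite itself \<Rightarrow> real" where
  "chain_const m T = (1 + (poly_const m T)\<^sup>2) * real (card (UNIV :: 'n set set)) * (1 + 2 * poly_const m T)"

lemma chain_const_pos: "0 < chain_const m TYPE('n::finite)"
proof -
  have "0 < card (UNIV :: 'n set set)" by (simp add: card_gt_0_iff)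
  then show ?thesis
    unfolding chain_const_def using poly_const_ge_1[of m, where 'n='n]
    by (intro mult_pos_pos) (auto intro: add_pos_nonneg)
qed

lemma box_subset_cart:
  fixes a b u v :: "real ^ 'n"
  assumes "\<And>i. a $ i \<le> u $ i" "\<And>i. v $ i \<le> b $ i"
  shows "box u v \<subseteq> box a b"
proof
  fix x assume "x \<in> box u v"
  then have "u $ i < x $ i" "x $ i < v $ i" for i by (auto simp: mem_box_cart)
  then have "a $ i < x $ i \<and> x $ i < b $ i" for i
    using assms[of i] by (meson le_less_trans less_le_trans)
  then show "x \<in> box a b" by (simp add: mem_box_cart)
qed

lemma LINT_osc:
  fixes a b :: "real ^ 'n"
  assumes "\<And>i. a $ i < b $ i"
  shows "(LINT x:box a b|lebesgue. \<bar>f x - poly_proj m (box a b) f x\<bar>) = measure lebesgue (box a b) * osc m f (box a b)"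
  using measure_box_pos[OF assms] by (simp add: osc_def avg_def)

text \<open>Cutting one margin off one face in every coordinate gives the corner boxes
  \<open>B S\<close>; they cover the box and all contain the core \<open>Q\<close>. On
  \<open>Q\<close> any two of their projections are close in the mean, since both are close to
  \<open>f\<close>, and the core bound turns this into closeness on the whole box. Hence the
  projection of the corner box \<open>T\<close> of largest oscillation approximates \<open>f\<close>
  on all of them.\<close>

lemma osc_corner:
  fixes a b :: "real ^ 'n"
  assumes ab: "\<And>i. a $ i < b $ i" and f: "set_integrable lebesgue (box a b) f"
  shows "\<exists>u v. (\<forall>i. u $ i < v $ i) \<and> box u v \<subseteq> box a b \<and> v - u = (1 - core_eps m) *\<^sub>R (b - a) \<and>
    osc m f (box a b) \<le> chain_const m TYPE('n) * osc m f (box u v)"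
proof -
  let ?e = "core_eps m" and ?R = "box a b" and ?K = "poly_const m TYPE('n)"
  define d where "d i = ?e * (b $ i - a $ i)" for i
  define lo where "lo S = (\<chi> i. if i \<in> S then a $ i else a $ i + d i)" for S :: "'n set"
  define hi where "hi S = (\<chi> i. if i \<in> S then b $ i - d i else b $ i)" for S :: "'n set"
  define B where "B S = box (lo S) (hi S)" for S
  define Q where "Q = box (a + ?e *\<^sub>R (b - a)) (b - ?e *\<^sub>R (b - a))"
  define P where "P S = poly_proj m (B S) f" for S
  have el: "0 < d i" "d i \<le> (b $ i - a $ i) / 8" for i
  proof -
    have l: "0 < b $ i - a $ i" using ab[of i] by simp
    then show "0 < d i" unfolding d_def by (rule mult_pos_pos[OF core_eps(1)])
    have "d i \<le> 1 / 8 * (b $ i - a $ i)"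
      unfolding d_def by (rule mult_right_mono[OF core_eps(2)]) (use l in linarith)
    then show "d i \<le> (b $ i - a $ i) / 8" by simp
  qed
  have Qd: "(a + ?e *\<^sub>R (b - a)) $ i = a $ i + d i" "(b - ?e *\<^sub>R (b - a)) $ i = b $ i - d i" for i
    by (simp_all add: d_def)
  have K: "?K \<ge> 1" by (rule poly_const_ge_1)
  have lohi: "lo S $ i < hi S $ i" for S i
    using el[of i] ab[of i] by (cases "i \<in> S") (simp_all add: lo_def hi_def)
  have BR: "B S \<subseteq> ?R" for S
    unfolding B_def using el(1) by (intro box_subset_cart) (auto simp: lo_def hi_def less_imp_le)
  have QB: "Q \<subseteq> B S" for S
    unfolding B_def Q_def using el(1) by (intro box_subset_cart) (auto simp: lo_def hi_def less_imp_le Qd simp del: vector_add_component vector_minus_component)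
  have scale: "hi S - lo S = (1 - ?e) *\<^sub>R (b - a)" for S
    by (simp add: vec_eq_iff lo_def hi_def d_def algebra_simps)
  have mR: "0 < measure lebesgue ?R" by (rule measure_box_pos[OF ab])
  have mB: "measure lebesgue (B S) \<le> measure lebesgue ?R" for S
    by (rule measure_mono_fmeasurable[OF BR]) (auto simp: B_def)
  have cover: "\<exists>S. x \<in> B S" if "x \<in> ?R" for x
  proof -
    \<comment> \<open>In each coordinate the upper margin is cut off if \<open>x\<close> lies in the
      lower half, and the lower margin otherwise.\<close>
    have "x \<in> B {i. x $ i < (a $ i + b $ i) / 2}"
      unfolding B_def mem_box_cart
    proof
      fix i
      have "a $ i < x $ i" "x $ i < b $ i" using that by (auto simp: mem_box_cart)
      then show "lo {i. x $ i < (a $ i + b $ i) / 2} $ i < x $ i \<and> x $ i < hi {i. x $ i < (a $ i + b $ i) / 2} $ i"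
        using el[of i] by (auto simp: lo_def hi_def field_simps)
    qed
    then show ?thesis by blast
  qed
  obtain T where T: "\<And>S. osc m f (B S) \<le> osc m f (B T)"
  proof -
    have "Max (range (\<lambda>S. osc m f (B S))) \<in> range (\<lambda>S. osc m f (B S))" by (rule Max_in) auto
    then obtain T where "Max (range (\<lambda>S. osc m f (B S))) = osc m f (B T)" by (rule imageE)
    moreover have "osc m f (B S) \<le> Max (range (\<lambda>S. osc m f (B S)))" for S by (rule Max_ge) auto
    ultimately show ?thesis using that by metis
  qed
  define E where "E = osc m f (B T)"
  have E0: "E \<ge> 0" unfolding E_def by (rule osc_nonneg)
  have fB: "set_integrable lebesgue (B S) f" for S
    by (rule set_integrable_subset[OF f _ BR]) (simp add: B_def)
  have PS: "P S \<in> poly_space m" for S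
    unfolding P_def B_def by (rule poly_proj_in_poly_space[OF lohi])
  have iR: "set_integrable lebesgue ?R (\<lambda>x. \<bar>f x - P S x\<bar>)" for S
    by (intro set_integrable_abs set_integral_diff(1) f poly_set_integrable[OF PS])
  have iB: "set_integrable lebesgue (B U) (\<lambda>x. \<bar>f x - P S x\<bar>)" for S U
    by (rule set_integrable_subset[OF iR _ BR]) (simp add: B_def)
  have iQ: "set_integrable lebesgue Q (\<lambda>x. \<bar>f x - P S x\<bar>)" for S
    by (rule set_integrable_subset[OF iB _ QB]) (simp add: Q_def)
  have IB: "(LINT x:B S|lebesgue. \<bar>f x - P S x\<bar>) \<le> measure lebesgue ?R * E" for S
  proof -
    have "(LINT x:B S|lebesgue. \<bar>f x - P S x\<bar>) = measure lebesgue (B S) * osc m f (B S)"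
      unfolding P_def B_def by (rule LINT_osc[OF lohi])
    also have "\<dots> \<le> measure lebesgue ?R * E"
      unfolding E_def by (intro mult_mono mB T osc_nonneg) auto
    finally show ?thesis .
  qed
  have IQ: "(LINT x:Q|lebesgue. \<bar>f x - P S x\<bar>) \<le> measure lebesgue ?R * E" for S
    using set_integral_subset_le[OF iQ iB QB, of S S] IB[of S] by auto
  \<comment> \<open>The mean of \<open>P S - P T\<close> over the core is at most the sum of two
    means of \<open>f\<close> minus a projection, each bounded by the extremal oscillation
    \<open>E\<close>.\<close>
  have close: "\<bar>P S x - P T x\<bar> \<le> 2 * ?K * E" if x: "x \<in> ?R" for S x
  proof -
    have dp: "(\<lambda>x. P S x - P T x) \<in> poly_space m" by (rule poly_space_diff[OF PS PS])
    have "\<bar>P S x - P T x\<bar> * measure lebesgue ?R \<le> ?K * (LINT y:Q|lebesgue. \<bar>P S y - P T y\<bar>)"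
      using poly_core_bound[OF ab dp x] by (simp add: poly_const_def Q_def)
    also have "(LINT y:Q|lebesgue. \<bar>P S y - P T y\<bar>) \<le> (LINT y:Q|lebesgue. \<bar>f y - P S y\<bar> + \<bar>f y - P T y\<bar>)"
      using poly_set_integrable[OF dp] unfolding Q_def[symmetric]
      by (intro set_integral_mono set_integral_add(1) iQ set_integrable_abs) (auto simp: Q_def poly_set_integrable[OF dp])
    also have "\<dots> = (LINT y:Q|lebesgue. \<bar>f y - P S y\<bar>) + (LINT y:Q|lebesgue. \<bar>f y - P T y\<bar>)"
      by (rule set_integral_add(2)[OF iQ iQ])
    also have "\<dots> \<le> 2 * (measure lebesgue ?R * E)" using IQ[of S] IQ[of T] by linarith
    finally have "\<bar>P S x - P T x\<bar> * measure lebesgue ?R \<le> (2 * ?K * E) * measure lebesgue ?R"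
      using K by (simp add: mult_ac)
    then show ?thesis using mR by simp
  qed
  have "(LINT x:?R|lebesgue. \<bar>f x - P T x\<bar>) \<le> (\<Sum>S\<in>UNIV. LINT x:B S|lebesgue. \<bar>f x - P T x\<bar>)"
  proof -
    have "(LINT x:?R|lebesgue. \<bar>f x - P T x\<bar>) \<le> (LINT x|lebesgue. (\<Sum>S\<in>UNIV. indicator (B S) x *\<^sub>R \<bar>f x - P T x\<bar>))"
      unfolding set_lebesgue_integral_def
    proof (rule integral_mono)
      show "integrable lebesgue (\<lambda>x. indicator ?R x *\<^sub>R \<bar>f x - P T x\<bar>)"
        using iR[of T] by (simp add: set_integrable_def)
      show "integrable lebesgue (\<lambda>x. \<Sum>S\<in>UNIV. indicator (B S) x *\<^sub>R \<bar>f x - P T x\<bar>)"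
        using iB[of _ T] by (intro Bochner_Integration.integrable_sum) (simp add: set_integrable_def)
      fix x
      show "indicator ?R x *\<^sub>R \<bar>f x - P T x\<bar> \<le> (\<Sum>S\<in>UNIV. indicator (B S) x *\<^sub>R \<bar>f x - P T x\<bar>)"
      proof (cases "x \<in> ?R")
        case True
        then obtain S where "x \<in> B S" using cover by blast
        then have "indicator ?R x *\<^sub>R \<bar>f x - P T x\<bar> = indicator (B S) x *\<^sub>R \<bar>f x - P T x\<bar>"
          using True by simp
        also have "\<dots> \<le> (\<Sum>S\<in>UNIV. indicator (B S) x *\<^sub>R \<bar>f x - P T x\<bar>)"
          by (rule member_le_sum) auto
        finally show ?thesis .
      qed (simp add: sum_nonneg)
    qed
    also have "\<dots> = (\<Sum>S\<in>UNIV. LINT x:B S|lebesgue. \<bar>f x - P T x\<bar>)"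
      unfolding set_lebesgue_integral_def using iB[of _ T]
      by (intro Bochner_Integration.integral_sum) (simp add: set_integrable_def)
    finally show ?thesis .
  qed
  also have "\<dots> \<le> (\<Sum>S\<in>(UNIV::'n set set). measure lebesgue ?R * ((1 + 2 * ?K) * E))"
  proof (rule sum_mono)
    fix S :: "'n set"
    have c: "set_integrable lebesgue (B S) (\<lambda>x. 2 * ?K * E)" unfolding B_def by (rule set_integrable_const_box)
    have "(LINT x:B S|lebesgue. \<bar>f x - P T x\<bar>) \<le> (LINT x:B S|lebesgue. \<bar>f x - P S x\<bar> + 2 * ?K * E)"
    proof (rule set_integral_mono[OF iB set_integral_add(1)[OF iB c]])
      fix x assume "x \<in> B S"
      then show "\<bar>f x - P T x\<bar> \<le> \<bar>f x - P S x\<bar> + 2 * ?K * E" using close[of x S] BR by fastforce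
    qed
    also have "\<dots> = (LINT x:B S|lebesgue. \<bar>f x - P S x\<bar>) + (LINT x:B S|lebesgue. 2 * ?K * E)"
      by (rule set_integral_add(2)[OF iB c])
    also have "(LINT x:B S|lebesgue. 2 * ?K * E) = measure lebesgue (B S) * (2 * ?K * E)"
      unfolding B_def by (rule LINT_const_box)
    also have "\<dots> \<le> measure lebesgue ?R * (2 * ?K * E)"
      using K E0 by (intro mult_right_mono mB) auto
    finally show "(LINT x:B S|lebesgue. \<bar>f x - P T x\<bar>) \<le> measure lebesgue ?R * ((1 + 2 * ?K) * E)"
      using IB[of S] by (simp add: algebra_simps)
  qed
  also have "\<dots> = real (card (UNIV :: 'n set set)) * (measure lebesgue ?R * ((1 + 2 * ?K) * E))" by simp
  finally have "avg ?R (\<lambda>x. \<bar>f x - P T x\<bar>) \<le> real (card (UNIV :: 'n set set)) * ((1 + 2 * ?K) * E)"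
    using mR unfolding avg_def by (simp add: pos_divide_le_eq mult_ac)
  then have "(1 + ?K\<^sup>2) * avg ?R (\<lambda>x. \<bar>f x - P T x\<bar>) \<le> (1 + ?K\<^sup>2) * (real (card (UNIV :: 'n set set)) * ((1 + 2 * ?K) * E))"
    by (intro mult_left_mono) auto
  then have "osc m f ?R \<le> chain_const m TYPE('n) * E"
    using osc_le_poly[OF ab f PS[of T]] unfolding chain_const_def by (simp only: mult.assoc)
  then show ?thesis
    using lohi scale BR unfolding E_def B_def by blast
qed

lemma osc_chain:
  fixes a b :: "real ^ 'n"
  assumes ab: "\<And>i. a $ i < b $ i" and f: "set_integrable lebesgue (box a b) f"
  shows "\<exists>u v. (\<forall>i. u $ i < v $ i) \<and> box u v \<subseteq> box a b \<and> v - u = (1 - core_eps m) ^ k *\<^sub>R (b - a) \<and>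
    osc m f (box a b) \<le> chain_const m TYPE('n) ^ k * osc m f (box u v)"
proof (induction k)
  case 0
  show ?case using ab by (intro exI[of _ a] exI[of _ b]) simp
next
  case (Suc k)
  then obtain u v where uv: "\<And>i. u $ i < v $ i" "box u v \<subseteq> box a b" "v - u = (1 - core_eps m) ^ k *\<^sub>R (b - a)"
    "osc m f (box a b) \<le> chain_const m TYPE('n) ^ k * osc m f (box u v)" by blast
  have "set_integrable lebesgue (box u v) f" by (rule set_integrable_subset[OF f _ uv(2)]) simp
  then obtain u' v' where uv': "\<forall>i. u' $ i < v' $ i" "box u' v' \<subseteq> box u v"
    "v' - u' = (1 - core_eps m) *\<^sub>R (v - u)" "osc m f (box u v) \<le> chain_const m TYPE('n) * osc m f (box u' v')"
    using osc_corner[OF uv(1)] by blast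
  have "chain_const m TYPE('n) ^ k * osc m f (box u v)
      \<le> chain_const m TYPE('n) ^ k * (chain_const m TYPE('n) * osc m f (box u' v'))"
    using chain_const_pos[of m, where 'n='n] by (intro mult_left_mono uv'(4)) auto
  then have "osc m f (box a b) \<le> chain_const m TYPE('n) ^ Suc k * osc m f (box u' v')"
    using uv(4) by (simp add: mult_ac)
  moreover have "v' - u' = (1 - core_eps m) ^ Suc k *\<^sub>R (b - a)"
    unfolding uv'(3) uv(3) by simp
  ultimately show ?case using uv'(1,2) uv(2) by blast
qed

section \<open>Weights and rectangles\<close>

lemma box_in_rectangles:
  fixes a b :: "real ^ 'n"
  assumes ab: "\<And>i. a $ i < b $ i"
  shows "box a b \<in> rectangles"
proof -
  have "(\<forall>i. is_interval {a $ i<..<b $ i} \<and> bounded {a $ i<..<b $ i} \<and> interior {a $ i<..<b $ i} \<noteq> {})"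
    using ab by (simp add: is_interval_oo interior_open not_le)
  moreover have "box a b = {x. \<forall>i. x $ i \<in> {a $ i<..<b $ i}}" by (auto simp: mem_box_cart)
  ultimately show ?thesis
    unfolding rectangles_def mem_Collect_eq by (intro exI[of _ "\<lambda>i. {a $ i<..<b $ i}"]) simp
qed

lemma rectangle_sandwich:
  fixes R :: "(real ^ 'n) set"
  assumes "R \<in> rectangles"
  shows "\<exists>a b. (\<forall>i. a $ i < b $ i) \<and> box a b \<subseteq> R \<and> R \<subseteq> cbox a b"
proof -
  obtain I :: "'n \<Rightarrow> real set" where I0: "\<forall>i. is_interval (I i) \<and> bounded (I i) \<and> interior (I i) \<noteq> {}"
    and R: "R = {x. \<forall>i. x $ i \<in> I i}"
    using assms unfolding rectangles_def mem_Collect_eq by (elim exE conjE) (rule that)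
  have I: "is_interval (I i)" "bounded (I i)" "interior (I i) \<noteq> {}" for i
    using I0[rule_format, of i] by simp_all
  define a where "a = (\<chi> i. Inf (I i))"
  define b where "b = (\<chi> i. Sup (I i))"
  have ne: "I i \<noteq> {}" for i using I(3)[of i] interior_subset by fastforce
  have bd: "bdd_below (I i)" "bdd_above (I i)" for i
    using I(2)[of i] by (simp_all add: bounded_imp_bdd_below bounded_imp_bdd_above)
  have 1: "a $ i < b $ i" for i
  proof -
    obtain y where "y \<in> interior (I i)" using I(3)[of i] by blast
    then obtain e where e: "e > 0" "cball y e \<subseteq> interior (I i)"
      using open_contains_cball[of "interior (I i)"] open_interior by blast
    have "y - e \<in> cball y e" "y + e \<in> cball y e" using e(1) by (auto simp: dist_real_def)
    then have m: "y - e \<in> I i" "y + e \<in> I i" using e(2) interior_subset by blast+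
    have "Inf (I i) \<le> y - e" by (rule cInf_lower[OF m(1) bd(1)])
    moreover have "y + e \<le> Sup (I i)" by (rule cSup_upper[OF m(2) bd(2)])
    ultimately show ?thesis using e(1) by (simp add: a_def b_def)
  qed
  have 2: "box a b \<subseteq> R"
  proof
    fix x assume x: "x \<in> box a b"
    have "x $ i \<in> I i" for i
    proof -
      have "Inf (I i) < x $ i" "x $ i < Sup (I i)" using x by (auto simp: mem_box_cart a_def b_def)
      then obtain s t where "s \<in> I i" "s < x $ i" "t \<in> I i" "x $ i < t"
        using cInf_less_iff[OF ne bd(1)] less_cSup_iff[OF ne bd(2)] by blast
      then show ?thesis
        using I(1)[of i] unfolding is_interval_1 by (meson less_imp_le)
    qed
    then show "x \<in> R" by (simp add: R)
  qed
  have 3: "R \<subseteq> cbox a b"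
    unfolding R using bd by (auto simp: mem_box_cart a_def b_def intro!: cInf_lower cSup_upper)
  show ?thesis using 1 2 3 by blast
qed

lemma AE_box_sandwich:
  fixes a b :: "real ^ 'n"
  assumes "box a b \<subseteq> R" "R \<subseteq> cbox a b"
  shows "AE x in lebesgue. x \<in> R \<longleftrightarrow> x \<in> box a b"
proof -
  have "negligible (cbox a b - box a b)" by (rule negligible_frontier_interval)
  then have "cbox a b - box a b \<in> null_sets lebesgue" by (simp add: negligible_iff_null_sets)
  then have "AE x in lebesgue. x \<notin> cbox a b - box a b" by (rule AE_not_in)
  then show ?thesis
  proof eventually_elim
    case (elim x)
    then show ?case using assms by blast
  qed
qed

lemma sandwich_sets:
  fixes a b :: "real ^ 'n"
  assumes "box a b \<subseteq> R" "R \<subseteq> cbox a b"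
  shows "R \<in> sets lebesgue"
proof -
  have "negligible (R - box a b)"
    using assms by (intro negligible_subset[OF negligible_frontier_interval[of a b]]) auto
  then have "R - box a b \<in> sets lebesgue" by (simp add: negligible_iff_null_sets null_setsD2)
  moreover have "R = box a b \<union> (R - box a b)" using assms by blast
  ultimately show ?thesis by (metis sets.Un borel_open open_box sets_completionI_sets sets_lborel)
qed

lemma set_nn_integral_sandwich:
  fixes a b :: "real ^ 'n"
  assumes "box a b \<subseteq> R" "R \<subseteq> cbox a b"
  shows "(\<integral>\<^sup>+x\<in>R. g x \<partial>lebesgue) = (\<integral>\<^sup>+x\<in>box a b. g x \<partial>lebesgue)"
  by (rule nn_integral_cong_AE) (use AE_box_sandwich[OF assms] in \<open>eventually_elim, simp add: indicator_def\<close>)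

text \<open>No measurability of \<open>g\<close> is assumed: Lebesgue measure is complete, so both
  integrands are measurable or neither is, and in the latter case both integrals have the default
  value 0. With this, \<open>avg_sandwich\<close> becomes an equality of operators.\<close>

lemma set_integral_sandwich:
  fixes a b :: "real ^ 'n" and g :: "real ^ 'n \<Rightarrow> real"
  assumes "box a b \<subseteq> R" "R \<subseteq> cbox a b"
  shows "(LINT x:R|lebesgue. g x) = (LINT x:box a b|lebesgue. g x)"
proof -
  define g1 where "g1 x = indicator R x *\<^sub>R g x" for x
  define g2 where "g2 x = indicator (box a b) x *\<^sub>R g x" for x
  have ae: "AE x in lebesgue. g1 x = g2 x"
    using AE_box_sandwich[OF assms] by eventually_elim (simp add: g1_def g2_def indicator_def)
  have "integral\<^sup>L lebesgue g1 = integral\<^sup>L lebesgue g2"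
  proof (cases "g1 \<in> borel_measurable lebesgue")
    case True
    then have "g2 \<in> borel_measurable lebesgue" by (rule borel_measurable_AE[OF _ ae])
    then show ?thesis using ae True by (intro integral_cong_AE)
  next
    case False
    have "AE x in lebesgue. g2 x = g1 x" using ae by eventually_elim simp
    then have "g2 \<notin> borel_measurable lebesgue" using False borel_measurable_AE by blast
    then have "\<not> integrable lebesgue g1" "\<not> integrable lebesgue g2"
      using False borel_measurable_integrable by blast+
    then show ?thesis by (simp add: not_integrable_integral_eq)
  qed
  then show ?thesis unfolding set_lebesgue_integral_def g1_def g2_def .
qed

lemma emeasure_sandwich:
  fixes a b :: "real ^ 'n"
  assumes "box a b \<subseteq> R" "R \<subseteq> cbox a b"
  shows "emeasure lebesgue R = emeasure lebesgue (box a b)"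
  using AE_box_sandwich[OF assms] sandwich_sets[OF assms] by (intro emeasure_eq_AE) auto

lemma avg_sandwich:
  fixes a b :: "real ^ 'n"
  assumes "box a b \<subseteq> R" "R \<subseteq> cbox a b"
  shows "avg R = avg (box a b)"
  by (rule ext) (simp add: avg_def set_integral_sandwich[OF assms] measure_def emeasure_sandwich[OF assms])

text \<open>Since the averages agree on all functions, \<open>orthonormal_basis\<close> is the same
  predicate for both sets, and the choice operator returns the same basis.\<close>

lemma poly_proj_sandwich:
  fixes a b :: "real ^ 'n"
  assumes "box a b \<subseteq> R" "R \<subseteq> cbox a b"
  shows "poly_proj m R = poly_proj m (box a b)"
  by (rule ext) (simp only: poly_proj_def orthonormal_basis_def avg_sandwich[OF assms])

lemma locally_integrable_box:
  assumes "locally_integrable f"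
  shows "set_integrable lebesgue (box a b) f"
proof -
  have "set_integrable lebesgue (cbox a b) f" using assms by (simp add: locally_integrable_def)
  then show ?thesis by (rule set_integrable_subset) (simp_all add: box_subset_cbox)
qed

lemma locally_integrable_measurable:
  assumes "locally_integrable f"
  shows "f \<in> borel_measurable lebesgue"
proof (rule borel_measurable_LIMSEQ_real)
  fix i :: nat
  show "(\<lambda>x. indicator (cball 0 (real i)) x *\<^sub>R f x) \<in> borel_measurable lebesgue"
    using assms compact_cball[of 0 "real i"]
    unfolding locally_integrable_def set_integrable_def by (blast intro: borel_measurable_integrable)
next
  fix x :: "real ^ 'a"
  obtain N :: nat where N: "norm x \<le> real N" using real_arch_simple by blast
  have "\<forall>\<^sub>F i in sequentially. indicator (cball 0 (real i)) x *\<^sub>R f x = f x"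
    using eventually_ge_at_top[of N]
  proof eventually_elim
    case (elim i)
    then have "norm x \<le> real i" using N by linarith
    then show ?case by simp
  qed
  then show "(\<lambda>i. indicator (cball 0 (real i)) x *\<^sub>R f x) \<longlonglongrightarrow> f x"
    by (rule tendsto_eventually)
qed

lemma set_nn_integral_eq_LINT:
  fixes g :: "'a \<Rightarrow> real"
  assumes "set_integrable M R g" "\<And>x. 0 \<le> g x"
  shows "(\<integral>\<^sup>+x\<in>R. ennreal (g x) \<partial>M) = ennreal (LINT x:R|M. g x)"
proof -
  have "(\<integral>\<^sup>+x\<in>R. ennreal (g x) \<partial>M) = (\<integral>\<^sup>+x. ennreal (indicator R x *\<^sub>R g x) \<partial>M)"
    by (intro nn_integral_cong) (simp split: split_indicator)
  also have "\<dots> = ennreal (LINT x:R|M. g x)"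
    using assms unfolding set_integrable_def set_lebesgue_integral_def
    by (intro nn_integral_eq_integral) auto
  finally show ?thesis .
qed

lemma box_integral_pos:
  fixes a b :: "real ^ 'n" and g :: "real ^ 'n \<Rightarrow> real"
  assumes ab: "\<And>i. a $ i < b $ i" and g: "set_integrable lebesgue (box a b) g" "\<And>x. 0 \<le> g x"
    and pos: "AE x in lebesgue. x \<in> box a b \<longrightarrow> 0 < g x"
  shows "0 < (LINT x:box a b|lebesgue. g x)"
proof (rule ccontr)
  assume "\<not> 0 < (LINT x:box a b|lebesgue. g x)"
  moreover have "0 \<le> (LINT x:box a b|lebesgue. g x)" using g(2) by (simp add: set_lebesgue_integral_def)
  ultimately have "(LINT x|lebesgue. indicator (box a b) x *\<^sub>R g x) = 0"
    by (simp add: set_lebesgue_integral_def)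
  then have "AE x in lebesgue. indicator (box a b) x *\<^sub>R g x = 0"
    using g unfolding set_integrable_def
    by (subst (asm) integral_nonneg_eq_0_iff_AE) auto
  then have "AE x in lebesgue. x \<notin> box a b" using pos by eventually_elim auto
  then have "box a b \<in> null_sets lebesgue" by (subst AE_iff_null_sets) simp_all
  then have "emeasure lebesgue (box a b) = 0" by (rule null_setsD1)
  then have "measure lebesgue (box a b) = 0" by (simp only: measure_def enn2real_0)
  then show False using measure_box_pos[OF ab] by simp
qed

lemma navg_box:
  fixes a b :: "real ^ 'n" and g :: "real ^ 'n \<Rightarrow> real"
  assumes ab: "\<And>i. a $ i < b $ i" and g: "set_integrable lebesgue (box a b) g" "\<And>x. 0 \<le> g x"
  shows "navg (box a b) (\<lambda>x. ennreal (g x)) = ennreal (avg (box a b) g)"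
  unfolding navg_def avg_def set_nn_integral_eq_LINT[OF g] emeasure_box_lebesgue
  using measure_box_pos[OF ab] g(2)
  by (intro divide_ennreal) (simp_all add: set_lebesgue_integral_def)

text \<open>Weighted arithmetic-geometric inequality for \<open>t\<close> and
  \<open>t powr (- 1 / (q - 1))\<close>, whose weighted geometric mean is 1: bound both terms below
  by their tangents in \<open>ln t\<close>, and the logarithms cancel. The equality case serves to
  prove that the constant of a nontrivial weight exceeds 1.\<close>

lemma weighted_am_gm:
  fixes t :: real
  assumes t: "t > 0" and q: "q > 1"
  shows "1 \<le> 1 / q * t + (1 - 1 / q) * t powr (- 1 / (q - 1))"
    and "1 / q * t + (1 - 1 / q) * t powr (- 1 / (q - 1)) = 1 \<Longrightarrow> t = 1"
proof -
  have a: "1 + ln t \<le> t" using ln_le_minus_one[OF t] by simp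
  have "1 + - 1 / (q - 1) * ln t \<le> exp (- 1 / (q - 1) * ln t)" by (rule exp_ge_add_one_self)
  then have b: "1 - ln t / (q - 1) \<le> t powr (- 1 / (q - 1))" using t by (simp add: powr_def)
  have "(1 - 1 / q) * (1 - ln t / (q - 1)) \<le> (1 - 1 / q) * t powr (- 1 / (q - 1))"
    by (rule mult_left_mono[OF b]) (use q in simp)
  moreover have "(1 - 1 / q) * (1 - ln t / (q - 1)) = 1 - 1 / q - 1 / q * ln t"
    using q by (simp add: field_simps)
  ultimately have c: "1 - 1 / q - 1 / q * ln t \<le> (1 - 1 / q) * t powr (- 1 / (q - 1))" by simp
  have d: "1 / q * (1 + ln t) \<le> 1 / q * t" by (rule mult_left_mono[OF a]) (use q in simp)
  show "1 \<le> 1 / q * t + (1 - 1 / q) * t powr (- 1 / (q - 1))"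
    using c d by (simp add: algebra_simps)
  assume "1 / q * t + (1 - 1 / q) * t powr (- 1 / (q - 1)) = 1"
  then have "1 / q * t \<le> 1 / q * (1 + ln t)" using c by (simp add: algebra_simps)
  then have "t \<le> 1 + ln t" using q by (simp add: divide_le_cancel)
  then have "ln t = t - 1" using a by simp
  then show "t = 1" by (rule ln_eq_minus_one[OF t])
qed

lemma set_nn_integral_AE_le:
  assumes "AE x in M. x \<in> R \<longrightarrow> f x \<le> g x"
  shows "(\<integral>\<^sup>+x\<in>R. f x \<partial>M) \<le> (\<integral>\<^sup>+x\<in>R. g x \<partial>M)"
  by (rule nn_integral_mono_AE) (use assms in \<open>eventually_elim, simp split: split_indicator\<close>)

lemma set_nn_integral_const_box:
  fixes a b :: "real ^ 'n"
  shows "(\<integral>\<^sup>+x\<in>box a b. c \<partial>lebesgue) = c * ennreal (measure lebesgue (box a b))"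
  by (simp add: nn_integral_cmult_indicator emeasure_box_lebesgue)

text \<open>For \<open>c = 0\<close> the quotient is \<open>0 / 0 = 0\<close>.\<close>
lemma Ainf_le_1_if_locally_constant:
  fixes w :: "real ^ 'n \<Rightarrow> real"
  assumes const: "\<And>a b :: real ^ 'n. (\<And>i. a $ i < b $ i) \<Longrightarrow> \<exists>c\<ge>0. AE x in lebesgue. x \<in> box a b \<longrightarrow> w x = c"
  shows "Ainf_const w \<le> 1"
  unfolding Ainf_const_def
proof (rule SUP_least)
  fix R :: "(real ^ 'n) set" assume "R \<in> rectangles"
  then obtain a b where ab': "\<forall>i. a $ i < b $ i" and R: "box a b \<subseteq> R" "R \<subseteq> cbox a b"
    using rectangle_sandwich by blast
  have ab: "a $ i < b $ i" for i using ab' by simp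
  let ?m = "measure lebesgue (box a b)"
  have m: "?m > 0" by (rule measure_box_pos[OF ab])
  obtain c where c: "c \<ge> 0" "AE x in lebesgue. x \<in> box a b \<longrightarrow> w x = c" using const[OF ab] by blast
  have wR: "AE x in lebesgue. x \<in> R \<longrightarrow> w x = c"
    using c(2) AE_box_sandwich[OF R] by eventually_elim simp
  have M: "strong_maximal (\<lambda>y. w y * indicator R y) x \<le> ennreal c" for x
    unfolding strong_maximal_def
  proof (rule SUP_least)
    fix S assume "S \<in> {S \<in> rectangles. x \<in> S}"
    then have "S \<in> rectangles" by simp
    then obtain u v where uv': "\<forall>i. u $ i < v $ i" and S: "box u v \<subseteq> S" "S \<subseteq> cbox u v"
      using rectangle_sandwich by blast
    have uv: "u $ i < v $ i" for i using uv' by simp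
    let ?k = "measure lebesgue (box u v)"
    have k: "?k > 0" by (rule measure_box_pos[OF uv])
    have "(\<integral>\<^sup>+y\<in>S. ennreal \<bar>w y * indicator R y\<bar> \<partial>lebesgue) = (\<integral>\<^sup>+y\<in>box u v. ennreal \<bar>w y * indicator R y\<bar> \<partial>lebesgue)"
      by (rule set_nn_integral_sandwich[OF S])
    also have "\<dots> \<le> (\<integral>\<^sup>+y\<in>box u v. ennreal c \<partial>lebesgue)"
      by (rule set_nn_integral_AE_le) (use wR c(1) in \<open>eventually_elim, simp split: split_indicator\<close>)
    also have "\<dots> = ennreal c * ennreal ?k" by (rule set_nn_integral_const_box)
    finally have "navg S (\<lambda>y. ennreal \<bar>w y * indicator R y\<bar>) \<le> ennreal c * ennreal ?k / ennreal ?k"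
      unfolding navg_def emeasure_sandwich[OF S] emeasure_box_lebesgue by (rule divide_right_mono_ennreal)
    also have "\<dots> = ennreal c"
      using k c(1) by (simp add: ennreal_mult[symmetric] divide_ennreal)
    finally show "navg S (\<lambda>y. ennreal \<bar>w y * indicator R y\<bar>) \<le> ennreal c" .
  qed
  have "(\<integral>\<^sup>+x\<in>R. strong_maximal (\<lambda>y. w y * indicator R y) x \<partial>lebesgue) \<le> (\<integral>\<^sup>+x\<in>R. ennreal c \<partial>lebesgue)"
    by (rule set_nn_integral_AE_le) (simp add: M)
  also have "\<dots> = ennreal (c * ?m)"
    unfolding set_nn_integral_sandwich[OF R] set_nn_integral_const_box using c(1) by (simp add: ennreal_mult)
  finally have num: "(\<integral>\<^sup>+x\<in>R. strong_maximal (\<lambda>y. w y * indicator R y) x \<partial>lebesgue) \<le> ennreal (c * ?m)" .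
  have "(\<integral>\<^sup>+x\<in>R. ennreal (w x) \<partial>lebesgue) = (\<integral>\<^sup>+x\<in>R. ennreal c \<partial>lebesgue)"
    by (rule nn_integral_cong_AE) (use wR in \<open>eventually_elim, simp split: split_indicator\<close>)
  also have "\<dots> = ennreal (c * ?m)"
    unfolding set_nn_integral_sandwich[OF R] set_nn_integral_const_box using c(1) by (simp add: ennreal_mult)
  finally have den: "(\<integral>\<^sup>+x\<in>R. ennreal (w x) \<partial>lebesgue) = ennreal (c * ?m)" .
  have "(\<integral>\<^sup>+x\<in>R. strong_maximal (\<lambda>y. w y * indicator R y) x \<partial>lebesgue) / (\<integral>\<^sup>+x\<in>R. ennreal (w x) \<partial>lebesgue)
      \<le> ennreal (c * ?m) / ennreal (c * ?m)"
    unfolding den by (rule divide_right_mono_ennreal[OF num])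
  also have "\<dots> \<le> 1"
  proof (cases "c = 0")
    case False
    then have "c * ?m > 0" using c(1) m by simp
    then show ?thesis by (simp add: divide_ennreal)
  qed simp
  finally show "(\<integral>\<^sup>+x\<in>R. strong_maximal (\<lambda>y. w y * indicator R y) x \<partial>lebesgue) / (\<integral>\<^sup>+x\<in>R. ennreal (w x) \<partial>lebesgue) \<le> 1" .
qed

lemma exists_box_pos:
  fixes w :: "real ^ 'n \<Rightarrow> real"
  assumes w: "weight w" and Ainf: "Ainf_const w > 1"
  shows "\<exists>a b :: real ^ 'n. (\<forall>i. a $ i < b $ i) \<and> 0 < wmeas w (box a b)"
proof (rule ccontr)
  assume "\<not> ?thesis"
  then have no: "\<not> 0 < wmeas w (box a b)" if "\<And>i. a $ i < b $ i" for a b :: "real ^ 'n"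
    using that by blast
  have "Ainf_const w \<le> 1"
  proof (rule Ainf_le_1_if_locally_constant)
    fix a b :: "real ^ 'n" assume ab: "\<And>i. a $ i < b $ i"
    have w0: "\<And>x. 0 \<le> w x" and wi: "set_integrable lebesgue (box a b) w"
      using w by (auto simp: weight_def intro: locally_integrable_box)
    have "wmeas w (box a b) \<ge> 0" using w0 by (simp add: wmeas_def set_lebesgue_integral_def)
    then have "(LINT x|lebesgue. indicator (box a b) x *\<^sub>R w x) = 0"
      using no[OF ab] by (simp add: wmeas_def set_lebesgue_integral_def)
    then have "AE x in lebesgue. indicator (box a b) x *\<^sub>R w x = 0"
      using w0 wi unfolding set_integrable_def
      by (subst (asm) integral_nonneg_eq_0_iff_AE) auto
    then have "AE x in lebesgue. x \<in> box a b \<longrightarrow> w x = 0"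
      by eventually_elim (auto simp: indicator_def split: if_splits)
    then show "\<exists>c\<ge>0. AE x in lebesgue. x \<in> box a b \<longrightarrow> w x = c" by blast
  qed
  then show False using Ainf by simp
qed

text \<open>The supremum defining the essential infimum is reached along a sequence, so only
  countably many exceptional null sets have to be united.\<close>

lemma ess_inf_attained:
  "AE x in lebesgue. x \<in> R \<longrightarrow> ess_inf_on R w \<le> ennreal (w x)"
proof -
  let ?T = "{t. AE x in lebesgue. x \<in> R \<longrightarrow> t \<le> ennreal (w x)}"
  have "?T \<noteq> {}" by (auto intro!: exI[of _ 0])
  from ennreal_Sup_countable_SUP[OF this]
  obtain f :: "nat \<Rightarrow> ennreal" where f: "range f \<subseteq> ?T" "Sup ?T = (SUP i. f i)"
    by (elim exE conjE) (rule that)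
  have "AE x in lebesgue. x \<in> R \<longrightarrow> f i \<le> ennreal (w x)" for i using f(1) by auto
  then have "AE x in lebesgue. \<forall>i. x \<in> R \<longrightarrow> f i \<le> ennreal (w x)"
    unfolding AE_all_countable by blast
  then show ?thesis
    unfolding ess_inf_on_def f(2)
  proof eventually_elim
    case (elim x)
    show ?case using elim by (auto intro: SUP_least)
  qed
qed

lemma A1_pointwise:
  fixes w :: "real ^ 'n \<Rightarrow> real"
  assumes w: "weight w" and A1: "A1_const w < \<infinity>" and ab: "\<And>i. a $ i < b $ i"
  shows "AE x in lebesgue. x \<in> box a b \<longrightarrow> avg (box a b) w \<le> enn2real (A1_const w) * w x"
proof -
  let ?R = "box a b"
  define e where "e = ess_inf_on ?R w"
  have w0: "\<And>x. 0 \<le> w x" and wi: "set_integrable lebesgue ?R w"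
    using w by (auto simp: weight_def intro: locally_integrable_box)
  have m: "measure lebesgue ?R > 0" by (rule measure_box_pos[OF ab])
  define N where "N = avg ?R w"
  have N0: "N \<ge> 0" unfolding N_def by (rule avg_nonneg[OF w0])
  have navg: "navg ?R (\<lambda>x. ennreal (w x)) = ennreal N" unfolding N_def by (rule navg_box[OF ab wi w0])
  \<comment> \<open>An infinite essential infimum would make the integral of \<open>w\<close> over
    the box infinite.\<close>
  have "e * ennreal (measure lebesgue ?R) \<le> (\<integral>\<^sup>+x\<in>?R. ennreal (w x) \<partial>lebesgue)"
    unfolding set_nn_integral_const_box[symmetric] e_def
    by (rule set_nn_integral_AE_le[OF ess_inf_attained])
  also have "\<dots> < \<infinity>" by (simp add: set_nn_integral_eq_LINT[OF wi w0])
  finally have "e \<noteq> \<infinity>" using m by (auto simp: ennreal_top_mult)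
  then obtain r where r: "r \<ge> 0" "e = ennreal r" by (cases e) auto
  define C where "C = {c. \<forall>R\<in>rectangles. navg R (\<lambda>x. ennreal (w x)) \<le> c * ess_inf_on R w}"
  have C: "ennreal N \<le> c * ennreal r" if "c \<in> C" for c
    using that box_in_rectangles[OF ab] unfolding C_def navg[symmetric] r(2)[symmetric] e_def by blast
  define A where "A = enn2real (A1_const w)"
  have A: "A1_const w = ennreal A" "A \<ge> 0" using A1 by (auto simp: A_def)
  have NA: "N \<le> A * r"
  proof (rule field_le_epsilon)
    fix \<epsilon> :: real assume \<epsilon>: "\<epsilon> > 0"
    \<comment> \<open>The infimum defining the constant is approached from above by admissible
      \<open>c\<close>. The excess \<open>\<epsilon> / (r + 1)\<close> contributes less than
      \<epsilon> after multiplication by \<open>r\<close>, also when \<open>r = 0\<close>.\<close>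
    have "Inf C < ennreal (A + \<epsilon> / (r + 1))"
      using A r \<epsilon> unfolding C_def A1_const_def[symmetric] by (simp add: ennreal_lessI)
    then obtain c where c: "c \<in> C" "c < ennreal (A + \<epsilon> / (r + 1))" unfolding Inf_less_iff by blast
    have "ennreal N \<le> c * ennreal r" by (rule C[OF c(1)])
    also have "\<dots> \<le> ennreal (A + \<epsilon> / (r + 1)) * ennreal r" using c(2) by (intro mult_right_mono) auto
    also have "\<dots> = ennreal ((A + \<epsilon> / (r + 1)) * r)" using A r \<epsilon> by (simp add: ennreal_mult)
    finally have "N \<le> (A + \<epsilon> / (r + 1)) * r" using A r \<epsilon> by (subst (asm) ennreal_le_iff) auto
    also have "\<dots> = A * r + \<epsilon> * (r / (r + 1))" by (simp add: algebra_simps)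
    also have "\<epsilon> * (r / (r + 1)) \<le> \<epsilon> * 1" using \<epsilon> r by (intro mult_left_mono) auto
    finally show "N \<le> A * r + \<epsilon>" by simp
  qed
  show ?thesis
    using ess_inf_attained[of ?R w]
  proof (eventually_elim, intro impI)
    fix x assume x: "x \<in> ?R \<longrightarrow> ess_inf_on ?R w \<le> ennreal (w x)" "x \<in> ?R"
    then have "ennreal r \<le> ennreal (w x)" using r(2) e_def by simp
    then have "r \<le> w x" using w0 by simp
    then have "A * r \<le> A * w x" using A(2) by (rule mult_left_mono)
    then show "avg ?R w \<le> enn2real (A1_const w) * w x" using NA by (simp add: N_def A_def)
  qed
qed

lemma enn_powr_neg:
  assumes "r < 0" "0 \<le> v"
  shows "enn_powr (ennreal v) r = (if v = 0 then \<infinity> else ennreal (v powr r))"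
  using assms by (auto simp: enn_powr_def)

lemma enn_powr_pos:
  assumes "r > 0" "0 \<le> v"
  shows "enn_powr (ennreal v) r = ennreal (v powr r)"
  using assms by (auto simp: enn_powr_def)

section \<open>Nontrivial weights: positivity and the dual weight\<close>

locale nontrivial_Aq_weight =
  fixes w :: "real ^ 'n \<Rightarrow> real" and q :: real
  assumes in_class: "w \<in> Aq_class q" and q1: "1 \<le> q" and Ainf: "1 < Ainf_const w"
begin

definition A :: real where "A = enn2real (Aq_const q w)"

text \<open>The dual weight for \<open>q > 1\<close>, with real powers: it is 0 where
  \<open>w\<close> vanishes, whereas the constant uses \<infinity> there. The two versions agree
  almost everywhere once \<open>w_pos\<close> is known.\<close>

definition \<sigma> :: "real ^ 'n \<Rightarrow> real" where "\<sigma> x = w x powr (- 1 / (q - 1))"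

lemma weight: "weight w" using in_class by (simp add: Aq_class_def)

lemma w0: "0 \<le> w x" using weight by (simp add: weight_def)

lemma w_int: "set_integrable lebesgue (box a b) w"
  using weight by (auto simp: weight_def intro: locally_integrable_box)

lemma w_meas: "w \<in> borel_measurable lebesgue"
  using weight by (auto simp: weight_def intro: locally_integrable_measurable)

lemma Aq_eq: "Aq_const q w = ennreal A"
  using in_class by (auto simp: A_def Aq_class_def)

lemma A0: "0 \<le> A" by (simp add: A_def)

lemma \<sigma>0: "0 \<le> \<sigma> x" by (simp add: \<sigma>_def)

lemma wmeas_eq: "wmeas w (box a b) = measure lebesgue (box a b) * avg (box a b) w"
  if "\<And>i. a $ i < b $ i" for a b
  using measure_box_pos[OF that] by (simp add: wmeas_def avg_def)

lemma product_le:
  assumes ab: "\<And>i. a $ i < b $ i" and q: "q > 1"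
  shows "ennreal (avg (box a b) w) *
    enn_powr (navg (box a b) (\<lambda>x. enn_powr (ennreal (w x)) (- 1 / (q - 1)))) (q - 1) \<le> ennreal A"
proof -
  have "navg (box a b) (\<lambda>x. ennreal (w x)) *
    enn_powr (navg (box a b) (\<lambda>x. enn_powr (ennreal (w x)) (- 1 / (q - 1)))) (q - 1) \<le> Aq_const q w"
    using q unfolding Aq_const_def by (simp only: if_False less_irrefl order_less_imp_not_eq2)
      (rule SUP_upper[OF box_in_rectangles[OF ab]])
  then show ?thesis unfolding Aq_eq navg_box[OF ab w_int w0] .
qed

text \<open>A positive average times \<infinity> would exceed the finite constant. Positivity
  matters because \<open>0 * \<infinity> = 0\<close> in \<open>ennreal\<close>: a weight vanishing
  on the whole box does not violate the bound there.\<close>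

lemma \<sigma>_finite:
  assumes ab: "\<And>i. a $ i < b $ i" and q: "q > 1" and pos: "0 < avg (box a b) w"
  shows "(\<integral>\<^sup>+x\<in>box a b. enn_powr (ennreal (w x)) (- 1 / (q - 1)) \<partial>lebesgue) \<noteq> \<infinity>"
proof
  assume "(\<integral>\<^sup>+x\<in>box a b. enn_powr (ennreal (w x)) (- 1 / (q - 1)) \<partial>lebesgue) = \<infinity>"
  then have "navg (box a b) (\<lambda>x. enn_powr (ennreal (w x)) (- 1 / (q - 1))) = \<infinity>"
    unfolding navg_def emeasure_box_lebesgue by (simp add: ennreal_top_divide)
  then have "enn_powr (navg (box a b) (\<lambda>x. enn_powr (ennreal (w x)) (- 1 / (q - 1)))) (q - 1) = \<infinity>"
    using q by (simp add: enn_powr_def)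
  then show False using product_le[OF ab q] pos by (auto simp: ennreal_mult_top top_unique)
qed

lemma \<sigma>_enn_measurable: "q > 1 \<Longrightarrow> (\<lambda>x. enn_powr (ennreal (w x)) (- 1 / (q - 1))) \<in> borel_measurable lebesgue"
proof -
  assume q: "q > 1"
  then have r: "- 1 / (q - 1) < 0" by simp
  show ?thesis unfolding enn_powr_neg[OF r w0] using w_meas by measurable
qed

lemma avg_le_A:
  assumes ab: "\<And>i. a $ i < b $ i" and q: "q = 1"
  shows "AE x in lebesgue. x \<in> box a b \<longrightarrow> avg (box a b) w \<le> A * w x"
proof -
  have eq: "Aq_const q w = A1_const w" unfolding q by (simp add: Aq_const_def)
  have fin: "A1_const w < \<infinity>" using in_class unfolding Aq_class_def eq[symmetric] by simp
  show ?thesis using A1_pointwise[OF weight fin ab] unfolding A_def eq .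
qed

lemma w_pos_of_avg:
  assumes ab: "\<And>i. a $ i < b $ i" and pos: "0 < avg (box a b) w"
  shows "AE x in lebesgue. x \<in> box a b \<longrightarrow> 0 < w x"
proof (cases "q = 1")
  case True
  then have "AE x in lebesgue. x \<in> box a b \<longrightarrow> avg (box a b) w \<le> A * w x"
    by (rule avg_le_A[OF ab])
  then show ?thesis
  proof (eventually_elim, intro impI)
    fix x assume x: "x \<in> box a b \<longrightarrow> avg (box a b) w \<le> A * w x" "x \<in> box a b"
    then have "0 < A * w x" using pos by simp
    then have "w x \<noteq> 0" by auto
    then show "0 < w x" using w0[of x] by simp
  qed
next
  case False
  then have q: "q > 1" using q1 by simp
  then have r: "- 1 / (q - 1) < 0" by simp
  have "AE x in lebesgue. enn_powr (ennreal (w x)) (- 1 / (q - 1)) * indicator (box a b) x \<noteq> \<infinity>"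
    using \<sigma>_enn_measurable[OF q] \<sigma>_finite[OF ab q pos]
    by (intro nn_integral_PInf_AE borel_measurable_times_ennreal borel_measurable_indicator) auto
  then show ?thesis
  proof (eventually_elim, intro impI)
    fix x assume x: "enn_powr (ennreal (w x)) (- 1 / (q - 1)) * indicator (box a b) x \<noteq> \<infinity>" "x \<in> box a b"
    then have "w x \<noteq> 0" unfolding enn_powr_neg[OF r w0] by auto
    then show "0 < w x" using w0[of x] by simp
  qed
qed

text \<open>A box on which \<open>w\<close> vanished could not be excluded by looking at it alone.
  It is enlarged until it contains some box of positive weight, and the condition on the larger box
  gives positivity almost everywhere.\<close>

lemma w_pos:
  assumes ab: "\<And>i. a $ i < b $ i"
  shows "AE x in lebesgue. x \<in> box a b \<longrightarrow> 0 < w x"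
proof -
  obtain c d :: "real ^ 'n" where cd: "\<forall>i. c $ i < d $ i" "0 < wmeas w (box c d)"
    using exists_box_pos[OF weight Ainf] by blast
  define u where "u = (\<chi> i. min (a $ i) (c $ i))"
  define v where "v = (\<chi> i. max (b $ i) (d $ i))"
  have uv: "u $ i < v $ i" for i using ab[of i] by (simp add: u_def v_def min_less_iff_disj less_max_iff_disj)
  have sub: "box a b \<subseteq> box u v" "box c d \<subseteq> box u v"
    by (rule box_subset_cart; simp add: u_def v_def)+
  have "wmeas w (box c d) \<le> wmeas w (box u v)"
    unfolding wmeas_def by (rule set_integral_subset_le[OF w_int w_int sub(2) w0])
  then have "0 < avg (box u v) w"
    using cd(2) measure_box_pos[OF uv] unfolding wmeas_eq[OF uv] by (meson less_le_trans zero_less_mult_pos)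
  from w_pos_of_avg[OF uv this] show ?thesis
  proof eventually_elim
    case (elim x) then show ?case using sub(1) by blast
  qed
qed

lemma W_pos: "0 < wmeas w (box a b)" if ab: "\<And>i. a $ i < b $ i" for a b
  unfolding wmeas_def by (rule box_integral_pos[OF ab w_int w0 w_pos[OF ab]])

lemma avg_pos: "0 < avg (box a b) w" if ab: "\<And>i. a $ i < b $ i" for a b
  using W_pos[OF ab] measure_box_pos[OF ab] unfolding wmeas_eq[OF ab] by (rule zero_less_mult_pos)

lemma \<sigma>_int:
  assumes ab: "\<And>i. a $ i < b $ i" and q: "q > 1"
  shows "set_integrable lebesgue (box a b) \<sigma>"
    and "avg (box a b) w * avg (box a b) \<sigma> powr (q - 1) \<le> A"
proof -
  let ?R = "box a b"
  have r: "- 1 / (q - 1) < 0" using q by simp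
  have eq: "(\<integral>\<^sup>+x\<in>?R. enn_powr (ennreal (w x)) (- 1 / (q - 1)) \<partial>lebesgue) = (\<integral>\<^sup>+x\<in>?R. ennreal (\<sigma> x) \<partial>lebesgue)"
  proof (rule nn_integral_cong_AE)
    have "enn_powr (ennreal (w x)) (- 1 / (q - 1)) = ennreal (\<sigma> x)" if "0 < w x" for x
      unfolding enn_powr_neg[OF r w0] \<sigma>_def using that by simp
    with w_pos[OF ab] show "AE x in lebesgue. enn_powr (ennreal (w x)) (- 1 / (q - 1)) * indicator ?R x
        = ennreal (\<sigma> x) * indicator ?R x"
      by (auto split: split_indicator)
  qed
  have m: "\<sigma> \<in> borel_measurable lebesgue" unfolding \<sigma>_def using w_meas by measurable
  have "(\<integral>\<^sup>+x\<in>?R. ennreal (\<sigma> x) \<partial>lebesgue) < \<infinity>"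
    using \<sigma>_finite[OF ab q avg_pos[OF ab]] unfolding eq by (simp add: less_top)
  also have "(\<integral>\<^sup>+x\<in>?R. ennreal (\<sigma> x) \<partial>lebesgue) = (\<integral>\<^sup>+x. ennreal (indicator ?R x *\<^sub>R \<sigma> x) \<partial>lebesgue)"
    by (intro nn_integral_cong) (simp split: split_indicator)
  finally show i: "set_integrable lebesgue ?R \<sigma>"
    unfolding set_integrable_def using \<sigma>0
    by (intro integrableI_nonneg borel_measurable_scaleR borel_measurable_indicator m) auto
  have "navg ?R (\<lambda>x. enn_powr (ennreal (w x)) (- 1 / (q - 1))) = navg ?R (\<lambda>x. ennreal (\<sigma> x))"
    unfolding navg_def eq ..
  also have "\<dots> = ennreal (avg ?R \<sigma>)" by (rule navg_box[OF ab i \<sigma>0])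
  finally have "ennreal (avg ?R w) * ennreal (avg ?R \<sigma> powr (q - 1)) \<le> ennreal A"
    using product_le[OF ab q] avg_nonneg[of \<sigma> ?R, OF \<sigma>0] q by (simp add: enn_powr_pos)
  then show "avg ?R w * avg ?R \<sigma> powr (q - 1) \<le> A"
    using avg_pos[OF ab] A0 by (simp add: ennreal_mult[symmetric])
qed

end

section \<open>Doubling, interpolation and strictness of the constant\<close>

context nontrivial_Aq_weight
begin

text \<open>\<open>weighted_am_gm\<close> at \<open>t = l powr (1 - q) * w x\<close>, for which the
  dual power is exactly \<open>l * \<sigma> x\<close>. The scale \<open>l\<close> is left free for
  optimisation.\<close>

lemma young_pointwise:
  assumes q: "q > 1" and l: "l > 0" and w: "w x > 0"
  shows "1 \<le> 1 / q * (l powr (1 - q) * w x) + (1 - 1 / q) * (l * \<sigma> x)"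
    and "1 / q * (l powr (1 - q) * w x) + (1 - 1 / q) * (l * \<sigma> x) = 1 \<Longrightarrow> l powr (1 - q) * w x = 1"
proof -
  have "(l powr (1 - q) * w x) powr (- 1 / (q - 1)) = (l powr (1 - q)) powr (- 1 / (q - 1)) * \<sigma> x"
    unfolding \<sigma>_def by (rule powr_mult)
  also have "(l powr (1 - q)) powr (- 1 / (q - 1)) = l powr ((1 - q) * (- 1 / (q - 1)))" by (rule powr_powr)
  also have "(1 - q) * (- 1 / (q - 1)) = 1" using q by (simp add: field_simps)
  finally have *: "(l powr (1 - q) * w x) powr (- 1 / (q - 1)) = l * \<sigma> x" using l by simp
  have t: "l powr (1 - q) * w x > 0" using l w by simp
  show "1 \<le> 1 / q * (l powr (1 - q) * w x) + (1 - 1 / q) * (l * \<sigma> x)"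
    using weighted_am_gm(1)[OF t q] unfolding * .
  show "1 / q * (l powr (1 - q) * w x) + (1 - 1 / q) * (l * \<sigma> x) = 1 \<Longrightarrow> l powr (1 - q) * w x = 1"
    using weighted_am_gm(2)[OF t q] unfolding * .
qed

text \<open>For \<open>q = 1\<close> integrate the pointwise bound over the small box. For
  \<open>q > 1\<close> this is Hoelder's inequality for
  \<open>1 = (w * \<sigma> powr (q - 1)) powr (1 / q)\<close> on the small box, obtained by
  integrating Young's inequality, followed by enlarging the integral of \<sigma> to the large box,
  where the condition applies.\<close>

lemma doubling:
  fixes a b u v :: "real ^ 'n"
  assumes ab: "\<And>i. a $ i < b $ i" and uv: "\<And>i. u $ i < v $ i" and sub: "box u v \<subseteq> box a b"
  shows "(measure lebesgue (box u v) / measure lebesgue (box a b)) powr q * wmeas w (box a b) \<le> A * wmeas w (box u v)"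
proof -
  let ?R = "box a b" and ?Q = "box u v"
  define mR where "mR = measure lebesgue ?R"
  define mQ where "mQ = measure lebesgue ?Q"
  define W where "W = wmeas w ?R"
  define W' where "W' = wmeas w ?Q"
  have pos: "mR > 0" "mQ > 0" "W > 0" "W' > 0"
    unfolding mR_def mQ_def W_def W'_def using measure_box_pos[OF ab] measure_box_pos[OF uv] W_pos[OF ab] W_pos[OF uv] by auto
  have "(mQ / mR) powr q * W \<le> A * W'"
  proof (cases "q = 1")
    case True
    have "(LINT x:?Q|lebesgue. avg ?R w) \<le> (LINT x:?Q|lebesgue. A * w x)"
    proof (rule set_integral_mono_AE)
      show "set_integrable lebesgue ?Q (\<lambda>x. avg ?R w)" by (rule set_integrable_const_box)
      show "set_integrable lebesgue ?Q (\<lambda>x. A * w x)" by (rule set_integrable_mult_right[OF w_int])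
      show "AE x \<in> ?Q in lebesgue. avg ?R w \<le> A * w x"
        using avg_le_A[OF ab True]
      proof eventually_elim
        case (elim x) then show ?case using sub by blast
      qed
    qed
    then have "mQ * avg ?R w \<le> A * W'"
      unfolding LINT_const_box by (simp add: mQ_def W'_def wmeas_def)
    moreover have "avg ?R w = W / mR" by (simp add: avg_def W_def wmeas_def mR_def)
    ultimately show ?thesis using True pos by (simp add: field_simps)
  next
    case False
    then have q: "q > 1" using q1 by simp
    define S where "S = (LINT x:?R|lebesgue. \<sigma> x)"
    have si: "set_integrable lebesgue ?R \<sigma>" "set_integrable lebesgue ?Q \<sigma>"
      by (rule \<sigma>_int(1)[OF ab q], rule \<sigma>_int(1)[OF uv q])
    have S: "S > 0"
      unfolding S_def
    proof (rule box_integral_pos[OF ab si(1) \<sigma>0])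
      show "AE x in lebesgue. x \<in> ?R \<longrightarrow> 0 < \<sigma> x"
        using w_pos[OF ab] by eventually_elim (auto simp: \<sigma>_def)
    qed
    have S': "(LINT x:?Q|lebesgue. \<sigma> x) \<le> S" unfolding S_def by (rule set_integral_subset_le[OF si(2,1) sub \<sigma>0])
    \<comment> \<open>The optimal scale: it makes the two Young terms
      \<open>l powr (1 - q) * W'\<close> and \<open>l * S\<close> equal, so that the convex
      combination collapses to \<open>l * S\<close>.\<close>
    define l where "l = (W' / S) powr (1 / q)"
    have l: "l > 0" unfolding l_def using pos S by simp
    have lq: "l powr q = W' / S" unfolding l_def powr_powr using q pos S by simp
    have iw: "set_integrable lebesgue ?Q (\<lambda>x. 1 / q * (l powr (1 - q) * w x))"
      by (intro set_integrable_mult_right w_int)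
    have is': "set_integrable lebesgue ?Q (\<lambda>x. (1 - 1 / q) * (l * \<sigma> x))"
      by (intro set_integrable_mult_right si(2))
    have "(LINT x:?Q|lebesgue. 1) \<le> (LINT x:?Q|lebesgue. 1 / q * (l powr (1 - q) * w x) + (1 - 1 / q) * (l * \<sigma> x))"
    proof (rule set_integral_mono_AE)
      show "set_integrable lebesgue ?Q (\<lambda>x. 1 :: real)" by (rule set_integrable_const_box)
      show "set_integrable lebesgue ?Q (\<lambda>x. 1 / q * (l powr (1 - q) * w x) + (1 - 1 / q) * (l * \<sigma> x))"
        by (rule set_integral_add(1)[OF iw is'])
      show "AE x \<in> ?Q in lebesgue. 1 \<le> 1 / q * (l powr (1 - q) * w x) + (1 - 1 / q) * (l * \<sigma> x)"
        using w_pos[OF uv]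
      proof eventually_elim
        case (elim x) then show ?case using young_pointwise(1)[OF q l, of x] by blast
      qed
    qed
    also have "\<dots> = 1 / q * (l powr (1 - q) * W') + (1 - 1 / q) * (l * (LINT x:?Q|lebesgue. \<sigma> x))"
      by (subst set_integral_add(2)[OF iw is']) (simp only: set_integral_mult_right W'_def wmeas_def)
    also have "\<dots> \<le> 1 / q * (l powr (1 - q) * W') + (1 - 1 / q) * (l * S)"
      using q l by (intro add_left_mono mult_left_mono S') auto
    also have "l powr (1 - q) * W' = l * S"
    proof -
      have "l powr (1 - q) = l / l powr q" using l by (simp add: powr_diff)
      then show ?thesis unfolding lq using pos S by (simp add: field_simps)
    qed
    also have "1 / q * (l * S) + (1 - 1 / q) * (l * S) = l * S" by (simp add: algebra_simps)
    finally have "mQ \<le> l * S" unfolding LINT_const_box by (simp add: mQ_def)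
    then have "mQ powr q \<le> (l * S) powr q" using q pos by (intro powr_mono2) auto
    also have "\<dots> = W' / S * S powr q" using l S by (simp add: powr_mult lq)
    also have "\<dots> = W' * S powr (q - 1)" using S by (simp add: powr_diff)
    finally have 1: "mQ powr q \<le> W' * S powr (q - 1)" .
    have "W / mR * (S / mR) powr (q - 1) \<le> A"
      using \<sigma>_int(2)[OF ab q] by (simp add: avg_def W_def wmeas_def mR_def S_def)
    moreover have "W / mR * (S / mR) powr (q - 1) = W * S powr (q - 1) / mR powr q"
      using pos S by (simp add: powr_divide powr_diff)
    ultimately have "W * S powr (q - 1) / mR powr q \<le> A" by (simp only:)
    then have 2: "W * S powr (q - 1) \<le> A * mR powr q"
      by (rule pos_divide_le_eq[THEN iffD1, rotated]) (use pos in simp)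
    have "mQ powr q * W \<le> (W' * S powr (q - 1)) * W" using 1 pos by (intro mult_right_mono) auto
    also have "\<dots> = W' * (W * S powr (q - 1))" by (simp only: mult_ac)
    also have "\<dots> \<le> W' * (A * mR powr q)" using 2 pos by (intro mult_left_mono) auto
    finally show ?thesis using pos by (simp add: powr_divide pos_divide_le_eq mult_ac)
  qed
  then show ?thesis by (simp only: mR_def mQ_def W_def W'_def)
qed

text \<open>Meant for \<open>t = a(Q)\<close> on the dyadic boxes \<open>Q\<close> of one
  generation: the integral of a(Q) against Lebesgue measure is bounded by an arbitrarily small
  multiple of a fixed integral plus \<open>K\<close> times a quantity summable through \<mu>.
  Neither \<open>h\<close> nor \<open>K\<close> depends on \<open>t\<close>, hence not on the
  generation. The hypothesis \<open>q \<le> p\<close> allows \<open>t powr q\<close> to be split at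
  a level \<open>s\<close> into a constant and a multiple of \<open>t powr p\<close>.\<close>

lemma interpolation:
  fixes a b :: "real ^ 'n"
  assumes ab: "\<And>i. a $ i < b $ i" and pq: "q \<le> p"
  shows "\<exists>h. set_integrable lebesgue (box a b) h \<and> (\<forall>x. 0 \<le> h x) \<and>
    (\<forall>l>0. \<exists>K\<ge>0. AE x in lebesgue. x \<in> box a b \<longrightarrow> (\<forall>t\<ge>0. t \<le> l * h x + K * (t powr p * w x)))"
proof -
  let ?R = "box a b"
  have split: "t powr q * w x \<le> s powr q * w x + s powr (q - p) * (t powr p * w x)"
    if "s > 0" "t \<ge> 0" for s t x
  proof (cases "t \<le> s")
    case True
    then have "t powr q * w x \<le> s powr q * w x"
      using that q1 w0 by (intro mult_right_mono powr_mono2) auto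
    moreover have "0 \<le> s powr (q - p) * (t powr p * w x)" using w0 by simp
    ultimately show ?thesis by linarith
  next
    case False
    then have "t powr q = t powr p * t powr (q - p)" using that by (simp add: powr_add[symmetric])
    also have "\<dots> \<le> t powr p * s powr (q - p)"
      using False that pq by (intro mult_left_mono powr_mono2') auto
    finally have "t powr q * w x \<le> (t powr p * s powr (q - p)) * w x" using w0 by (intro mult_right_mono) auto
    then have "t powr q * w x \<le> s powr (q - p) * (t powr p * w x)" by (simp only: mult_ac)
    moreover have "0 \<le> s powr q * w x" using w0 by simp
    ultimately show ?thesis by linarith
  qed
  show ?thesis
  proof (cases "q = 1")
    case True
    define c where "c = avg ?R w"
    have c: "c > 0" unfolding c_def by (rule avg_pos[OF ab])
    show ?thesis
    proof (intro exI[of _ w] conjI allI impI)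
      show "set_integrable lebesgue ?R w" by (rule w_int)
      show "0 \<le> w x" for x by (rule w0)
      fix l :: real assume l: "l > 0"
      \<comment> \<open>Chosen so that \<open>A / c * s \<le> l\<close>, the factor that the lower
        bound for \<open>w\<close> puts in front.\<close>
      define s where "s = l * c / (A + 1)"
      have s: "s > 0" unfolding s_def using l c A0 by simp
      define K where "K = A / c * s powr (q - p)"
      have "K \<ge> 0" unfolding K_def using A0 c by simp
      moreover have "AE x in lebesgue. x \<in> ?R \<longrightarrow> (\<forall>t\<ge>0. t \<le> l * w x + K * (t powr p * w x))"
        using avg_le_A[OF ab True]
      proof (eventually_elim, intro impI allI)
        fix x t :: "_" assume x: "x \<in> ?R \<longrightarrow> avg ?R w \<le> A * w x" "x \<in> ?R" and t: "(t::real) \<ge> 0"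
        have "1 \<le> A / c * w x" using x c by (simp add: c_def pos_le_divide_eq)
        then have "t * 1 \<le> t * (A / c * w x)" by (rule mult_left_mono[OF _ t])
        also have "\<dots> = A / c * (t * w x)" by (simp only: mult_ac)
        also have "\<dots> \<le> A / c * (s * w x + s powr (q - p) * (t powr p * w x))"
          using split[OF s t, of x] True t s A0 c by (intro mult_left_mono) auto
        also have "\<dots> = (A / c * s) * w x + K * (t powr p * w x)" by (simp add: K_def algebra_simps)
        also have "A / c * s \<le> l" unfolding s_def using c A0 l by (simp add: field_simps)
        then have "(A / c * s) * w x \<le> l * w x" using w0 by (intro mult_right_mono) auto
        finally show "t \<le> l * w x + K * (t powr p * w x)" by simp
      qed
      ultimately show "\<exists>K\<ge>0. AE x in lebesgue. x \<in> ?R \<longrightarrow> (\<forall>t\<ge>0. t \<le> l * w x + K * (t powr p * w x))"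
        by blast
    qed
  next
    case False
    then have q: "q > 1" using q1 by simp
    have si: "set_integrable lebesgue ?R \<sigma>" by (rule \<sigma>_int(1)[OF ab q])
    show ?thesis
    proof (intro exI[of _ "\<lambda>x. \<sigma> x + w x"] conjI allI impI)
      show "set_integrable lebesgue ?R (\<lambda>x. \<sigma> x + w x)" by (rule set_integral_add(1)[OF si w_int])
      show "0 \<le> \<sigma> x + w x" for x using w0[of x] \<sigma>0[of x] by simp
      fix l :: real assume l: "l > 0"
      \<comment> \<open>At this level the small part \<open>l powr (1 - q) * s powr q\<close> is
        \<open>l\<close> itself, and \<open>h\<close> can be taken to be
        \<open>\<sigma> + w\<close>.\<close>
      define s where "s = l"
      have s: "s > 0" "l powr (1 - q) * s powr q = l" unfolding s_def using l by (simp_all add: powr_add[symmetric])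
      define K where "K = l powr (1 - q) * s powr (q - p)"
      have "K \<ge> 0" unfolding K_def by simp
      moreover have "AE x in lebesgue. x \<in> ?R \<longrightarrow> (\<forall>t\<ge>0. t \<le> l * (\<sigma> x + w x) + K * (t powr p * w x))"
        using w_pos[OF ab]
      proof (eventually_elim, intro impI allI)
        fix x t :: "_" assume x: "x \<in> ?R \<longrightarrow> 0 < w x" "x \<in> ?R" and t: "(t::real) \<ge> 0"
        have wx: "w x > 0" using x by simp
        have sx: "\<sigma> x > 0" using wx by (simp add: \<sigma>_def)
        \<comment> \<open>If \<open>t\<close> exceeds \<open>l * \<sigma> x\<close>, insert
          \<open>\<sigma> x \<le> t / l\<close> into
          \<open>1 = w x * \<sigma> x powr (q - 1)\<close> and multiply by \<open>t\<close>.\<close>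
        have "t \<le> l * \<sigma> x + l powr (1 - q) * (t powr q * w x)"
        proof (cases "t \<le> l * \<sigma> x")
          case True
          moreover have "0 \<le> l powr (1 - q) * (t powr q * w x)" using w0 by simp
          ultimately show ?thesis by linarith
        next
          case False
          then have tl: "\<sigma> x \<le> t / l" "t > 0" using l sx by (auto simp: pos_le_divide_eq mult.commute not_le intro: less_trans[OF mult_pos_pos])
          have "w x * \<sigma> x powr (q - 1) = w x * w x powr (- 1 / (q - 1) * (q - 1))" by (simp add: \<sigma>_def powr_powr)
          also have "\<dots> = 1" using q wx by (simp add: powr_minus)
          finally have "1 = w x * \<sigma> x powr (q - 1)" by simp
          also have "\<dots> \<le> w x * (t / l) powr (q - 1)"
            using tl sx q wx by (intro mult_left_mono powr_mono2) auto
          finally have "t * 1 \<le> t * (w x * (t / l) powr (q - 1))" using t by (intro mult_left_mono) auto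
          also have "\<dots> = l powr (1 - q) * (t powr q * w x)"
            using tl(2) l by (simp add: powr_divide powr_diff)
          finally show ?thesis using l sx by (simp add: add_increasing)
        qed
        also have "l powr (1 - q) * (t powr q * w x) \<le> l powr (1 - q) * (s powr q * w x + s powr (q - p) * (t powr p * w x))"
          by (intro mult_left_mono split s t) auto
        also have "\<dots> = (l powr (1 - q) * s powr q) * w x + K * (t powr p * w x)"
          by (simp add: K_def algebra_simps)
        finally show "t \<le> l * (\<sigma> x + w x) + K * (t powr p * w x)" unfolding s(2) by (simp add: algebra_simps)
      qed
      ultimately show "\<exists>K\<ge>0. AE x in lebesgue. x \<in> ?R \<longrightarrow> (\<forall>t\<ge>0. t \<le> l * (\<sigma> x + w x) + K * (t powr p * w x))"
        by blast
    qed
  qed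
qed

text \<open>If \<open>A \<le> 1\<close>, the inequalities behind the condition become equalities on
  every box: for \<open>q = 1\<close> the weight is at least its average, for \<open>q > 1\<close>
  Young's inequality is an equality almost everywhere. Either way \<open>w\<close> is constant on
  each box, which nontriviality forbids. This makes \<open>ln A\<close> positive, so that the
  denominator in \<open>B_const\<close> is not 0.\<close>

lemma A_gt_1: "1 < A"
proof (rule ccontr)
  assume "\<not> 1 < A"
  then have A1: "A \<le> 1" by simp
  have "Ainf_const w \<le> 1"
  proof (rule Ainf_le_1_if_locally_constant)
    fix a b :: "real ^ 'n" assume ab: "\<And>i. a $ i < b $ i"
    let ?R = "box a b"
    define c where "c = avg ?R w"
    have c: "c > 0" unfolding c_def by (rule avg_pos[OF ab])
    have zeroI: "AE x in lebesgue. x \<in> ?R \<longrightarrow> g x = 0"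
      if "set_integrable lebesgue ?R g" "AE x in lebesgue. x \<in> ?R \<longrightarrow> 0 \<le> g x" "avg ?R g \<le> 0" for g
    proof -
      have n: "AE x in lebesgue. 0 \<le> indicator ?R x *\<^sub>R g x"
        using that(2) by eventually_elim (simp split: split_indicator)
      have "(LINT x|lebesgue. indicator ?R x *\<^sub>R g x) \<le> 0"
        using that(3) measure_box_pos[OF ab] unfolding avg_def set_lebesgue_integral_def by (simp add: divide_le_0_iff)
      moreover have "0 \<le> (LINT x|lebesgue. indicator ?R x *\<^sub>R g x)" by (rule integral_nonneg_AE[OF n])
      ultimately have "AE x in lebesgue. indicator ?R x *\<^sub>R g x = 0"
        using that(1) n unfolding set_integrable_def by (subst integral_nonneg_eq_0_iff_AE[symmetric]) auto
      then show ?thesis by eventually_elim (auto simp: indicator_def split: if_splits)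
    qed
    have "AE x in lebesgue. x \<in> ?R \<longrightarrow> w x = c"
    proof (cases "q = 1")
      case True
      have "AE x in lebesgue. x \<in> ?R \<longrightarrow> w x - c = 0"
      proof (rule zeroI)
        show "set_integrable lebesgue ?R (\<lambda>x. w x - c)" by (rule set_integral_diff(1)[OF w_int set_integrable_const_box])
        show "AE x in lebesgue. x \<in> ?R \<longrightarrow> 0 \<le> w x - c"
          using avg_le_A[OF ab True]
        proof (eventually_elim, intro impI)
          fix x assume "x \<in> ?R \<longrightarrow> avg ?R w \<le> A * w x" "x \<in> ?R"
          then have "c \<le> A * w x" by (simp add: c_def)
          also have "\<dots> \<le> 1 * w x" by (rule mult_right_mono[OF A1 w0])
          finally show "0 \<le> w x - c" by simp
        qed
        show "avg ?R (\<lambda>x. w x - c) \<le> 0"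
          using avg_diff[OF w_int set_integrable_const_box, of a b c] avg_const_box[OF ab, of c] by (simp add: c_def)
      qed
      then show ?thesis by eventually_elim simp
    next
      case False
      then have q: "q > 1" using q1 by simp
      \<comment> \<open>Normalises the first Young term to average \<open>1 / q\<close>; the
        assumption \<open>A \<le> 1\<close> bounds the average of the second by
        \<open>1 - 1 / q\<close>. So \<open>?g - 1\<close> is nonnegative with nonpositive
        average.\<close>
      define l where "l = c powr (1 / (q - 1))"
      have l: "l > 0" using c by (simp add: l_def)
      have lc: "l powr (1 - q) = 1 / c"
      proof -
        have "1 / (q - 1) * (1 - q) = -1" using q by (simp add: field_simps)
        then have "l powr (1 - q) = c powr (-1)" unfolding l_def powr_powr by simp
        then show ?thesis using c by (simp add: powr_minus_divide)
      qed
      let ?g = "\<lambda>x. 1 / q * (l powr (1 - q) * w x) + (1 - 1 / q) * (l * \<sigma> x)"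
      have iw: "set_integrable lebesgue ?R (\<lambda>x. 1 / q * (l powr (1 - q) * w x))"
        by (intro set_integrable_mult_right w_int)
      have is': "set_integrable lebesgue ?R (\<lambda>x. (1 - 1 / q) * (l * \<sigma> x))"
        by (intro set_integrable_mult_right \<sigma>_int(1)[OF ab q])
      have ig: "set_integrable lebesgue ?R ?g" by (rule set_integral_add(1)[OF iw is'])
      have "AE x in lebesgue. x \<in> ?R \<longrightarrow> ?g x - 1 = 0"
      proof (rule zeroI)
        show "set_integrable lebesgue ?R (\<lambda>x. ?g x - 1)" by (rule set_integral_diff(1)[OF ig set_integrable_const_box])
        show "AE x in lebesgue. x \<in> ?R \<longrightarrow> 0 \<le> ?g x - 1"
          using w_pos[OF ab]
        proof eventually_elim
          case (elim x) then show ?case using young_pointwise(1)[OF q l, of x] by simp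
        qed
        have "l * avg ?R \<sigma> \<le> 1"
        proof -
          have "(l * avg ?R \<sigma>) powr (q - 1) = c * avg ?R \<sigma> powr (q - 1)"
            using l c q avg_nonneg[of \<sigma> ?R, OF \<sigma>0] by (simp add: powr_mult l_def powr_powr)
          also have "\<dots> \<le> 1" using \<sigma>_int(2)[OF ab q] A1 by (simp add: c_def)
          finally have "(l * avg ?R \<sigma>) powr (q - 1) \<le> 1 powr (q - 1)" by simp
          then show ?thesis using q l avg_nonneg[of \<sigma> ?R, OF \<sigma>0] by (smt (verit) powr_less_mono2)
        qed
        then have "(1 - 1 / q) * (l * avg ?R \<sigma>) \<le> (1 - 1 / q) * 1" using q by (intro mult_left_mono) auto
        moreover have "avg ?R ?g = 1 / q * (l powr (1 - q) * c) + (1 - 1 / q) * (l * avg ?R \<sigma>)"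
          unfolding avg_add[OF iw is'] avg_cmult c_def ..
        moreover have "l powr (1 - q) * c = 1" unfolding lc using c by simp
        ultimately show "avg ?R (\<lambda>x. ?g x - 1) \<le> 0"
          using avg_diff[OF ig set_integrable_const_box, of 1] avg_const_box[OF ab, of 1] by simp
      qed
      then show ?thesis
        using w_pos[OF ab]
      proof (eventually_elim, intro impI)
        fix x assume x: "x \<in> ?R \<longrightarrow> ?g x - 1 = 0" "x \<in> ?R \<longrightarrow> 0 < w x" "x \<in> ?R"
        then have "l powr (1 - q) * w x = 1" by (intro young_pointwise(2)[OF q l]) auto
        then show "w x = c" unfolding lc using c by (simp add: field_simps)
      qed
    qed
    then show "\<exists>c\<ge>0. AE x in lebesgue. x \<in> ?R \<longrightarrow> w x = c" using c by (intro exI[of _ c]) auto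
  qed
  then show False using Ainf by simp
qed

end

section \<open>The dyadic grid\<close>

definition grid_idx :: "nat \<Rightarrow> ('n::finite \<Rightarrow> nat) set" where
  "grid_idx k = {j. \<forall>i. j i < 2 ^ k}"

definition grid_pt :: "real ^ 'n \<Rightarrow> real ^ 'n \<Rightarrow> nat \<Rightarrow> ('n \<Rightarrow> nat) \<Rightarrow> real ^ 'n" where
  "grid_pt a b k j = (\<chi> i. a $ i + real (j i) * ((b $ i - a $ i) / 2 ^ k))"

text \<open>Open cells keep a generation pairwise disjoint and keep every cell a box. The price is
  that the grid hyperplanes are lost; they are Lebesgue null, so \<open>dyadic_cover\<close> holds
  only almost everywhere.\<close>

definition dyadic :: "real ^ 'n \<Rightarrow> real ^ 'n \<Rightarrow> nat \<Rightarrow> ('n \<Rightarrow> nat) \<Rightarrow> (real ^ 'n) set" where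
  "dyadic a b k j = box (grid_pt a b k j) (grid_pt a b k (\<lambda>i. Suc (j i)))"

lemma finite_grid_idx: "finite (grid_idx k :: ('n::finite \<Rightarrow> nat) set)"
proof (rule finite_subset)
  show "(grid_idx k :: ('n \<Rightarrow> nat) set) \<subseteq> (UNIV \<rightarrow>\<^sub>E {..<2 ^ k})"
    by (auto simp: grid_idx_def)
qed (auto intro: finite_PiE)

lemma grid_pt_less:
  assumes "\<And>i. a $ i < b $ i"
  shows "grid_pt a b k j $ i < grid_pt a b k (\<lambda>i. Suc (j i)) $ i"
  using assms[of i] by (simp add: grid_pt_def field_simps)

lemma grid_pt_diff: "grid_pt a b k (\<lambda>i. Suc (j i)) - grid_pt a b k j = (1 / 2 ^ k) *\<^sub>R (b - a)"
  by (simp add: vec_eq_iff grid_pt_def algebra_simps diff_divide_distrib add_divide_distrib)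

lemma mem_dyadic:
  assumes ab: "\<And>i. a $ i < b $ i"
  shows "x \<in> dyadic a b k j \<longleftrightarrow> (\<forall>i. real (j i) < (x $ i - a $ i) / (b $ i - a $ i) * 2 ^ k
      \<and> (x $ i - a $ i) / (b $ i - a $ i) * 2 ^ k < real (j i) + 1)"
proof -
  have "(grid_pt a b k j $ i < x $ i) = (real (j i) < (x $ i - a $ i) / (b $ i - a $ i) * 2 ^ k)"
    "(x $ i < grid_pt a b k (\<lambda>i. Suc (j i)) $ i) = ((x $ i - a $ i) / (b $ i - a $ i) * 2 ^ k < real (j i) + 1)" for i
  proof -
    have l: "0 < b $ i - a $ i" using ab[of i] by simp
    have "(r < (x $ i - a $ i) / (b $ i - a $ i) * 2 ^ k) = (a $ i + r * ((b $ i - a $ i) / 2 ^ k) < x $ i)" for r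
      using l by (simp add: field_simps)
    moreover have "((x $ i - a $ i) / (b $ i - a $ i) * 2 ^ k < r) = (x $ i < a $ i + r * ((b $ i - a $ i) / 2 ^ k))" for r
      using l by (simp add: field_simps)
    ultimately show "(grid_pt a b k j $ i < x $ i) = (real (j i) < (x $ i - a $ i) / (b $ i - a $ i) * 2 ^ k)"
    "(x $ i < grid_pt a b k (\<lambda>i. Suc (j i)) $ i) = ((x $ i - a $ i) / (b $ i - a $ i) * 2 ^ k < real (j i) + 1)"
      by (simp_all add: grid_pt_def add.commute)
  qed
  then show ?thesis unfolding dyadic_def mem_box_cart by simp
qed

lemma dyadic_disjoint:
  assumes ab: "\<And>i. a $ i < b $ i" and x: "x \<in> dyadic a b k j" "x \<in> dyadic a b k j'"
  shows "j = j'"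
proof
  fix i
  define t where "t = (x $ i - a $ i) / (b $ i - a $ i) * 2 ^ k"
  have "real (j i) < t" "t < real (j i) + 1" "real (j' i) < t" "t < real (j' i) + 1"
    using x unfolding mem_dyadic[OF ab] t_def by blast+
  then have "real (j i) < real (j' i) + 1" "real (j' i) < real (j i) + 1" by linarith+
  then show "j i = j' i" by linarith
qed

lemma dyadic_subset:
  fixes a b :: "real ^ 'n"
  assumes ab: "\<And>i. a $ i < b $ i" and j: "j \<in> grid_idx k"
  shows "dyadic a b k j \<subseteq> box a b"
proof
  fix x assume x: "x \<in> dyadic a b k j"
  show "x \<in> box a b"
    unfolding mem_box_cart
  proof
    fix i
    define s where "s = (x $ i - a $ i) / (b $ i - a $ i)"
    have l: "0 < b $ i - a $ i" using ab[of i] by simp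
    have 1: "real (j i) < s * 2 ^ k" "s * 2 ^ k < real (j i) + 1"
      using x unfolding mem_dyadic[OF ab] s_def by blast+
    have "j i + 1 \<le> 2 ^ k" using j by (simp add: grid_idx_def Suc_le_eq)
    then have "real (j i + 1) \<le> real (2 ^ k)" by (simp only: of_nat_le_iff)
    then have "real (j i) + 1 \<le> 2 ^ k" by simp
    then have "s * 2 ^ k < 1 * 2 ^ k" using 1 by linarith
    then have "s < 1" by (simp only: mult_less_cancel_right_pos zero_less_power zero_less_numeral)
    have "0 < s * 2 ^ k" using 1(1) by (meson le_less_trans of_nat_0_le_iff)
    then have "0 < s" by (simp add: zero_less_mult_iff)
    show "a $ i < x $ i \<and> x $ i < b $ i"
      using \<open>s < 1\<close> \<open>0 < s\<close> l by (simp add: s_def zero_less_divide_iff)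
  qed
qed

definition grid_parent :: "('n \<Rightarrow> nat) \<Rightarrow> 'n \<Rightarrow> nat" where
  "grid_parent j = (\<lambda>i. j i div 2)"

lemma grid_parent_idx: "j \<in> grid_idx (Suc k) \<Longrightarrow> grid_parent j \<in> grid_idx k"
  unfolding grid_idx_def grid_parent_def mem_Collect_eq power_Suc
  by (intro allI less_mult_imp_div_less) (simp only: mult.commute)

lemma dyadic_parent:
  assumes ab: "\<And>i. a $ i < b $ i"
  shows "dyadic a b (Suc k) j \<subseteq> dyadic a b k (grid_parent j)"
proof
  fix x assume x: "x \<in> dyadic a b (Suc k) j"
  show "x \<in> dyadic a b k (grid_parent j)"
    unfolding mem_dyadic[OF ab]
  proof
    fix i
    define t where "t = (x $ i - a $ i) / (b $ i - a $ i) * 2 ^ k"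
    have "(x $ i - a $ i) / (b $ i - a $ i) * 2 ^ Suc k = 2 * t" unfolding t_def power_Suc by (simp only: mult_ac)
    moreover have "real (j i) < (x $ i - a $ i) / (b $ i - a $ i) * 2 ^ Suc k"
      "(x $ i - a $ i) / (b $ i - a $ i) * 2 ^ Suc k < real (j i) + 1"
      using x unfolding mem_dyadic[OF ab] by blast+
    ultimately have "real (j i) < 2 * t" "2 * t < real (j i) + 1" by (simp_all only:)
    moreover obtain d where d: "grid_parent j i = d" "2 * d \<le> j i" "j i \<le> 2 * d + 1"
    proof -
      have "2 * (j i div 2) \<le> j i" "j i \<le> 2 * (j i div 2) + 1" by presburger+
      then show thesis using that unfolding grid_parent_def by blast
    qed
    then have "real (2 * d) \<le> real (j i)" "real (j i) \<le> real (2 * d + 1)" by (simp_all only: of_nat_le_iff)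
    then have "2 * real d \<le> real (j i)" "real (j i) \<le> 2 * real d + 1" by simp_all
    ultimately have "real d < t" "t < real d + 1" by linarith+
    then show "real (grid_parent j i) < (x $ i - a $ i) / (b $ i - a $ i) * 2 ^ k \<and>
      (x $ i - a $ i) / (b $ i - a $ i) * 2 ^ k < real (grid_parent j i) + 1"
      unfolding d(1) t_def by (rule conjI)
  qed
qed

lemma dyadic_cover:
  fixes a b :: "real ^ 'n"
  assumes ab: "\<And>i. a $ i < b $ i"
  shows "AE x in lebesgue. x \<in> box a b \<longrightarrow> (\<exists>j\<in>grid_idx k. x \<in> dyadic a b k j)"
proof -
  define c where "c i l = a $ i + real l * ((b $ i - a $ i) / 2 ^ k)" for i and l :: nat
  have null: "AE x in lebesgue. (x :: real ^ 'n) $ i \<noteq> c i l" for i l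
  proof -
    have "{x :: real ^ 'n. x $ i = c i l} \<in> null_sets lebesgue"
      using negligible_standard_hyperplane[of "axis i 1 :: real ^ 'n" "c i l"]
      by (simp add: negligible_iff_null_sets axis_in_Basis_iff cart_eq_inner_axis)
    from AE_not_in[OF this] show ?thesis by simp
  qed
  then have "AE x in lebesgue. \<forall>l. (x :: real ^ 'n) $ i \<noteq> c i l" for i by (simp add: AE_all_countable)
  then have "AE x in lebesgue. \<forall>i l. (x :: real ^ 'n) $ i \<noteq> c i l" by (simp add: AE_all_countable)
  then show ?thesis
  proof (eventually_elim, intro impI)
    fix x assume nc: "\<forall>i l. x $ i \<noteq> c i l" and x: "x \<in> box a b"
    define t where "t i = (x $ i - a $ i) / (b $ i - a $ i) * 2 ^ k" for i
    have t: "0 < t i" "t i < 2 ^ k" "t i \<noteq> real l" for i l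
    proof -
      have l: "0 < b $ i - a $ i" using ab[of i] by simp
      have xi: "a $ i < x $ i" "x $ i < b $ i" using x by (auto simp: mem_box_cart)
      show "0 < t i" using l xi by (simp add: t_def)
      show "t i < 2 ^ k" using l xi by (simp add: t_def field_simps)
      have "t i = real l \<Longrightarrow> x $ i = c i l" using l by (simp add: t_def c_def field_simps)
      then show "t i \<noteq> real l" using nc by blast
    qed
    define j where "j i = nat \<lfloor>t i\<rfloor>" for i
    have j: "real (j i) < t i" "t i < real (j i) + 1" for i
    proof -
      have r: "real (j i) = of_int \<lfloor>t i\<rfloor>" using t(1)[of i] by (simp add: j_def)
      show "t i < real (j i) + 1" unfolding r by linarith
      have "real (j i) \<le> t i" unfolding r by linarith
      then show "real (j i) < t i" using t(3)[of i "j i"] by linarith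
    qed
    have "j i < 2 ^ k" for i
    proof -
      have "real (j i) < 2 ^ k" using j(1)[of i] t(2)[of i] by (rule less_trans)
      then show ?thesis by simp
    qed
    then have "j \<in> grid_idx k" by (simp add: grid_idx_def)
    moreover have "x \<in> dyadic a b k j" unfolding mem_dyadic[OF ab] using j by (simp add: t_def)
    ultimately show "\<exists>j\<in>grid_idx k. x \<in> dyadic a b k j" by blast
  qed
qed

lemma dyadic_0:
  assumes "j \<in> grid_idx 0"
  shows "dyadic a b 0 j = box a b"
proof -
  have "j i = 0" for i using assms by (simp add: grid_idx_def)
  then show ?thesis by (simp add: dyadic_def grid_pt_def)
qed

lemma measure_dyadic:
  fixes a b :: "real ^ 'n"
  assumes ab: "\<And>i. a $ i < b $ i"
  shows "measure lebesgue (dyadic a b k j) = (1 / 2 ^ k) ^ CARD('n) * measure lebesgue (box a b)"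
  unfolding dyadic_def by (rule measure_box_scale[OF ab _ grid_pt_diff]) simp

section \<open>Sums over one generation\<close>

lemma sum_dyadic_indicator:
  assumes ab: "\<And>i. a $ i < b $ i" and j: "j \<in> grid_idx k" "x \<in> dyadic a b k j"
  shows "(\<Sum>j'\<in>grid_idx k. F j' * indicator (dyadic a b k j') x) = (F j :: real)"
proof -
  have "(\<Sum>j'\<in>grid_idx k. F j' * indicator (dyadic a b k j') x) = (\<Sum>j'\<in>grid_idx k. if j' = j then F j else 0)"
  proof (rule sum.cong[OF refl])
    fix j'
    show "F j' * indicator (dyadic a b k j') x = (if j' = j then F j else 0)"
    proof (cases "j' = j")
      case True then show ?thesis using j(2) by simp
    next
      case False
      then have "x \<notin> dyadic a b k j'" using dyadic_disjoint[OF ab j(2), of j'] by metis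
      then show ?thesis using False by simp
    qed
  qed
  also have "\<dots> = F j" using j(1) by (simp add: sum.delta[OF finite_grid_idx])
  finally show ?thesis .
qed

lemma sum_dyadic_le:
  fixes a b :: "real ^ 'n" and h :: "real ^ 'n \<Rightarrow> real"
  assumes ab: "\<And>i. a $ i < b $ i" and h: "set_integrable lebesgue (box a b) h" "\<And>x. 0 \<le> h x"
  shows "(\<Sum>j\<in>grid_idx k. LINT x:dyadic a b k j|lebesgue. h x) \<le> (LINT x:box a b|lebesgue. h x)"
proof -
  have i: "integrable lebesgue (\<lambda>x. indicator (dyadic a b k j) x *\<^sub>R h x)" if "j \<in> grid_idx k" for j
    using set_integrable_subset[OF h(1) _ dyadic_subset[OF ab that]]
    unfolding set_integrable_def dyadic_def by simp
  have "(\<Sum>j\<in>grid_idx k. LINT x:dyadic a b k j|lebesgue. h x)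
      = (LINT x|lebesgue. (\<Sum>j\<in>grid_idx k. indicator (dyadic a b k j) x *\<^sub>R h x))"
    unfolding set_lebesgue_integral_def by (rule Bochner_Integration.integral_sum[OF i, symmetric])
  also have "\<dots> \<le> (LINT x|lebesgue. indicator (box a b) x *\<^sub>R h x)"
  proof (rule integral_mono)
    show "integrable lebesgue (\<lambda>x. \<Sum>j\<in>grid_idx k. indicator (dyadic a b k j) x *\<^sub>R h x)"
      by (rule Bochner_Integration.integrable_sum[OF i])
    show "integrable lebesgue (\<lambda>x. indicator (box a b) x *\<^sub>R h x)" using h(1) by (simp add: set_integrable_def)
    fix x
    show "(\<Sum>j\<in>grid_idx k. indicator (dyadic a b k j) x *\<^sub>R h x) \<le> indicator (box a b) x *\<^sub>R h x"
    proof (cases "\<exists>j\<in>grid_idx k. x \<in> dyadic a b k j")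
      case True
      then obtain j where j: "j \<in> grid_idx k" "x \<in> dyadic a b k j" by blast
      have "(\<Sum>j'\<in>grid_idx k. indicator (dyadic a b k j') x *\<^sub>R h x) = h x"
        using sum_dyadic_indicator[OF ab j, of "\<lambda>_. h x"] by (simp add: mult.commute)
      then show ?thesis using dyadic_subset[OF ab j(1)] j(2) by auto
    next
      case False
      then have "(\<Sum>j\<in>grid_idx k. indicator (dyadic a b k j) x *\<^sub>R h x) = 0"
        by (intro sum.neutral) auto
      then show ?thesis using h(2)[of x] by simp
    qed
  qed
  finally show ?thesis by (simp only: set_lebesgue_integral_def)
qed

lemma radon_fmeasurable:
  assumes "radon_measure \<mu>" and S: "S \<in> sets borel" "S \<subseteq> cbox a b"
  shows "S \<in> fmeasurable \<mu>"
proof -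
  have sets: "sets \<mu> = sets borel" and "\<forall>K. compact K \<longrightarrow> emeasure \<mu> K < \<infinity>"
    using assms(1) unfolding radon_measure_def by blast+
  then have "emeasure \<mu> (cbox a b) < \<infinity>" using compact_cbox by blast
  moreover have "emeasure \<mu> S \<le> emeasure \<mu> (cbox a b)" by (rule emeasure_mono[OF S(2)]) (simp add: sets)
  ultimately show ?thesis using S(1) sets by (intro fmeasurableI) (auto intro: order_le_less_trans)
qed

text \<open>Only an inequality, since \<mu> may charge the grid hyperplanes that the open cells
  omit; superadditivity is the direction needed for upper bounds.\<close>

lemma sum_measure_dyadic_le:
  fixes a b :: "real ^ 'n"
  assumes ab: "\<And>i. a $ i < b $ i" and \<mu>: "radon_measure \<mu>"
  shows "(\<Sum>j\<in>grid_idx k. measure \<mu> (dyadic a b k j)) \<le> measure \<mu> (box a b)"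
proof -
  have R: "box a b \<in> fmeasurable \<mu>" by (rule radon_fmeasurable[OF \<mu> _ box_subset_cbox]) simp
  have d: "dyadic a b k j \<in> fmeasurable \<mu>" if "j \<in> grid_idx k" for j
    using order_trans[OF dyadic_subset[OF ab that] box_subset_cbox]
    by (rule radon_fmeasurable[OF \<mu>, rotated]) (simp add: dyadic_def)
  have "(\<Sum>j\<in>grid_idx k. measure \<mu> (dyadic a b k j)) = measure \<mu> (\<Union>j\<in>grid_idx k. dyadic a b k j)"
  proof (rule measure_UNION'[symmetric])
    show "pairwise (\<lambda>x y. disjnt (dyadic a b k x) (dyadic a b k y)) (grid_idx k)"
      unfolding pairwise_def disjnt_def using dyadic_disjoint[OF ab] by blast
  qed (use finite_grid_idx d in auto)
  also have "\<dots> \<le> measure \<mu> (box a b)"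
  proof (rule measure_mono_fmeasurable)
    show "(\<Union>j\<in>grid_idx k. dyadic a b k j) \<subseteq> box a b" using dyadic_subset[OF ab] by blast
    show "(\<Union>j\<in>grid_idx k. dyadic a b k j) \<in> sets \<mu>"
      using finite_grid_idx d by (intro sets.finite_UN) auto
    show "box a b \<in> fmeasurable \<mu>" by (rule R)
  qed
  finally show ?thesis .
qed

section \<open>Self-improvement\<close>

lemma diameter_box_scale_le:
  fixes a b u v :: "real ^ 'n"
  assumes ab: "\<And>i. a $ i < b $ i" and t: "t > 0" and uv: "v - u = t *\<^sub>R (b - a)"
  shows "diameter (box u v) \<le> t * diameter (box a b)"
proof (rule diameter_le)
  have "box a b \<noteq> {}" using ab by (simp add: interval_ne_empty_cart)
  then show "box u v \<noteq> {} \<or> 0 \<le> t * diameter (box a b)"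
    using t by (simp add: diameter_ge_0)
  fix x y assume xy: "x \<in> box u v" "y \<in> box u v"
  define s where "s z = a + (1 / t) *\<^sub>R (z - u)" for z
  have s: "s z \<in> box a b" if "z \<in> box u v" for z
    unfolding mem_box_cart
  proof
    fix i
    have d: "v $ i - u $ i = t * (b $ i - a $ i)" using arg_cong[OF uv, of "\<lambda>z. z $ i"] by simp
    have z: "u $ i < z $ i" "z $ i < v $ i" using that by (auto simp: mem_box_cart)
    have "(z $ i - u $ i) / t < b $ i - a $ i" using z(2) d t by (simp add: pos_divide_less_eq mult.commute)
    moreover have "0 < (z $ i - u $ i) / t" using z(1) t by simp
    ultimately show "a $ i < s z $ i \<and> s z $ i < b $ i" by (simp add: s_def)
  qed
  have "x - y = t *\<^sub>R (s x - s y)" using t by (simp add: s_def algebra_simps)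
  then have "norm (x - y) = t * dist (s x) (s y)" using t by (simp add: dist_norm)
  also have "\<dots> \<le> t * diameter (box a b)"
    using t by (intro mult_left_mono diameter_bounded_bound s xy bounded_box) auto
  finally show "norm (x - y) \<le> t * diameter (box a b)" .
qed

locale poincare_setting = nontrivial_Aq_weight w q for w :: "real ^ 'n \<Rightarrow> real" and q :: real +
  fixes p \<delta> r :: real and m :: nat and \<mu> :: "(real ^ 'n) measure" and f :: "real ^ 'n \<Rightarrow> real"
  assumes p1: "1 \<le> p" and pn: "p < real CARD('n)" and qp: "q \<le> p" and \<delta>0: "0 < \<delta>" and r0: "0 < r"
    and exponent: "1 / p - 1 / r = \<delta> / real CARD('n) * (1 / (q + ln A))"
    and \<mu>: "radon_measure \<mu>" and f_loc: "locally_integrable f"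
    and osc_le_functional: "\<And>R. R \<in> rectangles \<Longrightarrow> osc m f R \<le> rect_functional \<delta> p w \<mu> R"
begin

definition \<tau> :: real where "\<tau> = 1 / p - 1 / r"

text \<open>This is \<delta> divided by \<open>B_const q w\<close>, see \<open>B_const_eq\<close>;
  by \<open>sum_fn_powr_r\<close> it is the decay exponent of the generations to base 2.\<close>

definition \<kappa> :: real where "\<kappa> = \<delta> * ln A / (q + ln A)"

abbreviation "fn \<equiv> rect_functional \<delta> p w \<mu>"

lemma lnA: "0 < ln A" using A_gt_1 by simp

lemma N1: "1 < real CARD('n)" using p1 pn by simp

lemma \<tau>_eq: "\<tau> = \<delta> / real CARD('n) * (1 / (q + ln A))" unfolding \<tau>_def by (rule exponent)

lemma \<tau>_pos: "0 < \<tau>"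
  unfolding \<tau>_eq using \<delta>0 N1 q1 lnA by (intro mult_pos_pos divide_pos_pos) auto

lemma \<kappa>_pos: "0 < \<kappa>"
  unfolding \<kappa>_def using \<delta>0 q1 lnA by (intro divide_pos_pos mult_pos_pos) auto

lemma \<kappa>_le: "\<kappa> \<le> \<delta>"
proof -
  have "\<delta> * ln A \<le> \<delta> * (q + ln A)" using \<delta>0 q1 by (intro mult_left_mono) auto
  then show ?thesis unfolding \<kappa>_def using q1 lnA by (simp add: pos_divide_le_eq)
qed

lemma \<kappa>_eq: "\<kappa> = \<delta> - real CARD('n) * q * \<tau>"
proof -
  have s: "q + ln A \<noteq> 0" using q1 lnA by simp
  have "\<delta> - real CARD('n) * q * \<tau> = \<delta> - q * \<delta> / (q + ln A)" unfolding \<tau>_eq using N1 by simp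
  also have "\<dots> = (\<delta> * (q + ln A) - q * \<delta>) / (q + ln A)" using s by (simp add: diff_divide_distrib)
  also have "\<delta> * (q + ln A) - q * \<delta> = \<delta> * ln A" by (simp add: algebra_simps)
  finally show ?thesis unfolding \<kappa>_def by simp
qed

text \<open>The doubling constant enters only through this power, and
  \<open>\<tau> * ln A = \<kappa> / n\<close>: however large \<open>A\<close> is, the loss is
  bounded in terms of \<delta> alone.\<close>

lemma A_powr_\<tau>: "A powr \<tau> \<le> exp \<kappa>"
proof -
  have "\<tau> * ln A = \<kappa> / real CARD('n)" unfolding \<tau>_eq \<kappa>_def by simp
  also have "\<dots> \<le> \<kappa>" using \<kappa>_pos N1 by (simp add: pos_divide_le_eq)
  finally show ?thesis using A_gt_1 by (simp add: powr_def)
qed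

lemma p_less_r: "p < r"
proof -
  have "1 / r < 1 / p" using \<tau>_pos unfolding \<tau>_def by simp
  then show ?thesis using p1 r0 by (simp add: field_simps)
qed

lemma r_over_p: "r / p = 1 + r * \<tau>"
  unfolding \<tau>_def using r0 by (simp add: algebra_simps)

lemma r_ge_1: "1 \<le> r" using p1 p_less_r by simp

lemma f_int: "set_integrable lebesgue (box a b) f"
  by (rule locally_integrable_box[OF f_loc])

lemma fn_nonneg: "0 \<le> fn R" unfolding rect_functional_def by simp

lemma diameter_nonneg: "0 \<le> diameter (box a (b :: real ^ 'n))"
  by (rule diameter_ge_0[OF bounded_box])

lemma osc_le_box: "osc m f (box a b) \<le> fn (box a b)" if "\<And>i. a $ i < b $ i" for a b
  by (rule osc_le_functional[OF box_in_rectangles[OF that]])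

lemma fn_scale_le:
  fixes a b u v :: "real ^ 'n"
  assumes ab: "\<And>i. a $ i < b $ i" and t: "t > 0" and uv: "v - u = t *\<^sub>R (b - a)"
  shows "fn (box u v) \<le> (t * diameter (box a b)) powr \<delta> * (measure \<mu> (box u v) / wmeas w (box u v)) powr (1 / p)"
  unfolding rect_functional_def
  using diameter_box_scale_le[OF ab t uv] \<delta>0 diameter_nonneg by (intro mult_right_mono powr_mono2) auto

lemma dyadic_sub_box:
  fixes a b :: "real ^ 'n"
  assumes ab: "\<And>i. a $ i < b $ i" and j: "j \<in> grid_idx k"
  shows "measure \<mu> (dyadic a b k j) \<le> measure \<mu> (box a b)"
proof -
  have "measure \<mu> (dyadic a b k j) \<le> (\<Sum>j\<in>grid_idx k. measure \<mu> (dyadic a b k j))"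
    using j finite_grid_idx by (intro member_le_sum) auto
  then show ?thesis using sum_measure_dyadic_le[OF ab \<mu>, of k] by linarith
qed

lemma W_dyadic_pos: "0 < wmeas w (dyadic a b k j)" if "\<And>i. a $ i < b $ i" for a b
  unfolding dyadic_def by (rule W_pos[OF grid_pt_less[OF that]])

lemma fn_dyadic_le:
  fixes a b :: "real ^ 'n"
  assumes ab: "\<And>i. a $ i < b $ i"
  shows "fn (dyadic a b k j) \<le> (1 / 2 ^ k * diameter (box a b)) powr \<delta> *
    (measure \<mu> (dyadic a b k j) / wmeas w (dyadic a b k j)) powr (1 / p)"
  unfolding dyadic_def by (rule fn_scale_le[OF ab _ grid_pt_diff]) simp

lemma W_dyadic_ge:
  fixes a b :: "real ^ 'n"
  assumes ab: "\<And>i. a $ i < b $ i" and j: "j \<in> grid_idx k"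
  shows "(1 / 2 ^ k) powr (real CARD('n) * q) * wmeas w (box a b) / A \<le> wmeas w (dyadic a b k j)"
proof -
  have "(measure lebesgue (dyadic a b k j) / measure lebesgue (box a b)) powr q * wmeas w (box a b)
      \<le> A * wmeas w (dyadic a b k j)"
    using doubling[OF ab grid_pt_less[OF ab], of k j] dyadic_subset[OF ab j] unfolding dyadic_def by blast
  also have "measure lebesgue (dyadic a b k j) / measure lebesgue (box a b) = (1 / 2 ^ k) ^ CARD('n)"
    unfolding measure_dyadic[OF ab] using measure_box_pos[OF ab] by simp
  also have "((1 / 2 ^ k) ^ CARD('n)) powr q = (1 / 2 ^ k :: real) powr (real CARD('n) * q)"
    by (simp add: powr_realpow[symmetric] powr_powr del: power_divide power_one_over)
  finally show ?thesis using A_gt_1 by (simp add: pos_divide_le_eq mult.commute)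
qed

text \<open>At exponent \<open>p\<close> the weight cancels against the denominator of the
  functional, so no property of \<open>w\<close> beyond positivity enters, and \<mu> is summed
  directly.\<close>

lemma sum_fn_powr_p:
  fixes a b :: "real ^ 'n"
  assumes ab: "\<And>i. a $ i < b $ i"
  shows "(\<Sum>j\<in>grid_idx k. fn (dyadic a b k j) powr p * wmeas w (dyadic a b k j))
    \<le> (1 / 2 ^ k * diameter (box a b)) powr (\<delta> * p) * measure \<mu> (box a b)"
proof -
  let ?D = "1 / 2 ^ k * diameter (box a b)"
  have "fn (dyadic a b k j) powr p * wmeas w (dyadic a b k j) \<le> ?D powr (\<delta> * p) * measure \<mu> (dyadic a b k j)" for j
  proof -
    let ?Q = "dyadic a b k j"
    have W: "0 < wmeas w ?Q" by (rule W_dyadic_pos[OF ab])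
    have "fn ?Q powr p \<le> (?D powr \<delta> * (measure \<mu> ?Q / wmeas w ?Q) powr (1 / p)) powr p"
      using p1 fn_nonneg by (intro powr_mono2 fn_dyadic_le[OF ab]) auto
    also have "\<dots> = ?D powr (\<delta> * p) * (measure \<mu> ?Q / wmeas w ?Q)"
      using p1 W by (simp add: powr_mult powr_powr)
    finally have "fn ?Q powr p * wmeas w ?Q \<le> ?D powr (\<delta> * p) * (measure \<mu> ?Q / wmeas w ?Q) * wmeas w ?Q"
      using W by (intro mult_right_mono) auto
    then show ?thesis using W by simp
  qed
  then have "(\<Sum>j\<in>grid_idx k. fn (dyadic a b k j) powr p * wmeas w (dyadic a b k j))
     \<le> (\<Sum>j\<in>grid_idx k. ?D powr (\<delta> * p) * measure \<mu> (dyadic a b k j))" by (rule sum_mono)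
  also have "\<dots> = ?D powr (\<delta> * p) * (\<Sum>j\<in>grid_idx k. measure \<mu> (dyadic a b k j))"
    by (simp only: sum_distrib_left)
  also have "\<dots> \<le> ?D powr (\<delta> * p) * measure \<mu> (box a b)"
    by (intro mult_left_mono sum_measure_dyadic_le[OF ab \<mu>]) simp
  finally show ?thesis .
qed

text \<open>By \<open>r / p = 1 + r * \<tau>\<close> each summand contains one power of \<mu>(Q),
  which is summed, while the remaining \<open>r * \<tau>\<close> powers of \<mu>(Q)/w(Q) are bounded
  uniformly in Q. The lower bound for w(Q) turns the power of the side ratio from \<delta> into
  \<kappa> and produces \<open>A powr \<tau>\<close>.\<close>

lemma sum_fn_powr_r:
  fixes a b :: "real ^ 'n"
  assumes ab: "\<And>i. a $ i < b $ i"
  shows "(\<Sum>j\<in>grid_idx k. fn (dyadic a b k j) powr r * wmeas w (dyadic a b k j))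
    \<le> (A powr \<tau> * (1 / 2 ^ k) powr \<kappa> * fn (box a b)) powr r * wmeas w (box a b)"
proof -
  define T :: real where "T = 1 / 2 ^ k"
  define D where "D = diameter (box a b)"
  define W where "W = wmeas w (box a b)"
  define M where "M = measure \<mu> (box a b)"
  \<comment> \<open>Everything that is independent of the cell, except the power of the total mass
    \<open>M\<close>.\<close>
  define E where "E = (T * D) powr (\<delta> * r) * (T powr (real CARD('n) * q) * W / A) powr (- (r * \<tau>))"
  have T: "T > 0" by (simp add: T_def)
  have D: "D \<ge> 0" unfolding D_def by (rule diameter_nonneg)
  have W: "W > 0" unfolding W_def by (rule W_pos[OF ab])
  have M: "M \<ge> 0" by (simp add: M_def)
  have A: "A > 0" using A_gt_1 by simp
  have rt: "r * \<tau> > 0" using r0 \<tau>_pos by simp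
  have one: "fn (dyadic a b k j) powr r * wmeas w (dyadic a b k j) \<le> E * (M powr (r * \<tau>) * measure \<mu> (dyadic a b k j))"
    if j: "j \<in> grid_idx k" for j
  proof -
    let ?Q = "dyadic a b k j"
    define v where "v = wmeas w ?Q"
    define c where "c = measure \<mu> ?Q"
    have v: "v > 0" unfolding v_def by (rule W_dyadic_pos[OF ab])
    have c: "0 \<le> c" "c \<le> M" unfolding c_def M_def using dyadic_sub_box[OF ab j] by auto
    have "fn ?Q powr r \<le> ((T * D) powr \<delta> * (c / v) powr (1 / p)) powr r"
      unfolding T_def D_def c_def v_def using r0 fn_nonneg by (intro powr_mono2 fn_dyadic_le[OF ab]) auto
    also have "\<dots> = (T * D) powr (\<delta> * r) * (c powr (r / p) / v powr (r / p))"
      using c v by (simp add: powr_mult powr_powr powr_divide)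
    finally have "fn ?Q powr r * v \<le> (T * D) powr (\<delta> * r) * (c powr (r / p) / v powr (r / p)) * v"
      using v by (intro mult_right_mono) auto
    also have "\<dots> = (T * D) powr (\<delta> * r) * (c powr (r * \<tau>) * c) * v powr (- (r * \<tau>))"
    proof -
      have "c powr (r / p) = c powr (r * \<tau>) * c"
        unfolding r_over_p using c by (cases "c = 0") (simp_all add: powr_add)
      moreover have "v / v powr (r / p) = v powr (- (r * \<tau>))"
        unfolding r_over_p using v by (simp add: powr_add powr_minus_divide)
      moreover have "(T * D) powr (\<delta> * r) * (c powr (r / p) / v powr (r / p)) * v
          = (T * D) powr (\<delta> * r) * c powr (r / p) * (v / v powr (r / p))" by simp
      ultimately show ?thesis by (simp only:)
    qed
    also have "\<dots> \<le> (T * D) powr (\<delta> * r) * (M powr (r * \<tau>) * c) * (T powr (real CARD('n) * q) * W / A) powr (- (r * \<tau>))"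
    proof (intro mult_mono)
      show "c powr (r * \<tau>) \<le> M powr (r * \<tau>)" using rt c by (intro powr_mono2) auto
      have "T powr (real CARD('n) * q) * W / A \<le> v" unfolding T_def W_def v_def by (rule W_dyadic_ge[OF ab j])
      moreover have "T powr (real CARD('n) * q) * W / A > 0" using T W A by simp
      ultimately show "v powr (- (r * \<tau>)) \<le> (T powr (real CARD('n) * q) * W / A) powr (- (r * \<tau>))"
        using rt by (intro powr_mono2') auto
    qed (use c in auto)
    finally show ?thesis unfolding v_def c_def E_def by (simp only: mult_ac)
  qed
  have "(\<Sum>j\<in>grid_idx k. fn (dyadic a b k j) powr r * wmeas w (dyadic a b k j))
      \<le> (\<Sum>j\<in>grid_idx k. E * (M powr (r * \<tau>) * measure \<mu> (dyadic a b k j)))"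
    by (rule sum_mono[OF one])
  also have "\<dots> = E * (M powr (r * \<tau>) * (\<Sum>j\<in>grid_idx k. measure \<mu> (dyadic a b k j)))"
    by (simp only: sum_distrib_left)
  also have "\<dots> \<le> E * (M powr (r * \<tau>) * M)"
    unfolding M_def E_def by (intro mult_left_mono sum_measure_dyadic_le[OF ab \<mu>]) auto
  also have "\<dots> = (A powr \<tau> * T powr \<kappa> * (D powr \<delta> * (M / W) powr (1 / p))) powr r * W"
  proof -
    have "(A powr \<tau> * T powr \<kappa> * (D powr \<delta> * (M / W) powr (1 / p))) powr r * W
        = A powr (r * \<tau>) * T powr (\<kappa> * r) * D powr (\<delta> * r) * (M powr (r / p) / W powr (r / p)) * W"
      using M W by (simp add: powr_mult powr_powr powr_divide mult.commute)
    also have "M powr (r / p) = M powr (r * \<tau>) * M"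
      unfolding r_over_p using M by (cases "M = 0") (simp_all add: powr_add)
    also have "T powr (\<kappa> * r) = T powr (\<delta> * r) * T powr (- (real CARD('n) * q * (r * \<tau>)))"
      unfolding \<kappa>_eq powr_add[symmetric] by (simp add: algebra_simps)
    also have "M powr (r * \<tau>) * M / W powr (r / p) = M powr (r * \<tau>) * M * W powr (- (r * \<tau>)) / W"
      unfolding r_over_p using W by (simp add: powr_add powr_minus_divide)
    finally have *: "(A powr \<tau> * T powr \<kappa> * (D powr \<delta> * (M / W) powr (1 / p))) powr r * W
       = A powr (r * \<tau>) * (T powr (\<delta> * r) * T powr (- (real CARD('n) * q * (r * \<tau>)))) * D powr (\<delta> * r)
         * (M powr (r * \<tau>) * M * W powr (- (r * \<tau>)) / W) * W" .
    have "(T powr (real CARD('n) * q) * W / A) powr (- (r * \<tau>)) = T powr (- (real CARD('n) * q * (r * \<tau>))) * W powr (- (r * \<tau>)) * A powr (r * \<tau>)"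
      using T W A by (simp add: powr_mult powr_divide powr_powr powr_minus field_simps)
    then have "E = T powr (\<delta> * r) * D powr (\<delta> * r) * (T powr (- (real CARD('n) * q * (r * \<tau>))) * W powr (- (r * \<tau>)) * A powr (r * \<tau>))"
      unfolding E_def using T D by (simp add: powr_mult)
    then show ?thesis unfolding * using W by simp
  qed
  finally show ?thesis
    by (simp only: T_def D_def M_def W_def rect_functional_def)
qed

end

section \<open>Convexity and powers of series\<close>

lemma bernoulli_powr:
  fixes t r :: real
  assumes "0 \<le> t" "1 \<le> r"
  shows "r * t - (r - 1) \<le> t powr r"
proof (cases "t = 0")
  case False
  then have t: "t > 0" using assms by simp
  have "ln (1 / t) \<le> 1 / t - 1" using t by (intro ln_le_minus_one) simp
  then have "1 - ln t \<le> 1 / t" using t by (simp add: ln_div)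
  then have "t * (1 - ln t) \<le> t * (1 / t)" using t by (intro mult_left_mono) auto
  then have a: "t - 1 \<le> t * ln t" using t by (simp add: algebra_simps)
  have "1 + (r - 1) * ln t \<le> exp ((r - 1) * ln t)" by (rule exp_ge_add_one_self)
  then have "1 + (r - 1) * ln t \<le> t powr (r - 1)" using t by (simp add: powr_def)
  then have "t * (1 + (r - 1) * ln t) \<le> t * t powr (r - 1)" using t by (intro mult_left_mono) auto
  also have "t * t powr (r - 1) = t powr r" using t by (simp add: powr_diff)
  finally have b: "t + (r - 1) * (t * ln t) \<le> t powr r" by (simp add: algebra_simps)
  have "(r - 1) * (t - 1) \<le> (r - 1) * (t * ln t)" using a assms by (intro mult_left_mono) auto
  then show ?thesis using b by (simp add: algebra_simps)
qed (use assms in simp)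

text \<open>A convexity argument with the weights \<open>(1 - \<theta>) \<theta>\<^sup>k\<close> that replaces Minkowski's inequality for series.\<close>
lemma powr_suminf_le:
  fixes u :: "nat \<Rightarrow> real"
  assumes y: "0 \<le> y" and u: "\<And>k. 0 \<le> u k" and r: "1 \<le> r" and \<theta>: "0 < \<theta>" "\<theta> < 1"
    and le: "ennreal y \<le> (\<Sum>k. ennreal (u k))"
  shows "ennreal (y powr r) \<le> (\<Sum>k. ennreal ((1 - \<theta>) * \<theta> ^ k * (u k / ((1 - \<theta>) * \<theta> ^ k)) powr r))"
proof (cases "y = 0")
  case False
  then have y0: "y > 0" using y by simp
  define b where "b k = (1 - \<theta>) * \<theta> ^ k" for k
  have b: "b k > 0" for k using \<theta> by (simp add: b_def)
  have "b sums ((1 - \<theta>) * (1 / (1 - \<theta>)))"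
    unfolding b_def using \<theta> by (intro sums_mult geometric_sums) simp
  then have b1: "b sums 1" using \<theta> by simp
  \<comment> \<open>The tangent to the \<open>r\<close>-th power at \<open>y\<close>, evaluated at
    \<open>u k / b k\<close> and weighted by \<open>b k\<close>. Summed over \<open>k\<close>, with
    the weights adding up to 1, the left side is at least \<open>r * y powr r\<close>.\<close>
  have pt: "r * y powr (r - 1) * u k \<le> b k * (u k / b k) powr r + (r - 1) * y powr r * b k" for k
  proof -
    define s where "s = u k / b k"
    have s: "0 \<le> s" "u k = b k * s" using u[of k] b[of k] by (simp_all add: s_def)
    have "r * (s / y) - (r - 1) \<le> (s / y) powr r" using s y0 r by (intro bernoulli_powr) auto
    then have "y powr r * (r * (s / y) - (r - 1)) \<le> y powr r * (s / y) powr r" by (intro mult_left_mono) auto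
    also have "y powr r * (s / y) powr r = s powr r" using y0 s by (simp add: powr_divide)
    also have "y powr r * (r * (s / y) - (r - 1)) = r * y powr (r - 1) * s - (r - 1) * y powr r"
      using y0 by (simp add: powr_diff algebra_simps)
    finally have "r * y powr (r - 1) * s \<le> s powr r + (r - 1) * y powr r" by simp
    then have "b k * (r * y powr (r - 1) * s) \<le> b k * (s powr r + (r - 1) * y powr r)"
      using b[of k] by (intro mult_left_mono) auto
    then show ?thesis using b[of k] by (simp add: s_def algebra_simps)
  qed
  define S where "S = (\<Sum>k. ennreal (b k * (u k / b k) powr r))"
  have "ennreal (r * y powr r) = ennreal (r * y powr (r - 1)) * ennreal y"
    using y0 r by (simp add: ennreal_mult[symmetric] powr_diff)
  also have "\<dots> \<le> ennreal (r * y powr (r - 1)) * (\<Sum>k. ennreal (u k))" by (rule mult_left_mono[OF le]) simp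
  also have "\<dots> = (\<Sum>k. ennreal (r * y powr (r - 1) * u k))"
    using r u by (simp add: ennreal_mult)
  also have "\<dots> \<le> (\<Sum>k. ennreal (b k * (u k / b k) powr r) + ennreal ((r - 1) * y powr r * b k))"
  proof (intro suminf_le summableI)
    fix k
    show "ennreal (r * y powr (r - 1) * u k) \<le> ennreal (b k * (u k / b k) powr r) + ennreal ((r - 1) * y powr r * b k)"
    proof -
      have "0 \<le> b k * (u k / b k) powr r" "0 \<le> (r - 1) * y powr r * b k"
        using b[of k] r by (auto intro!: mult_nonneg_nonneg)
      then show ?thesis using ennreal_leI[OF pt[of k]] by (simp only: ennreal_plus)
    qed
  qed
  also have "\<dots> = S + (\<Sum>k. ennreal ((r - 1) * y powr r * b k))"
    unfolding S_def by (intro suminf_add[symmetric] summableI)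
  also have "(\<Sum>k. ennreal ((r - 1) * y powr r * b k)) = ennreal ((r - 1) * y powr r)"
  proof -
    have "(\<lambda>k. (r - 1) * y powr r * b k) sums ((r - 1) * y powr r * 1)" by (rule sums_mult[OF b1])
    then show ?thesis
      using r b by (subst suminf_ennreal_eq) (auto intro!: mult_nonneg_nonneg simp: less_imp_le)
  qed
  finally have *: "ennreal (r * y powr r) \<le> S + ennreal ((r - 1) * y powr r)" .
  \<comment> \<open>The term \<open>(r - 1) * y powr r\<close> can be cancelled as a real number
    when \<open>S\<close> is finite; an infinite \<open>S\<close> leaves nothing to prove.\<close>
  have "ennreal (y powr r) \<le> S"
  proof (cases S)
    case (real s)
    then have "ennreal (r * y powr r) \<le> ennreal (s + (r - 1) * y powr r)"
      using * r by (simp add: ennreal_plus)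
    then have "r * y powr r \<le> s + (r - 1) * y powr r" using real r by (subst (asm) ennreal_le_iff) auto
    then have "y powr r \<le> s" by (simp add: algebra_simps)
    then show ?thesis using real by simp
  qed simp
  then show ?thesis by (simp only: S_def b_def)
qed (use r in simp)

section \<open>Telescoping along dyadic ancestors\<close>

context poincare_setting
begin

definition level :: "real ^ 'n \<Rightarrow> real ^ 'n \<Rightarrow> nat \<Rightarrow> real ^ 'n \<Rightarrow> real" where
  "level a b k x = (\<Sum>j\<in>grid_idx k. fn (dyadic a b k j) * indicator (dyadic a b k j) x)"

text \<open>The square comes from \<open>poly_proj_near\<close> on a child; the power of 2 is the
  ratio of the measures of parent and child, paid when the mean over the child is enlarged to the
  parent.\<close>

definition C0 :: real where "C0 = (poly_const m TYPE('n))\<^sup>2 * 2 ^ CARD('n)"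

lemma C0_pos: "0 < C0"
  unfolding C0_def using poly_const_ge_1[of m, where 'n='n] by (intro mult_pos_pos zero_less_power) auto

lemma level_nonneg: "0 \<le> level a b k x"
  unfolding level_def by (intro sum_nonneg mult_nonneg_nonneg fn_nonneg) simp

lemma level_powr:
  assumes ab: "\<And>i. a $ i < b $ i"
  shows "level a b k x powr r = (\<Sum>j\<in>grid_idx k. fn (dyadic a b k j) powr r * indicator (dyadic a b k j) x)"
proof (cases "\<exists>j\<in>grid_idx k. x \<in> dyadic a b k j")
  case True
  then obtain j where j: "j \<in> grid_idx k" "x \<in> dyadic a b k j" by blast
  show ?thesis unfolding level_def sum_dyadic_indicator[OF ab j] ..
next
  case False
  then have "(\<Sum>j\<in>grid_idx k. F j * indicator (dyadic a b k j) x) = 0" for F :: "_ \<Rightarrow> real"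
    by (intro sum.neutral) auto
  then show ?thesis unfolding level_def by simp
qed

lemma proj_step:
  fixes a b :: "real ^ 'n"
  assumes ab: "\<And>i. a $ i < b $ i" and x: "x \<in> dyadic a b (Suc k) j"
  shows "\<bar>poly_proj m (dyadic a b (Suc k) j) f x - poly_proj m (dyadic a b k (grid_parent j)) f x\<bar>
    \<le> C0 * fn (dyadic a b k (grid_parent j))"
proof -
  let ?Q = "dyadic a b k (grid_parent j)" and ?Q' = "dyadic a b (Suc k) j"
  define P where "P = poly_proj m ?Q f"
  have P: "P \<in> poly_space m"
    unfolding P_def dyadic_def by (rule poly_proj_in_poly_space[OF grid_pt_less[OF ab]])
  have i: "set_integrable lebesgue ?Q (\<lambda>y. \<bar>f y - P y\<bar>)" "set_integrable lebesgue ?Q' (\<lambda>y. \<bar>f y - P y\<bar>)"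
    unfolding dyadic_def by (intro set_integrable_abs set_integral_diff(1) f_int poly_set_integrable[OF P])+
  have mQ': "0 < measure lebesgue ?Q'"
    unfolding dyadic_def by (rule measure_box_pos[OF grid_pt_less[OF ab]])
  have mQ: "measure lebesgue ?Q = 2 ^ CARD('n) * measure lebesgue ?Q'"
    unfolding measure_dyadic[OF ab] by (simp add: power_divide power_mult_distrib)
  have "\<bar>poly_proj m ?Q' f x - P x\<bar> \<le> (poly_const m TYPE('n))\<^sup>2 * avg ?Q' (\<lambda>y. \<bar>f y - P y\<bar>)"
    using poly_proj_near[OF grid_pt_less[OF ab] f_int P] x unfolding dyadic_def by blast
  also have "\<dots> \<le> (poly_const m TYPE('n))\<^sup>2 * (2 ^ CARD('n) * fn ?Q)"
  proof (rule mult_left_mono)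
    have "(LINT y:?Q'|lebesgue. \<bar>f y - P y\<bar>) \<le> (LINT y:?Q|lebesgue. \<bar>f y - P y\<bar>)"
      by (rule set_integral_subset_le[OF i(2,1) dyadic_parent[OF ab]]) simp
    then have "avg ?Q' (\<lambda>y. \<bar>f y - P y\<bar>) \<le> (LINT y:?Q|lebesgue. \<bar>f y - P y\<bar>) / measure lebesgue ?Q'"
      unfolding avg_def using mQ' by (intro divide_right_mono) auto
    also have "\<dots> = 2 ^ CARD('n) * avg ?Q (\<lambda>y. \<bar>f y - P y\<bar>)"
      unfolding avg_def mQ using mQ' by simp
    also have "\<dots> \<le> 2 ^ CARD('n) * fn ?Q"
      using osc_le_box[OF grid_pt_less[OF ab]] unfolding P_def osc_def dyadic_def
      by (intro mult_left_mono) auto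
    finally show "avg ?Q' (\<lambda>y. \<bar>f y - P y\<bar>) \<le> 2 ^ CARD('n) * fn ?Q" .
  qed simp
  finally show ?thesis unfolding P_def C0_def by (simp only: mult.assoc)
qed

text \<open>The passage from generation \<open>i\<close> to \<open>i + 1\<close> is charged to the
  ancestor of generation \<open>i\<close>, which is why the sum stops before \<open>k\<close> and
  the cell itself does not occur.\<close>

lemma telescope:
  fixes a b :: "real ^ 'n"
  assumes ab: "\<And>i. a $ i < b $ i" and j: "j \<in> grid_idx k" "x \<in> dyadic a b k j"
  shows "\<bar>poly_proj m (dyadic a b k j) f x - poly_proj m (box a b) f x\<bar> \<le> (\<Sum>i<k. C0 * level a b i x)"
  using j
proof (induction k arbitrary: j)
  case 0
  show ?case unfolding dyadic_0[OF 0(1)] by simp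
next
  case (Suc k)
  have p: "grid_parent j \<in> grid_idx k" by (rule grid_parent_idx[OF Suc.prems(1)])
  have xp: "x \<in> dyadic a b k (grid_parent j)" using dyadic_parent[OF ab] Suc.prems(2) by blast
  have lv: "level a b k x = fn (dyadic a b k (grid_parent j))"
    unfolding level_def by (rule sum_dyadic_indicator[OF ab p xp])
  show ?case
    using Suc.IH[OF p xp] proj_step[OF ab Suc.prems(2)] unfolding sum.lessThan_Suc lv by linarith
qed

text \<open>Apply \<open>interpolation\<close> on every cell with \<open>t\<close> the value of the
  functional there: the integrals of \<open>h\<close> add up to at most \<open>H\<close>, and the
  powers \<open>p\<close> are summed by \<open>sum_fn_powr_p\<close>, whose diameter factor tends to
  0.\<close>

lemma sum_measure_fn_small:
  fixes a b :: "real ^ 'n"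
  assumes ab: "\<And>i. a $ i < b $ i" and \<epsilon>: "\<epsilon> > 0"
  shows "\<exists>k. (\<Sum>j\<in>grid_idx k. measure lebesgue (dyadic a b k j) * fn (dyadic a b k j)) \<le> \<epsilon>"
proof -
  let ?R = "box a b"
  obtain h where h: "set_integrable lebesgue ?R h" "\<And>x. 0 \<le> h x"
    and hK: "\<And>l. l > 0 \<Longrightarrow> \<exists>K\<ge>0. AE x in lebesgue. x \<in> ?R \<longrightarrow> (\<forall>t\<ge>0. t \<le> l * h x + K * (t powr p * w x))"
    using interpolation[OF ab qp] by blast
  define H where "H = (LINT x:?R|lebesgue. h x)"
  have H: "H \<ge> 0" using h(2) by (simp add: H_def set_lebesgue_integral_def)
  \<comment> \<open>Fixed before the generation is chosen, so that the possibly huge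
    \<open>K\<close> belonging to it is a constant when \<open>k\<close> grows.\<close>
  define l where "l = \<epsilon> / (2 * (H + 1))"
  have l: "l > 0" using \<epsilon> H by (simp add: l_def)
  obtain K where K: "K \<ge> 0" "AE x in lebesgue. x \<in> ?R \<longrightarrow> (\<forall>t\<ge>0. t \<le> l * h x + K * (t powr p * w x))"
    using hK[OF l] by blast
  define M where "M = measure \<mu> ?R"
  define D where "D = diameter ?R"
  have D: "D \<ge> 0" unfolding D_def by (rule diameter_nonneg)
  have bound: "(\<Sum>j\<in>grid_idx k. measure lebesgue (dyadic a b k j) * fn (dyadic a b k j))
      \<le> l * H + K * ((1 / 2 ^ k * D) powr (\<delta> * p) * M)" for k
  proof -
    have one: "measure lebesgue (dyadic a b k j) * fn (dyadic a b k j)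
        \<le> l * (LINT x:dyadic a b k j|lebesgue. h x) + K * (fn (dyadic a b k j) powr p * wmeas w (dyadic a b k j))"
      if j: "j \<in> grid_idx k" for j
    proof -
      let ?Q = "dyadic a b k j"
      define t where "t = fn ?Q"
      have t: "t \<ge> 0" unfolding t_def by (rule fn_nonneg)
      have iw: "set_integrable lebesgue ?Q (\<lambda>x. K * (t powr p * w x))"
        unfolding dyadic_def by (intro set_integrable_mult_right w_int)
      have ih: "set_integrable lebesgue ?Q (\<lambda>x. l * h x)"
        by (intro set_integrable_mult_right set_integrable_subset[OF h(1) _ dyadic_subset[OF ab j]])
          (simp add: dyadic_def)
      have "measure lebesgue ?Q * t = (LINT x:?Q|lebesgue. t)"
        unfolding dyadic_def by (rule LINT_const_box[symmetric])
      also have "\<dots> \<le> (LINT x:?Q|lebesgue. l * h x + K * (t powr p * w x))"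
      proof (rule set_integral_mono_AE)
        show "set_integrable lebesgue ?Q (\<lambda>x. t)" unfolding dyadic_def by (rule set_integrable_const_box)
        show "set_integrable lebesgue ?Q (\<lambda>x. l * h x + K * (t powr p * w x))" by (rule set_integral_add(1)[OF ih iw])
        show "AE x \<in> ?Q in lebesgue. t \<le> l * h x + K * (t powr p * w x)"
          using K(2)
        proof eventually_elim
          case (elim x)
          then show ?case using dyadic_subset[OF ab j] t by blast
        qed
      qed
      also have "\<dots> = l * (LINT x:?Q|lebesgue. h x) + K * (t powr p * wmeas w ?Q)"
        unfolding set_integral_add(2)[OF ih iw] by (simp only: set_integral_mult_right wmeas_def)
      finally show ?thesis unfolding t_def .
    qed
    have "(\<Sum>j\<in>grid_idx k. measure lebesgue (dyadic a b k j) * fn (dyadic a b k j))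
      \<le> (\<Sum>j\<in>grid_idx k. l * (LINT x:dyadic a b k j|lebesgue. h x) + K * (fn (dyadic a b k j) powr p * wmeas w (dyadic a b k j)))"
      by (rule sum_mono[OF one])
    also have "\<dots> = l * (\<Sum>j\<in>grid_idx k. LINT x:dyadic a b k j|lebesgue. h x)
        + K * (\<Sum>j\<in>grid_idx k. fn (dyadic a b k j) powr p * wmeas w (dyadic a b k j))"
      by (simp only: sum.distrib sum_distrib_left)
    also have "\<dots> \<le> l * H + K * ((1 / 2 ^ k * D) powr (\<delta> * p) * M)"
      unfolding H_def D_def M_def using l K(1)
      by (intro add_mono mult_left_mono sum_dyadic_le[OF ab h] sum_fn_powr_p[OF ab]) auto
    finally show ?thesis .
  qed
  have "(\<lambda>k. 1 / 2 ^ k * D) \<longlonglongrightarrow> 0 * D"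
    by (intro tendsto_mult tendsto_const LIMSEQ_divide_realpow_zero) simp
  then have "(\<lambda>k. (1 / 2 ^ k * D) powr (\<delta> * p)) \<longlonglongrightarrow> 0 powr (\<delta> * p)"
    using D \<delta>0 p1 by (intro tendsto_powr' tendsto_const) auto
  then have "(\<lambda>k. K * ((1 / 2 ^ k * D) powr (\<delta> * p) * M)) \<longlonglongrightarrow> K * (0 powr (\<delta> * p) * M)"
    by (intro tendsto_mult tendsto_const)
  then have "(\<lambda>k. K * ((1 / 2 ^ k * D) powr (\<delta> * p) * M)) \<longlonglongrightarrow> 0" by simp
  then have "\<forall>\<^sub>F k in sequentially. K * ((1 / 2 ^ k * D) powr (\<delta> * p) * M) < \<epsilon> / 2"
    using \<epsilon> by (intro order_tendstoD(2)) auto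
  then obtain k where k: "K * ((1 / 2 ^ k * D) powr (\<delta> * p) * M) < \<epsilon> / 2"
    by (meson eventually_sequentially order_refl)
  have "l * H \<le> \<epsilon> / 2"
  proof -
    have "l * H = \<epsilon> / 2 * (H / (H + 1))" using H by (simp add: l_def)
    also have "\<dots> \<le> \<epsilon> / 2 * 1" using H \<epsilon> by (intro mult_left_mono) auto
    finally show ?thesis by simp
  qed
  then show ?thesis using bound[of k] k by (intro exI[of _ k]) linarith
qed

lemma dyadic_meas: "dyadic a b k j \<in> sets lebesgue"
  by (simp add: dyadic_def)

lemma level_measurable: "level a b k \<in> borel_measurable lebesgue"
  unfolding level_def
  by (intro borel_measurable_sum borel_measurable_times borel_measurable_const borel_measurable_indicator dyadic_meas)

text \<open>Takes the place of Lebesgue differentiation. The excess \<open>E\<close> of the left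
  side over the full series does not depend on the generation, yet for every \<open>k\<close> it is
  at most the distance of \<open>f\<close> to its projection on the cell of generation
  \<open>k\<close>. The integral of that distance is at most the sum of |Q| a(Q), which can be made
  arbitrarily small.\<close>

lemma pointwise_bound:
  fixes a b :: "real ^ 'n"
  assumes ab: "\<And>i. a $ i < b $ i"
  shows "AE x in lebesgue. x \<in> box a b \<longrightarrow>
    ennreal \<bar>f x - poly_proj m (box a b) f x\<bar> \<le> (\<Sum>k. ennreal (C0 * level a b k x))"
proof -
  let ?R = "box a b"
  define P where "P = poly_proj m ?R f"
  define G where "G x = (\<Sum>k. ennreal (C0 * level a b k x))" for x
  \<comment> \<open>Subtraction in \<open>ennreal\<close> is truncated at 0, so the excess vanishes
    wherever the series dominates or diverges.\<close>
  define E where "E x = (ennreal \<bar>f x - P x\<bar> - G x) * indicator ?R x" for x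
  have Gm: "G \<in> borel_measurable lebesgue"
    unfolding G_def using level_measurable by measurable
  have "P \<in> borel_measurable borel"
    unfolding P_def by (intro borel_measurable_continuous_onI poly_space_continuous[OF poly_proj_in_poly_space[OF ab]])
  then have Pm: "P \<in> borel_measurable lebesgue" by (simp add: measurable_completion)
  have fm: "f \<in> borel_measurable lebesgue" by (rule locally_integrable_measurable[OF f_loc])
  have Em: "E \<in> borel_measurable lebesgue"
    unfolding E_def using fm Pm Gm by (intro borel_measurable_times_ennreal borel_measurable_indicator borel_measurable_minus_ennreal) auto
  have le: "(\<integral>\<^sup>+x. E x \<partial>lebesgue) \<le> ennreal (\<Sum>j\<in>grid_idx k. measure lebesgue (dyadic a b k j) * fn (dyadic a b k j))" for k
  proof -
    define d where "d j x = \<bar>f x - poly_proj m (dyadic a b k j) f x\<bar>" for j x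
    have di: "set_integrable lebesgue (dyadic a b k j) (d j)" for j
      unfolding d_def dyadic_def by (intro set_integrable_abs osc_integrable[OF grid_pt_less[OF ab] f_int])
    have dm: "(\<lambda>x. ennreal (d j x) * indicator (dyadic a b k j) x) \<in> borel_measurable lebesgue" for j
    proof -
      have "(\<lambda>x. indicator (dyadic a b k j) x *\<^sub>R d j x) \<in> borel_measurable lebesgue"
        using di unfolding set_integrable_def by (rule borel_measurable_integrable)
      then have "(\<lambda>x. ennreal (indicator (dyadic a b k j) x *\<^sub>R d j x)) \<in> borel_measurable lebesgue" by measurable
      also have "(\<lambda>x. ennreal (indicator (dyadic a b k j) x *\<^sub>R d j x)) = (\<lambda>x. ennreal (d j x) * indicator (dyadic a b k j) x)"
        by (auto simp: fun_eq_iff indicator_def)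
      finally show ?thesis .
    qed
    have "(\<integral>\<^sup>+x. E x \<partial>lebesgue) \<le> (\<integral>\<^sup>+x. (\<Sum>j\<in>grid_idx k. ennreal (d j x) * indicator (dyadic a b k j) x) \<partial>lebesgue)"
    proof (rule nn_integral_mono_AE)
      show "AE x in lebesgue. E x \<le> (\<Sum>j\<in>grid_idx k. ennreal (d j x) * indicator (dyadic a b k j) x)"
        using dyadic_cover[OF ab, of k]
      proof eventually_elim
        case (elim x)
        show ?case
        proof (cases "x \<in> ?R")
          case True
          then obtain j where j: "j \<in> grid_idx k" "x \<in> dyadic a b k j" using elim by blast
          have "\<bar>f x - P x\<bar> \<le> d j x + (\<Sum>i<k. C0 * level a b i x)"
            using telescope[OF ab j] unfolding d_def P_def by linarith
          then have "ennreal \<bar>f x - P x\<bar> \<le> ennreal (d j x + (\<Sum>i<k. C0 * level a b i x))" by (rule ennreal_leI)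
          also have "\<dots> = ennreal (d j x) + ennreal (\<Sum>i<k. C0 * level a b i x)"
            using C0_pos level_nonneg by (intro ennreal_plus sum_nonneg mult_nonneg_nonneg) (auto simp: d_def less_imp_le)
          also have "ennreal (\<Sum>i<k. C0 * level a b i x) = (\<Sum>i<k. ennreal (C0 * level a b i x))"
            using C0_pos level_nonneg by (intro sum_ennreal[symmetric] mult_nonneg_nonneg) (auto simp: less_imp_le)
          also have "\<dots> \<le> G x" unfolding G_def by (intro sum_le_suminf summableI) auto
          finally have "ennreal \<bar>f x - P x\<bar> \<le> ennreal (d j x) + G x" by (simp add: add_left_mono)
          then have "E x \<le> ennreal (d j x) * indicator (dyadic a b k j) x"
            using True j(2) unfolding E_def by (simp add: ennreal_minus_le_iff add.commute)
          also have "\<dots> \<le> (\<Sum>j\<in>grid_idx k. ennreal (d j x) * indicator (dyadic a b k j) x)"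
            using j(1) finite_grid_idx by (intro member_le_sum) auto
          finally show ?thesis .
        qed (simp add: E_def)
      qed
    qed
    also have "\<dots> = (\<Sum>j\<in>grid_idx k. \<integral>\<^sup>+x\<in>dyadic a b k j. ennreal (d j x) \<partial>lebesgue)"
      by (rule nn_integral_sum[OF dm])
    also have "\<dots> = (\<Sum>j\<in>grid_idx k. ennreal (LINT x:dyadic a b k j|lebesgue. d j x))"
      by (intro sum.cong refl set_nn_integral_eq_LINT di) (simp add: d_def)
    also have "\<dots> = ennreal (\<Sum>j\<in>grid_idx k. (LINT x:dyadic a b k j|lebesgue. d j x))"
      by (intro sum_ennreal) (simp add: d_def set_lebesgue_integral_def)
    also have "\<dots> \<le> ennreal (\<Sum>j\<in>grid_idx k. measure lebesgue (dyadic a b k j) * fn (dyadic a b k j))"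
    proof (intro ennreal_leI sum_mono)
      fix j
      have "(LINT x:dyadic a b k j|lebesgue. d j x) = measure lebesgue (dyadic a b k j) * osc m f (dyadic a b k j)"
        unfolding d_def dyadic_def by (rule LINT_osc[OF grid_pt_less[OF ab]])
      also have "\<dots> \<le> measure lebesgue (dyadic a b k j) * fn (dyadic a b k j)"
        unfolding dyadic_def by (intro mult_left_mono osc_le_box grid_pt_less[OF ab]) auto
      finally show "(LINT x:dyadic a b k j|lebesgue. d j x) \<le> measure lebesgue (dyadic a b k j) * fn (dyadic a b k j)" .
    qed
    finally show ?thesis .
  qed
  have "(\<integral>\<^sup>+x. E x \<partial>lebesgue) \<le> 0"
  proof (rule ennreal_le_epsilon)
    fix \<epsilon> :: real assume "0 < \<epsilon>"
    then obtain k where "(\<Sum>j\<in>grid_idx k. measure lebesgue (dyadic a b k j) * fn (dyadic a b k j)) \<le> \<epsilon>"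
      using sum_measure_fn_small[OF ab] by blast
    then show "(\<integral>\<^sup>+x. E x \<partial>lebesgue) \<le> 0 + ennreal \<epsilon>"
      using order_trans[OF le[of k] ennreal_leI] by simp
  qed
  then have "AE x in lebesgue. E x = 0" using Em by (simp add: nn_integral_0_iff_AE)
  then show ?thesis
  proof (eventually_elim, intro impI)
    fix x assume "E x = 0" "x \<in> ?R"
    then have "ennreal \<bar>f x - P x\<bar> - G x = 0" by (simp add: E_def)
    then show "ennreal \<bar>f x - poly_proj m ?R f x\<bar> \<le> (\<Sum>k. ennreal (C0 * level a b k x))"
      unfolding P_def G_def by (rule ennreal_minus_eq_0)
  qed
qed

end

text \<open>Lebesgue measurability would not do here, because \<mu> is defined on Borel sets
  only.\<close>

lemma rectangle_borel:
  fixes R :: "(real ^ 'n) set"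
  assumes "R \<in> rectangles"
  shows "R \<in> sets borel"
proof -
  obtain I :: "'n \<Rightarrow> real set" where I: "\<forall>i. is_interval (I i) \<and> bounded (I i) \<and> interior (I i) \<noteq> {}"
    and R: "R = {x. \<forall>i. x $ i \<in> I i}"
    using assms unfolding rectangles_def mem_Collect_eq by (elim exE conjE) (rule that)
  have m: "(\<lambda>x::real^'n. x $ i) -` I i \<inter> space borel \<in> sets borel" for i
    using I by (intro measurable_sets[OF borel_measurable_continuous_onI] continuous_on_component
      continuous_on_id real_interval_borel_measurable) blast
  have "R = (\<Inter>i. (\<lambda>x::real^'n. x $ i) -` I i \<inter> space borel)" unfolding R by auto
  then show ?thesis using m by (simp only:) (intro sets.finite_INT, auto)
qed

lemma enn_powr_root_le:
  assumes "x \<le> ennreal (y powr r)" "0 \<le> y" "0 < r"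
  shows "enn_powr x (1 / r) \<le> ennreal y"
proof -
  have "x < \<infinity>" using assms(1) by (rule order_le_less_trans) simp
  then obtain z where z: "z \<ge> 0" "x = ennreal z" by (cases x) auto
  have "z \<le> y powr r" using assms(1) z by simp
  then have "z powr (1 / r) \<le> (y powr r) powr (1 / r)" using z assms(3) by (intro powr_mono2) auto
  also have "\<dots> = y" using assms by (simp add: powr_powr)
  finally show ?thesis
    unfolding z(2) using z(1) assms(3) by (subst enn_powr_pos) (auto intro: ennreal_leI)
qed

text \<open>The sum of the geometric series of the generations, and the origin of the factor
  \<open>1 / \<kappa>\<close>. It follows from \<open>exp x \<ge> 1 + x\<close> and the crude bound
  \<open>ln 2 \<ge> 1 / 2\<close>.\<close>

lemma inverse_one_minus_two_powr:
  fixes \<kappa> :: real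
  assumes "\<kappa> > 0"
  shows "1 / (1 - (1 / 2) powr \<kappa>) \<le> (\<kappa> + 2) / \<kappa>"
proof -
  define x where "x = \<kappa> * ln 2"
  have "ln (1 / 2 :: real) \<le> 1 / 2 - 1" by (rule ln_le_minus_one) simp
  then have ln2: "ln (2 :: real) \<ge> 1 / 2" by (simp add: ln_div)
  have x: "x > 0" "x \<ge> \<kappa> / 2"
    using assms ln2 mult_left_mono[OF ln2, of \<kappa>] by (auto simp: x_def)
  have "(1 / 2 :: real) powr \<kappa> = exp (- x)" by (simp add: powr_def x_def ln_div)
  also have "\<dots> \<le> 1 / (1 + x)"
    using exp_ge_add_one_self[of x] x by (simp add: exp_minus field_simps)
  finally have "x / (1 + x) \<le> 1 - (1 / 2) powr \<kappa>" using x by (simp add: field_simps)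
  moreover have "0 < x / (1 + x)" using x by simp
  ultimately have "1 / (1 - (1 / 2) powr \<kappa>) \<le> 1 / (x / (1 + x))" by (intro frac_le) auto
  also have "\<dots> = 1 + 1 / x" using x by (simp add: field_simps)
  also have "\<dots> \<le> 1 + 1 / (\<kappa> / 2)" using x assms by (intro add_left_mono divide_left_mono) auto
  also have "\<dots> = (\<kappa> + 2) / \<kappa>" using assms by (simp add: field_simps)
  finally show ?thesis .
qed

section \<open>The weighted bound on boxes and the regime of large exponents\<close>

context poincare_setting
begin

text \<open>Raise the pointwise series to the power \<open>r\<close> with
  \<open>powr_suminf_le\<close>, integrate term by term against \<open>w\<close>, and insert
  \<open>sum_fn_powr_r\<close>. The convexity weights use the same ratio \<theta> with which the
  generations decay.\<close>

lemma box_bound: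
  fixes a b :: "real ^ 'n"
  assumes ab: "\<And>i. a $ i < b $ i"
  shows "(\<integral>\<^sup>+x\<in>box a b. ennreal (\<bar>f x - poly_proj m (box a b) f x\<bar> powr r * w x) \<partial>lebesgue)
    \<le> ennreal ((C0 * (A powr \<tau> * fn (box a b)) / (1 - (1 / 2) powr \<kappa>)) powr r * wmeas w (box a b))"
proof -
  let ?R = "box a b"
  define \<theta> :: real where "\<theta> = (1 / 2) powr \<kappa>"
  have \<theta>: "0 < \<theta>" "\<theta> < 1"
    unfolding \<theta>_def using \<kappa>_pos powr_less_mono2[of \<kappa> "1 / 2" 1] by auto
  define M where "M = A powr \<tau> * fn ?R"
  have M: "M \<ge> 0" unfolding M_def by (intro mult_nonneg_nonneg fn_nonneg) simp
  define W where "W = wmeas w ?R"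
  have W: "W > 0" unfolding W_def by (rule W_pos[OF ab])
  define c where "c k = (1 - \<theta>) * \<theta> ^ k" for k
  have c: "c k > 0" for k using \<theta> by (simp add: c_def)
  have c1: "c sums 1"
  proof -
    have "c sums ((1 - \<theta>) * (1 / (1 - \<theta>)))"
      unfolding c_def using \<theta> by (intro sums_mult geometric_sums) simp
    then show ?thesis using \<theta> by simp
  qed
  \<comment> \<open>By that choice \<open>C0 / c k * (M * \<theta> ^ k)\<close> is this number for
    every \<open>k\<close>. Generation \<open>k\<close> then contributes
    \<open>c k * (Y powr r * W)\<close>, and the \<open>c k\<close> add up to 1.\<close>
  define Y where "Y = C0 * M / (1 - \<theta>)"
  have Y: "Y \<ge> 0" unfolding Y_def using C0_pos M \<theta> by simp
  define F where "F k x = c k * (C0 * level a b k x / c k) powr r" for k x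
  have F: "F k x = (c k * (C0 / c k) powr r) * level a b k x powr r" for k x
  proof -
    have "C0 * level a b k x / c k = (C0 / c k) * level a b k x" by simp
    then show ?thesis unfolding F_def by (simp only: powr_mult mult.assoc)
  qed
  have F0: "F k x \<ge> 0" for k x unfolding F_def using c[of k] by simp
  have Fm: "F k \<in> borel_measurable lebesgue" for k
    unfolding F_def using level_measurable[of a b k] by measurable
  have "(\<integral>\<^sup>+x\<in>?R. ennreal (\<bar>f x - poly_proj m ?R f x\<bar> powr r * w x) \<partial>lebesgue)
      \<le> (\<integral>\<^sup>+x. (\<Sum>k. ennreal (F k x) * (ennreal (w x) * indicator ?R x)) \<partial>lebesgue)"
  proof (rule nn_integral_mono_AE)
    show "AE x in lebesgue. ennreal (\<bar>f x - poly_proj m ?R f x\<bar> powr r * w x) * indicator ?R x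
       \<le> (\<Sum>k. ennreal (F k x) * (ennreal (w x) * indicator ?R x))"
      using pointwise_bound[OF ab]
    proof eventually_elim
      case (elim x)
      show ?case
      proof (cases "x \<in> ?R")
        case True
        then have "ennreal \<bar>f x - poly_proj m ?R f x\<bar> \<le> (\<Sum>k. ennreal (C0 * level a b k x))" using elim by blast
        then have "ennreal (\<bar>f x - poly_proj m ?R f x\<bar> powr r) \<le> (\<Sum>k. ennreal (F k x))"
          unfolding F_def c_def using C0_pos level_nonneg
          by (intro powr_suminf_le r_ge_1 \<theta>) (auto simp: less_imp_le)
        then have "ennreal (\<bar>f x - poly_proj m ?R f x\<bar> powr r) * ennreal (w x) \<le> (\<Sum>k. ennreal (F k x)) * ennreal (w x)"
          by (rule mult_right_mono) simp
        then show ?thesis using True w0[of x] by (simp add: ennreal_mult)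
      qed simp
    qed
  qed
  also have "\<dots> = (\<Sum>k. \<integral>\<^sup>+x. ennreal (F k x) * (ennreal (w x) * indicator ?R x) \<partial>lebesgue)"
    using Fm w_meas
    by (intro nn_integral_suminf borel_measurable_times_ennreal borel_measurable_indicator measurable_compose[OF _ measurable_ennreal]) auto
  also have "\<dots> \<le> (\<Sum>k. ennreal (c k * (Y powr r * W)))"
  proof (intro suminf_le summableI)
    fix k
    define B where "B = c k * (C0 / c k) powr r"
    have B: "B \<ge> 0" unfolding B_def using c[of k] by simp
    have "(\<integral>\<^sup>+x. ennreal (F k x) * (ennreal (w x) * indicator ?R x) \<partial>lebesgue)
        = (\<integral>\<^sup>+x. (\<Sum>j\<in>grid_idx k. ennreal (B * fn (dyadic a b k j) powr r) * (ennreal (w x) * indicator (dyadic a b k j) x)) \<partial>lebesgue)"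
    proof (rule nn_integral_cong)
      fix x
      have "ennreal (F k x) = (\<Sum>j\<in>grid_idx k. ennreal (B * fn (dyadic a b k j) powr r) * indicator (dyadic a b k j) x)"
      proof -
        have "F k x = (\<Sum>j\<in>grid_idx k. B * fn (dyadic a b k j) powr r * indicator (dyadic a b k j) x)"
          unfolding F level_powr[OF ab] sum_distrib_left B_def by (simp only: mult.assoc)
        also have "ennreal \<dots> = (\<Sum>j\<in>grid_idx k. ennreal (B * fn (dyadic a b k j) powr r * indicator (dyadic a b k j) x))"
          using B by (intro sum_ennreal[symmetric] mult_nonneg_nonneg) auto
        finally show ?thesis by (simp add: ennreal_mult'' ennreal_indicator)
      qed
      then have "ennreal (F k x) * (ennreal (w x) * indicator ?R x)
        = (\<Sum>j\<in>grid_idx k. ennreal (B * fn (dyadic a b k j) powr r) * indicator (dyadic a b k j) x * (ennreal (w x) * indicator ?R x))"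
        by (simp only: sum_distrib_right)
      also have "\<dots> = (\<Sum>j\<in>grid_idx k. ennreal (B * fn (dyadic a b k j) powr r) * (ennreal (w x) * indicator (dyadic a b k j) x))"
      proof (rule sum.cong[OF refl])
        fix j :: "'n \<Rightarrow> nat" assume "j \<in> grid_idx k"
        then have "x \<in> dyadic a b k j \<Longrightarrow> x \<in> ?R" using dyadic_subset[OF ab] by blast
        then show "ennreal (B * fn (dyadic a b k j) powr r) * indicator (dyadic a b k j) x * (ennreal (w x) * indicator ?R x)
          = ennreal (B * fn (dyadic a b k j) powr r) * (ennreal (w x) * indicator (dyadic a b k j) x)"
          by (cases "x \<in> dyadic a b k j") simp_all
      qed
      finally show "ennreal (F k x) * (ennreal (w x) * indicator ?R x)
        = (\<Sum>j\<in>grid_idx k. ennreal (B * fn (dyadic a b k j) powr r) * (ennreal (w x) * indicator (dyadic a b k j) x))" .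
    qed
    also have "\<dots> = (\<Sum>j\<in>grid_idx k. ennreal (B * fn (dyadic a b k j) powr r) * (\<integral>\<^sup>+x\<in>dyadic a b k j. ennreal (w x) \<partial>lebesgue))"
    proof -
      have wm: "(\<lambda>x. ennreal (w x) * indicator (dyadic a b k j) x) \<in> borel_measurable lebesgue" for j :: "'n \<Rightarrow> nat"
        using w_meas dyadic_meas by (intro borel_measurable_times_ennreal borel_measurable_indicator) auto
      have "(\<integral>\<^sup>+x. (\<Sum>j\<in>grid_idx k. ennreal (B * fn (dyadic a b k j) powr r) * (ennreal (w x) * indicator (dyadic a b k j) x)) \<partial>lebesgue)
        = (\<Sum>j\<in>grid_idx k. \<integral>\<^sup>+x. ennreal (B * fn (dyadic a b k j) powr r) * (ennreal (w x) * indicator (dyadic a b k j) x) \<partial>lebesgue)"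
        by (rule nn_integral_sum) (intro borel_measurable_times_ennreal borel_measurable_const wm)
      then show ?thesis unfolding nn_integral_cmult[OF wm] .
    qed
    also have "\<dots> = (\<Sum>j\<in>grid_idx k. ennreal (B * (fn (dyadic a b k j) powr r * wmeas w (dyadic a b k j))))"
    proof (rule sum.cong[OF refl])
      fix j :: "'n \<Rightarrow> nat"
      have "(\<integral>\<^sup>+x\<in>dyadic a b k j. ennreal (w x) \<partial>lebesgue) = ennreal (wmeas w (dyadic a b k j))"
        unfolding wmeas_def dyadic_def by (rule set_nn_integral_eq_LINT[OF w_int w0])
      then show "ennreal (B * fn (dyadic a b k j) powr r) * (\<integral>\<^sup>+x\<in>dyadic a b k j. ennreal (w x) \<partial>lebesgue)
          = ennreal (B * (fn (dyadic a b k j) powr r * wmeas w (dyadic a b k j)))"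
        using B W_dyadic_pos[OF ab, of k j] by (simp add: ennreal_mult[symmetric] mult.assoc)
    qed
    also have "\<dots> = ennreal (B * (\<Sum>j\<in>grid_idx k. fn (dyadic a b k j) powr r * wmeas w (dyadic a b k j)))"
      unfolding sum_distrib_left using B W_dyadic_pos[OF ab, of k]
      by (intro sum_ennreal mult_nonneg_nonneg) (auto simp: less_imp_le)
    also have "\<dots> \<le> ennreal (B * ((M * \<theta> ^ k) powr r * W))"
    proof (intro ennreal_leI mult_left_mono B)
      have "(1 / 2 ^ k) powr \<kappa> = \<theta> ^ k"
      proof -
        have "(1 / 2 ^ k) powr \<kappa> = ((1 / 2) powr real k) powr \<kappa>" by (simp add: powr_realpow power_one_over)
        also have "\<dots> = (1 / 2) powr (\<kappa> * real k)" by (simp add: powr_powr mult.commute)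
        also have "\<dots> = \<theta> powr real k" unfolding \<theta>_def by (simp add: powr_powr)
        also have "\<dots> = \<theta> ^ k" using \<theta> by (simp add: powr_realpow)
        finally show ?thesis .
      qed
      then show "(\<Sum>j\<in>grid_idx k. fn (dyadic a b k j) powr r * wmeas w (dyadic a b k j)) \<le> (M * \<theta> ^ k) powr r * W"
        using sum_fn_powr_r[OF ab, of k] unfolding M_def W_def by (simp add: mult_ac)
    qed
    also have "B * ((M * \<theta> ^ k) powr r * W) = c k * (Y powr r * W)"
    proof -
      have "(C0 / c k) powr r * (M * \<theta> ^ k) powr r = (C0 / c k * (M * \<theta> ^ k)) powr r" by (rule powr_mult[symmetric])
      also have "C0 / c k * (M * \<theta> ^ k) = Y" using \<theta> by (simp add: c_def Y_def)
      finally show ?thesis unfolding B_def by (simp add: mult.assoc[symmetric])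
    qed
    finally show "(\<integral>\<^sup>+x. ennreal (F k x) * (ennreal (w x) * indicator ?R x) \<partial>lebesgue) \<le> ennreal (c k * (Y powr r * W))" .
  qed
  also have "\<dots> = ennreal (Y powr r * W)"
  proof -
    have "(\<lambda>k. c k * (Y powr r * W)) sums (1 * (Y powr r * W))" by (rule sums_mult2[OF c1])
    then show ?thesis
      using c W by (subst suminf_ennreal_eq) (auto intro!: mult_nonneg_nonneg simp: less_imp_le)
  qed
  finally show ?thesis unfolding Y_def M_def \<theta>_def W_def .
qed

text \<open>After \<open>k\<close> passages to corner boxes the oscillation is at most
  \<open>L ^ k\<close> times the functional on a box of relative size
  \<open>T = \<theta> ^ k\<close>. The diameter contributes \<open>T powr \<delta>\<close>, the
  quotient of \<mu> and \<open>w\<close> at most a constant times \<open>T powr (- n)\<close>. So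
  the bound is geometric with ratio \<open>z < 1\<close>.\<close>

lemma osc_zero:
  fixes a b :: "real ^ 'n"
  assumes ab: "\<And>i. a $ i < b $ i"
    and small: "chain_const m TYPE('n) * (1 - core_eps m) powr (\<delta> - real CARD('n)) < 1"
  shows "osc m f (box a b) = 0"
proof -
  let ?R = "box a b"
  define L where "L = chain_const m TYPE('n)"
  define \<theta> where "\<theta> = 1 - core_eps m"
  have L: "L > 0" unfolding L_def by (rule chain_const_pos)
  have \<theta>: "0 < \<theta>" "\<theta> < 1" unfolding \<theta>_def using core_eps(1,2)[of m] by auto
  define W where "W = wmeas w ?R"
  have W: "W > 0" unfolding W_def by (rule W_pos[OF ab])
  define M where "M = measure \<mu> ?R"
  define D where "D = diameter ?R"
  have D: "D \<ge> 0" unfolding D_def by (rule diameter_nonneg)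
  have A: "A > 0" using A_gt_1 by simp
  define z where "z = L * \<theta> powr (\<delta> - real CARD('n))"
  have z: "0 \<le> z" "z < 1" unfolding z_def using L small by (simp_all add: L_def \<theta>_def)
  define c where "c = D powr \<delta> * (M * A / W) powr (1 / p)"
  have bound: "osc m f ?R \<le> z ^ k * c" for k
  proof -
    define T where "T = \<theta> ^ k"
    have T: "0 < T" "T \<le> 1" unfolding T_def using \<theta> by (auto intro: power_le_one)
    obtain u v where uv': "\<forall>i. u $ i < v $ i" "box u v \<subseteq> ?R" "v - u = T *\<^sub>R (b - a)"
      and o: "osc m f ?R \<le> L ^ k * osc m f (box u v)"
      using osc_chain[OF ab f_int, of m k] unfolding T_def \<theta>_def L_def by blast
    have uv: "u $ i < v $ i" for i using uv'(1) by simp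
    define W' where "W' = wmeas w (box u v)"
    have W': "W' > 0" unfolding W'_def by (rule W_pos[OF uv])
    have ratio: "measure lebesgue (box u v) / measure lebesgue ?R = T ^ CARD('n)"
      using measure_box_scale[OF ab T(1) uv'(3)] measure_box_pos[OF ab] by simp
    have "(T ^ CARD('n)) powr q * W \<le> A * W'"
      using doubling[OF ab uv uv'(2)] unfolding ratio W_def W'_def .
    moreover have "(T ^ CARD('n)) powr q = T powr (real CARD('n) * q)"
      using T by (simp add: powr_realpow[symmetric] powr_powr)
    ultimately have w1: "T powr (real CARD('n) * q) * W / A \<le> W'" using A by (simp add: pos_divide_le_eq mult.commute)
    have \<mu>le: "measure \<mu> (box u v) \<le> M"
      unfolding M_def
      by (rule measure_mono_fmeasurable[OF uv'(2) _ radon_fmeasurable[OF \<mu> _ box_subset_cbox]])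
        (use \<mu> in \<open>auto simp: radon_measure_def\<close>)
    have "measure \<mu> (box u v) / W' \<le> M / (T powr (real CARD('n) * q) * W / A)"
      using \<mu>le w1 T W W' A by (intro frac_le) (auto simp: M_def)
    also have "\<dots> = M * A / W * T powr (- (real CARD('n) * q))"
      using T W A by (simp add: powr_minus field_simps)
    finally have "(measure \<mu> (box u v) / W') powr (1 / p) \<le> (M * A / W * T powr (- (real CARD('n) * q))) powr (1 / p)"
      using W' p1 by (intro powr_mono2) auto
    also have "\<dots> = (M * A / W) powr (1 / p) * T powr (- (real CARD('n) * (q / p)))"
      by (simp only: powr_mult powr_powr) simp
    \<comment> \<open>Here \<open>T \<le> 1\<close> and \<open>q \<le> p\<close> replace the
      exponent \<open>n * q / p\<close> by \<open>n\<close>, which frees the smallness condition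
      from the weight and from \<open>p\<close> and \<open>q\<close>.\<close>
    also have "\<dots> \<le> (M * A / W) powr (1 / p) * T powr (- real CARD('n))"
    proof (intro mult_left_mono powr_mono')
      have "real CARD('n) * (q / p) \<le> real CARD('n) * 1" using qp p1 by (intro mult_left_mono) auto
      then show "- real CARD('n) \<le> - (real CARD('n) * (q / p))" by simp
    qed (use T in auto)
    finally have \<mu>w: "(measure \<mu> (box u v) / W') powr (1 / p) \<le> (M * A / W) powr (1 / p) * T powr (- real CARD('n))" .
    have "osc m f (box u v) \<le> fn (box u v)" by (rule osc_le_box[OF uv])
    also have "\<dots> \<le> (T * D) powr \<delta> * (measure \<mu> (box u v) / W') powr (1 / p)"
      unfolding D_def W'_def by (rule fn_scale_le[OF ab T(1) uv'(3)])
    also have "\<dots> \<le> (T * D) powr \<delta> * ((M * A / W) powr (1 / p) * T powr (- real CARD('n)))"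
      by (intro mult_left_mono \<mu>w) simp
    also have "\<dots> = T powr (\<delta> - real CARD('n)) * c"
    proof -
      have "T powr (\<delta> - real CARD('n)) = T powr \<delta> * T powr (- real CARD('n))" unfolding powr_add[symmetric] by simp
      then show ?thesis by (simp only: c_def powr_mult mult_ac)
    qed
    finally have "L ^ k * osc m f (box u v) \<le> L ^ k * (T powr (\<delta> - real CARD('n)) * c)"
      using L by (intro mult_left_mono) auto
    moreover have "T powr (\<delta> - real CARD('n)) = (\<theta> powr (\<delta> - real CARD('n))) ^ k"
    proof -
      have "T powr (\<delta> - real CARD('n)) = \<theta> powr (real k * (\<delta> - real CARD('n)))"
        unfolding T_def using \<theta> by (simp add: powr_realpow[symmetric] powr_powr)
      also have "\<dots> = (\<theta> powr (\<delta> - real CARD('n))) powr real k" by (simp add: powr_powr mult.commute)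
      also have "\<dots> = (\<theta> powr (\<delta> - real CARD('n))) ^ k" using \<theta> by (simp add: powr_realpow)
      finally show ?thesis .
    qed
    ultimately show ?thesis using o unfolding z_def power_mult_distrib by (simp add: mult.assoc)
  qed
  have "(\<lambda>k. z ^ k * c) \<longlonglongrightarrow> 0 * c" using z by (intro tendsto_mult tendsto_const LIMSEQ_power_zero) auto
  then have "osc m f ?R \<le> 0 * c" by (rule LIMSEQ_le_const) (use bound in blast)
  then show ?thesis using osc_nonneg[of m f ?R] by simp
qed

lemma box_integral_zero:
  fixes a b :: "real ^ 'n"
  assumes ab: "\<And>i. a $ i < b $ i" and o: "osc m f (box a b) = 0"
  shows "(\<integral>\<^sup>+x\<in>box a b. ennreal (\<bar>f x - poly_proj m (box a b) f x\<bar> powr r * w x) \<partial>lebesgue) = 0"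
proof -
  let ?d = "\<lambda>x. \<bar>f x - poly_proj m (box a b) f x\<bar>"
  have i: "set_integrable lebesgue (box a b) ?d" by (intro set_integrable_abs osc_integrable[OF ab f_int])
  have "(LINT x:box a b|lebesgue. ?d x) = 0" unfolding LINT_osc[OF ab] o by simp
  then have "AE x in lebesgue. indicator (box a b) x *\<^sub>R ?d x = 0"
    using i unfolding set_integrable_def set_lebesgue_integral_def
    by (subst (asm) integral_nonneg_eq_0_iff_AE) auto
  then have "AE x in lebesgue. ennreal (?d x powr r * w x) * indicator (box a b) x = 0"
    by eventually_elim (auto simp: indicator_def split: if_splits)
  then have "(\<integral>\<^sup>+x\<in>box a b. ennreal (?d x powr r * w x) \<partial>lebesgue) = (\<integral>\<^sup>+(x::real^'n). 0 \<partial>lebesgue)"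
    by (rule nn_integral_cong_AE)
  then show ?thesis by simp
qed

end

section \<open>From boxes to rectangles, and the uniform constant\<close>

context poincare_setting
begin

lemma B_const_eq: "B_const q w * (1 / \<delta>) = 1 / \<kappa>"
proof -
  have l: "ln (A powr (1 / q)) = ln A / q" using A_gt_1 by (simp add: ln_powr)
  have "B_const q w = (1 + ln A / q) / (ln A / q)"
    unfolding B_const_def A_def[symmetric] l ..
  also have "\<dots> = (q + ln A) / ln A" using q1 lnA by (simp add: field_simps)
  finally show ?thesis using \<delta>0 q1 lnA by (simp add: \<kappa>_def)
qed

text \<open>The boundary is null for Lebesgue measure but possibly not for \<mu>, so the functional
  only compares by an inequality. The direction is the right one: the hypothesis is used on open
  boxes, and the conclusion concerns \<open>R\<close>.\<close>

lemma fn_mono_box: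
  fixes a b :: "real ^ 'n"
  assumes ab: "\<And>i. a $ i < b $ i" and R: "R \<in> rectangles" "box a b \<subseteq> R" "R \<subseteq> cbox a b"
  shows "fn (box a b) \<le> fn R"
proof -
  have "sets \<mu> = sets borel" using \<mu> unfolding radon_measure_def by (elim conjE)
  then have m: "measure \<mu> (box a b) \<le> measure \<mu> R"
    by (intro measure_mono_fmeasurable[OF R(2) _ radon_fmeasurable[OF \<mu> rectangle_borel[OF R(1)] R(3)]]) simp
  have d: "diameter (box a b) \<le> diameter R"
    by (rule diameter_subset[OF R(2) bounded_subset[OF bounded_cbox R(3)]])
  have W: "wmeas w R = wmeas w (box a b)" unfolding wmeas_def by (rule set_integral_sandwich[OF R(2,3)])
  show ?thesis
    unfolding rect_functional_def W
    using d m diameter_nonneg[of a b] W_pos[OF ab] \<delta>0 p1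
    by (intro mult_mono powr_mono2 divide_right_mono) auto
qed

text \<open>Joins the two regimes at a threshold \<open>\<delta>\<^sub>0\<close>: below it the
  series bound holds with \<delta> replaced by the threshold in its constant, from it on the
  integral is 0 and \<open>Y = 0\<close> serves.\<close>

lemma rectangle_bound:
  assumes C: "C \<ge> 0" "\<delta> < \<delta>\<^sub>0 \<Longrightarrow> C0 * exp \<delta>\<^sub>0 * (\<delta>\<^sub>0 + 2) \<le> C"
    and large: "\<delta>\<^sub>0 \<le> \<delta> \<Longrightarrow> chain_const m TYPE('n) * (1 - core_eps m) powr (\<delta> - real CARD('n)) < 1"
    and R: "R \<in> rectangles"
  shows "enn_powr ((\<integral>\<^sup>+x\<in>R. ennreal (\<bar>f x - poly_proj m R f x\<bar> powr r * w x) \<partial>lebesgue) / ennreal (wmeas w R)) (1 / r)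
    \<le> ennreal (B_const q w * C * (1 / \<delta>) * fn R)"
proof -
  obtain a b where ab': "\<forall>i. a $ i < b $ i" and s: "box a b \<subseteq> R" "R \<subseteq> cbox a b"
    using rectangle_sandwich[OF R] by blast
  have ab: "a $ i < b $ i" for i using ab' by simp
  let ?I = "\<integral>\<^sup>+x\<in>box a b. ennreal (\<bar>f x - poly_proj m (box a b) f x\<bar> powr r * w x) \<partial>lebesgue"
  have I: "(\<integral>\<^sup>+x\<in>R. ennreal (\<bar>f x - poly_proj m R f x\<bar> powr r * w x) \<partial>lebesgue) = ?I"
    unfolding poly_proj_sandwich[OF s] by (rule set_nn_integral_sandwich[OF s])
  have W: "wmeas w R = wmeas w (box a b)" unfolding wmeas_def by (rule set_integral_sandwich[OF s])
  have W0: "0 < wmeas w (box a b)" by (rule W_pos[OF ab])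
  have "B_const q w * C * (1 / \<delta>) * fn R = (B_const q w * (1 / \<delta>)) * C * fn R" by (simp only: mult_ac)
  also have "\<dots> = C / \<kappa> * fn R" unfolding B_const_eq by simp
  finally have rhs: "B_const q w * C * (1 / \<delta>) * fn R = C / \<kappa> * fn R" .
  have "\<exists>Y. 0 \<le> Y \<and> ?I \<le> ennreal (Y powr r * wmeas w (box a b)) \<and> Y \<le> C / \<kappa> * fn R"
  proof (cases "\<delta> < \<delta>\<^sub>0")
    case True
    define Y where "Y = C0 * (A powr \<tau> * fn (box a b)) / (1 - (1 / 2) powr \<kappa>)"
    have \<theta>: "(1 / 2) powr \<kappa> < (1 :: real)"
      using \<kappa>_pos powr_less_mono2[of \<kappa> "1 / 2" 1] by auto
    have Y0: "Y \<ge> 0" unfolding Y_def using \<theta> C0_pos fn_nonneg by (intro divide_nonneg_nonneg mult_nonneg_nonneg) auto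
    have "Y = C0 * A powr \<tau> * (1 / (1 - (1 / 2) powr \<kappa>)) * fn (box a b)" by (simp add: Y_def)
    also have "\<dots> \<le> C0 * exp \<delta>\<^sub>0 * ((\<delta>\<^sub>0 + 2) / \<kappa>) * fn R"
    proof (intro mult_mono)
      show "A powr \<tau> \<le> exp \<delta>\<^sub>0"
        using A_powr_\<tau> \<kappa>_le True by (meson exp_le_cancel_iff less_imp_le order_trans)
      have "1 / (1 - (1 / 2) powr \<kappa>) \<le> (\<kappa> + 2) / \<kappa>" by (rule inverse_one_minus_two_powr[OF \<kappa>_pos])
      also have "\<dots> \<le> (\<delta>\<^sub>0 + 2) / \<kappa>" using \<kappa>_pos \<kappa>_le True by (intro divide_right_mono) auto
      finally show "1 / (1 - (1 / 2) powr \<kappa>) \<le> (\<delta>\<^sub>0 + 2) / \<kappa>" .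
      show "fn (box a b) \<le> fn R" by (rule fn_mono_box[OF ab R s])
    qed (use C0_pos \<theta> \<kappa>_pos \<delta>0 True fn_nonneg in \<open>auto intro!: mult_nonneg_nonneg\<close>)
    also have "\<dots> = C0 * exp \<delta>\<^sub>0 * (\<delta>\<^sub>0 + 2) / \<kappa> * fn R" by simp
    also have "\<dots> \<le> C / \<kappa> * fn R"
      using C(2)[OF True] \<kappa>_pos by (intro mult_right_mono divide_right_mono fn_nonneg) auto
    finally show ?thesis using box_bound[OF ab] Y0 unfolding Y_def by blast
  next
    case False
    then have "osc m f (box a b) = 0" using large by (intro osc_zero[OF ab]) simp
    then have "?I = 0" by (rule box_integral_zero[OF ab])
    moreover have "0 \<le> C / \<kappa> * fn R" using C(1) \<kappa>_pos fn_nonneg by simp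
    ultimately show ?thesis by (intro exI[of _ 0]) auto
  qed
  then obtain Y where Y: "0 \<le> Y" "?I \<le> ennreal (Y powr r * wmeas w (box a b))" "Y \<le> C / \<kappa> * fn R" by blast
  have "?I / ennreal (wmeas w (box a b)) \<le> ennreal (Y powr r * wmeas w (box a b)) / ennreal (wmeas w (box a b))"
    by (rule divide_right_mono_ennreal[OF Y(2)])
  also have "\<dots> = ennreal (Y powr r)" using W0 by (simp add: divide_ennreal)
  finally have "enn_powr (?I / ennreal (wmeas w (box a b))) (1 / r) \<le> ennreal Y"
    by (rule enn_powr_root_le[OF _ Y(1) r0])
  also have "\<dots> \<le> ennreal (C / \<kappa> * fn R)" by (rule ennreal_leI[OF Y(3)])
  finally show ?thesis unfolding I W rhs .
qed

end

text \<open>The left side is an extended real bounded by a finite number, so the inequality includes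
  the finiteness of the weighted integral.\<close>

theorem theorem2p5:
  fixes m :: nat
  shows "\<exists>C::real. C > 0 \<and>
    (\<forall>(p::real) (q::real) (\<delta>::real) (pw::real) (w :: real ^ 'n \<Rightarrow> real)
       (\<mu> :: (real ^ 'n) measure) (f :: real ^ 'n \<Rightarrow> real).
       1 \<le> p \<longrightarrow> p < real CARD('n) \<longrightarrow> 1 \<le> q \<longrightarrow> q \<le> p \<longrightarrow>
       w \<in> Aq_class q \<longrightarrow> Ainf_const w > 1 \<longrightarrow>
       \<delta> > 0 \<longrightarrow> pw > 0 \<longrightarrow>
       1 / p - 1 / pw = \<delta> / real CARD('n) * (1 / (q + ln (enn2real (Aq_const q w)))) \<longrightarrow>
       radon_measure \<mu> \<longrightarrow> locally_integrable f \<longrightarrow>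
       (\<forall>R\<in>rectangles. avg R (\<lambda>x. \<bar>f x - poly_proj m R f x\<bar>) \<le> rect_functional \<delta> p w \<mu> R) \<longrightarrow>
       (\<forall>R\<in>rectangles.
          enn_powr
            ((\<integral>\<^sup>+x\<in>R. ennreal (\<bar>f x - poly_proj m R f x\<bar> powr pw * w x) \<partial>lebesgue)
               / ennreal (wmeas w R))
            (1 / pw)
          \<le> ennreal (B_const q w * C * (1 / \<delta>) * rect_functional \<delta> p w \<mu> R)))"
proof -
  have \<theta>: "0 < 1 - core_eps m" "1 - core_eps m < 1" using core_eps(1,2)[of m] by auto
  \<comment> \<open>Enough shrinking steps to beat the loss of a single passage to a corner box;
    \<open>k\<close> depends only on \<open>n\<close> and \<open>m\<close>.\<close>
  obtain k where "(1 - core_eps m) ^ k < 1 / chain_const m TYPE('n)"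
    using real_arch_pow_inv[of "1 / chain_const m TYPE('n)" "1 - core_eps m"] \<theta> chain_const_pos[of m, where 'n='n] by auto
  then have k: "chain_const m TYPE('n) * (1 - core_eps m) ^ k < 1"
    using chain_const_pos[of m, where 'n='n] by (simp add: pos_less_divide_eq mult.commute)
  \<comment> \<open>The threshold for \<delta>: beyond it the exponent \<open>\<delta> - n\<close>
    in \<open>osc_zero\<close> is at least \<open>k\<close>.\<close>
  define d0 where "d0 = real CARD('n) + real k"
  have d0: "d0 > 0" by (simp add: d0_def add_pos_nonneg)
  \<comment> \<open>Below the threshold: the first two factors are \<open>C0\<close>,
    \<open>exp d0\<close> bounds \<open>A powr \<tau>\<close>, and \<open>d0 + 2\<close> is the
    numerator of the bound for the geometric series.\<close>
  define C where "C = (poly_const m TYPE('n))\<^sup>2 * 2 ^ CARD('n) * exp d0 * (d0 + 2)"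
  have C: "C > 0"
    unfolding C_def using poly_const_ge_1[of m, where 'n='n] d0 by (intro mult_pos_pos zero_less_power) auto
  show ?thesis
  proof (intro exI[of _ C] conjI allI impI ballI C)
    fix p q \<delta> pw :: real and w f :: "real ^ 'n \<Rightarrow> real" and \<mu> :: "(real ^ 'n) measure" and R :: "(real ^ 'n) set"
    assume a: "1 \<le> p" "p < real CARD('n)" "1 \<le> q" "q \<le> p" "w \<in> Aq_class q" "1 < Ainf_const w" "0 < \<delta>" "0 < pw"
      "1 / p - 1 / pw = \<delta> / real CARD('n) * (1 / (q + ln (enn2real (Aq_const q w))))"
      "radon_measure \<mu>" "locally_integrable f"
      "\<forall>R\<in>rectangles. avg R (\<lambda>x. \<bar>f x - poly_proj m R f x\<bar>) \<le> rect_functional \<delta> p w \<mu> R"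
      and R: "R \<in> rectangles"
    interpret Aq: nontrivial_Aq_weight w q
      by unfold_locales (use a in auto)
    interpret poincare_setting w q p \<delta> pw m \<mu> f
      by unfold_locales (use a in \<open>auto simp: Aq.A_def osc_def\<close>)
    show "enn_powr ((\<integral>\<^sup>+x\<in>R. ennreal (\<bar>f x - poly_proj m R f x\<bar> powr pw * w x) \<partial>lebesgue) / ennreal (wmeas w R)) (1 / pw)
        \<le> ennreal (B_const q w * C * (1 / \<delta>) * rect_functional \<delta> p w \<mu> R)"
    proof (rule rectangle_bound[OF _ _ _ R, of C d0])
      show "0 \<le> C" using C by simp
      show "C0 * exp d0 * (d0 + 2) \<le> C" unfolding C_def C0_def ..
      assume "d0 \<le> \<delta>"
      then have "(1 - core_eps m) powr (\<delta> - real CARD('n)) \<le> (1 - core_eps m) powr real k"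
        using \<theta> by (intro powr_mono') (auto simp: d0_def)
      also have "\<dots> = (1 - core_eps m) ^ k" using \<theta> by (simp add: powr_realpow)
      finally have "chain_const m TYPE('n) * (1 - core_eps m) powr (\<delta> - real CARD('n))
          \<le> chain_const m TYPE('n) * (1 - core_eps m) ^ k"
        using chain_const_pos[of m, where 'n='n] by (intro mult_left_mono) auto
      then show "chain_const m TYPE('n) * (1 - core_eps m) powr (\<delta> - real CARD('n)) < 1" using k by linarith
    qed
  qed
qed

end
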